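(* Fix a finite set $AP$ of atomic propositions and an operator precedence matrix $M$ on $2^{AP}$. Given a POTL formula $\varphi$ over $AP$, it is possible to build an operator precedence automaton over $(2^{AP},M)$ accepting the language denoted by $\varphi$, i.e. the set of words $x=P(1)\cdots P(n)$ compatible with $M$ such that $(w,1)\models\varphi$ for the OP word $w$ with labels $P(1),\dots,P(n)$, with at most $2^{O(|\varphi|)}$ states, where $|\varphi|$ is the length of $\varphi$.
   Context: Let $AP$ be partitioned into normal propositions and structural labels, and let $\#\notin AP$ be an end marker; $\Sigma=2^{AP}$. An operator precedence matrix (OPM) $M$ on $\Sigma$ is a partial function $M:(\Sigma\cup\{\#\})^2\to\{\lessdot,\doteq,\gtrdot\}$, defined only on sets containing exactly one structural label, with $M(a,b)$ depending only on the structural labels in $a$ and $b$. Write $a\,\pi\,b$ for $M(a,b)=\pi$; by convention $\#\lessdot b$ for every $b$ and $a\gtrdot\#$ for every $a\in\Sigma$. A simple chain is a string $c_0c_1\dots c_\ell c_{\ell+1}$ with $\ell\ge1$, $c_0,c_{\ell+1}\in\Sigma\cup\{\#\}$, $c_1,\dots,c_\ell\in\Sigma$ and $c_0\lessdot c_1\doteq\dots\doteq c_\ell\gtrdot c_{\ell+1}$. A composed chain is a string $c_0s_0c_1s_1\dots c_\ell s_\ell c_{\ell+1}$ such that $c_0c_1\dots c_{\ell+1}$ is a simple chain and each $s_k\in\Sigma^*$ is either empty or such that $c_ks_kc_{k+1}$ is a chain; $(c_0,c_{\ell+1})$ is its context. A word $x\in\Sigma^*$ is compatible with $M$ if $M(c,d)$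 is defined for consecutive letters $c,d$ of $x$ and $M(a,b)$ is defined for each substring of $\#x\#$ that is a chain with context $(a,b)$. An OP word is $w=\langle U,M,P\rangle$ with $U=\{0,\dots,n+1\}$, $P(0)=P(n+1)=\#$, $P(1)\cdots P(n)$ compatible with $M$. Write $i\,\pi\,j$ if $P(i)\,\pi\,P(j)$. $\chi(i,j)$ holds iff $i<j-1$ and $P(i)\cdots P(j)$ is a chain. POTL formulas over $AP$: $\varphi::=a\mid\neg\varphi\mid\varphi\lor\varphi\mid\bigcirc^{\Pi}\varphi\mid\ominus^{\Pi}\varphi\mid\chi_F^{\Pi}\varphi\mid\chi_P^{\Pi}\varphi\mid\varphi\,\mathcal U_\chi^{\Pi}\,\varphi\mid\varphi\,\mathcal S_\chi^{\Pi}\,\varphi\mid\bigcirc_H^{\mu}\varphi\mid\ominus_H^{\mu}\varphi\mid\varphi\,\mathcal U_H^{\mu}\,\varphi\mid\varphi\,\mathcal S_H^{\mu}\,\varphi$, $a\in AP$, $\Pi\subseteq\{\lessdot,\doteq,\gtrdot\}$ nonempty, $\mu\in\{\lessdot,\gtrdot\}$. Semantics at position $i$ of $w$: $(w,i)\models a$ iff $a\in P(i)$; Booleans as usual. $\bigcirc^\Pi\varphi$: $i\,\pi\,(i+1)$ for some $\pi\in\Pi$ and $\varphi$ at $i+1$. $\ominus^\Pi\varphi$: $(i-1)\,\pi\,i$ for some $\pi\in\Pi$ and $\varphi$ at $i-1$. $\chi_F^\Pi\varphi$: some $j>i$ with $\chi(i,j)$, $i\,\pi\,j$ ($\pi\in\Pi$),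 $\varphi$ at $j$. $\chi_P^\Pi\varphi$: some $j<i$ with $\chi(j,i)$, $j\,\pi\,i$ ($\pi\in\Pi$), $\varphi$ at $j$. $\bigcirc_H^\lessdot\varphi$: some $h<i$ has $\chi(h,i)$, $h\lessdot i$, the set $\{k>i:\chi(h,k),h\lessdot k\}$ is nonempty and $\varphi$ holds at its minimum; $\ominus_H^\lessdot\varphi$: same with $\{k<i:\chi(h,k),h\lessdot k\}$, maximum. $\bigcirc_H^\gtrdot\varphi$: some $h>i$ has $\chi(i,h)$, $i\gtrdot h$, $\{k>i:\chi(k,h),k\gtrdot h\}$ nonempty and $\varphi$ at its minimum; $\ominus_H^\gtrdot\varphi$: same with $\{k<i:\chi(k,h),k\gtrdot h\}$, maximum. A path from $i$ to $j$ is $i=i_1<\dots<i_n=j$. For a set $\Gamma$ of paths, $(w,i)\models\varphi\,\mathcal U_\Gamma\,\psi$ iff for some $j\ge i$ a path in $\Gamma$ from $i$ to $j$ has $\varphi$ at $i_1,\dots,i_{n-1}$ and $\psi$ at $i_n$; $\varphi\,\mathcal S_\Gamma\,\psi$ iff for some $j\le i$ a path $j=i_1<\dots<i_n=i$ in $\Gamma$ has $\psi$ at $i_1$ and $\varphi$ at $i_2,\dots,i_n$. Summary path for $\Pi$: for each $p<n$, if $K_p=\{h\le j:\chi(i_p,h),\ i_p\,\pi\,h,\ \pi\in\Pi\}\ne\emptyset$ then $i_{p+1}=\max K_p$, else $i_{p+1}=i_p+1$ with $i_p\,\pi\,(i_p+1)$ for some $\pi\in\Pi$ (used by $\mathcal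 U_\chi^\Pi,\mathcal S_\chi^\Pi$). Yield-precedence hierarchical path: some $h<i$ has $\chi(h,i_p)$, $h\lessdot i_p$ for all $p$, no $k$ with $i_q<k<i_{q+1}$ and $\chi(h,k)$ (used by $\mathcal U_H^\lessdot,\mathcal S_H^\lessdot$). Take-precedence hierarchical path: some $h>j$ has $\chi(i_p,h)$, $i_p\gtrdot h$ for all $p$, no $k$ with $i_q<k<i_{q+1}$ and $\chi(k,h)$ (used by $\mathcal U_H^\gtrdot,\mathcal S_H^\gtrdot$). An operator precedence automaton (OPA) is $\mathcal A=(\Sigma,M,Q,I,F,\delta)$ with finite state set $Q$, $I,F\subseteq Q$, and $\delta=\delta_{push}\cup\delta_{shift}\cup\delta_{pop}$ with $\delta_{push},\delta_{shift}\subseteq Q\times\Sigma\times Q$, $\delta_{pop}\subseteq Q\times Q\times Q$. Configurations are $\langle x,q,\gamma\rangle$ with $x\in\Sigma^*\#$, $q\in Q$, $\gamma\in(\Sigma\times Q)^*\bot$; the top symbol of $\gamma$ is the letter of its topmost pair, or $\#$ if $\gamma=\bot$. Moves (with $b$ the next input symbol, possibly $\#$): push, if top $\lessdot b$: $\langle bx,p,\gamma\rangle\vdash\langle x,q,[b,p]\gamma\rangle$ for $(p,b,q)\in\delta_{push}$; shift, if $a\doteq b$: $\langle bx,q,[a,p]\gamma\rangle\vdash\langle x,r,[b,p]\gamma\rangle$ for $(q,b,r)\in\delta_{shift}$; pop, if $a\gtrdot b$: $\langle bx,q,[a,p]\gamma\rangle\vdash\langle bx,r,\gamma\rangle$ for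 $(q,p,r)\in\delta_{pop}$. $L(\mathcal A)=\{x\in\Sigma^*:\langle x\#,q_I,\bot\rangle\vdash^*\langle\#,q_F,\bot\rangle,\ q_I\in I,\ q_F\in F\}$. *)

theory Defs
  imports Complex_Main "HOL-Library.Landau_Symbols" "HOL-Library.Sublist"
begin

text \<open>
  The type \<open>'a\<close> plays the role of the set of atomic propositions, so that the alphabet
  \<open>2^AP\<close> is the type \<open>'a set\<close>. In \<open>'a symb\<close>, \<open>None\<close> is the end marker \<open>#\<close>.
\<close>

type_synonym 'a letter = "'a set"
type_synonym 'a symb = "'a letter option"

datatype prec = Yield | Equal | Take

type_synonym 'a opm = "'a symb \<Rightarrow> 'a symb \<Rightarrow> prec option"

text \<open>
  \<open>SL\<close> is the set of structural labels; its complement consists of the normal propositions.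
  The conventions on \<open>#\<close> are imposed for all letters, and \<open># \<lessdot> b\<close> also for \<open>b = #\<close>;
  otherwise the chain \<open>#x#\<close> would have an undefined context relation and no
  nonempty word would be compatible.
\<close>

definition is_opm :: "'a set \<Rightarrow> 'a opm \<Rightarrow> bool" where
  "is_opm SL M \<longleftrightarrow>
     (\<forall>a b. M (Some a) (Some b) \<noteq> None \<longrightarrow> (\<exists>!l. l \<in> a \<inter> SL) \<and> (\<exists>!l. l \<in> b \<inter> SL)) \<and>
     (\<forall>a a' b b'. a \<inter> SL = a' \<inter> SL \<longrightarrow> b \<inter> SL = b' \<inter> SL \<longrightarrow>
        M (Some a) (Some b) = M (Some a') (Some b')) \<and>
     (\<forall>b. M None b = Some Yield) \<and>
     (\<forall>a. M (Some a) None = Some Take)"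


subsection \<open>Chains, compatible words and OP words\<close>

definition simple_chain :: "'a opm \<Rightarrow> 'a symb list \<Rightarrow> bool" where
  "simple_chain M cs \<longleftrightarrow>
     (\<exists>l\<ge>1. length cs = l + 2 \<and>
        (\<forall>k\<in>{1..l}. cs ! k \<noteq> None) \<and>
        M (cs ! 0) (cs ! 1) = Some Yield \<and>
        (\<forall>k\<in>{1..<l}. M (cs ! k) (cs ! (k + 1)) = Some Equal) \<and>
        M (cs ! l) (cs ! (l + 1)) = Some Take)"

text \<open>In the second rule the chain is \<open>c\<^sub>0 s\<^sub>0 c\<^sub>1 s\<^sub>1 \<dots> c\<^sub>l s\<^sub>l c\<^bsub>l+1\<^esub>\<close>.\<close>

inductive chain :: "'a opm \<Rightarrow> 'a symb list \<Rightarrow> bool" for M :: "'a opm" where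
  simple: "simple_chain M cs \<Longrightarrow> chain M cs"
| composed: "\<lbrakk>simple_chain M cs; length cs = length ss + 1;
     \<forall>k<length ss. ss ! k = [] \<or> chain M (cs ! k # map Some (ss ! k) @ [cs ! (k + 1)])\<rbrakk>
    \<Longrightarrow> chain M (concat (map2 (\<lambda>c s. c # map Some s) (butlast cs) ss) @ [last cs])"

definition delimited :: "'a letter list \<Rightarrow> 'a symb list" where
  "delimited x = None # map Some x @ [None]"

definition compatible :: "'a opm \<Rightarrow> 'a letter list \<Rightarrow> bool" where
  "compatible M x \<longleftrightarrow>
     (\<forall>k. k + 1 < length x \<longrightarrow> M (Some (x ! k)) (Some (x ! (k + 1))) \<noteq> None) \<and>
     (\<forall>y. sublist y (delimited x) \<longrightarrow> chain M y \<longrightarrow> M (hd y) (last y) \<noteq> None)"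

text \<open>The OP word with labels \<open>x\<close> over a matrix \<open>M\<close> is represented by \<open>M\<close> and \<open>x\<close>.\<close>

definition positions :: "'a letter list \<Rightarrow> nat set" where
  "positions x = {0..length x + 1}"

definition label :: "'a letter list \<Rightarrow> nat \<Rightarrow> 'a symb" where
  "label x i = delimited x ! i"

definition prel :: "'a opm \<Rightarrow> 'a letter list \<Rightarrow> prec \<Rightarrow> nat \<Rightarrow> nat \<Rightarrow> bool" where
  "prel M x \<pi> i j \<longleftrightarrow> M (label x i) (label x j) = Some \<pi>"

definition chi :: "'a opm \<Rightarrow> 'a letter list \<Rightarrow> nat \<Rightarrow> nat \<Rightarrow> bool" where
  "chi M x i j \<longleftrightarrow> i \<in> positions x \<and> j \<in> positions x \<and> i + 1 < j \<and>
     chain M (map (label x) [i..<j + 1])"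


subsection \<open>Paths\<close>

definition is_path :: "'a letter list \<Rightarrow> nat list \<Rightarrow> bool" where
  "is_path x ps \<longleftrightarrow> ps \<noteq> [] \<and> sorted_wrt (<) ps \<and> set ps \<subseteq> positions x"

definition summary_path :: "'a opm \<Rightarrow> 'a letter list \<Rightarrow> prec set \<Rightarrow> nat list \<Rightarrow> bool" where
  "summary_path M x \<Pi> ps \<longleftrightarrow> is_path x ps \<and>
     (\<forall>p. p + 1 < length ps \<longrightarrow>
       (let K = {h. h \<le> last ps \<and> chi M x (ps ! p) h \<and> (\<exists>\<pi>\<in>\<Pi>. prel M x \<pi> (ps ! p) h)}
        in if K \<noteq> {} then ps ! (p + 1) = Max K
           else ps ! (p + 1) = ps ! p + 1 \<and> (\<exists>\<pi>\<in>\<Pi>. prel M x \<pi> (ps ! p) (ps ! p + 1))))"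

definition yield_path :: "'a opm \<Rightarrow> 'a letter list \<Rightarrow> nat list \<Rightarrow> bool" where
  "yield_path M x ps \<longleftrightarrow> is_path x ps \<and>
     (\<exists>h<hd ps.
       (\<forall>i\<in>set ps. chi M x h i \<and> prel M x Yield h i) \<and>
       (\<forall>q. q + 1 < length ps \<longrightarrow> \<not> (\<exists>k. ps ! q < k \<and> k < ps ! (q + 1) \<and> chi M x h k)))"

definition take_path :: "'a opm \<Rightarrow> 'a letter list \<Rightarrow> nat list \<Rightarrow> bool" where
  "take_path M x ps \<longleftrightarrow> is_path x ps \<and>
     (\<exists>h>last ps.
       (\<forall>i\<in>set ps. chi M x i h \<and> prel M x Take i h) \<and>
       (\<forall>q. q + 1 < length ps \<longrightarrow> \<not> (\<exists>k. ps ! q < k \<and> k < ps ! (q + 1) \<and> chi M x k h)))"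

definition until_on :: "(nat list \<Rightarrow> bool) \<Rightarrow> (nat \<Rightarrow> bool) \<Rightarrow> (nat \<Rightarrow> bool) \<Rightarrow> nat \<Rightarrow> bool" where
  "until_on \<Gamma> A B i \<longleftrightarrow>
     (\<exists>ps. \<Gamma> ps \<and> hd ps = i \<and> (\<forall>k\<in>set (butlast ps). A k) \<and> B (last ps))"

definition since_on :: "(nat list \<Rightarrow> bool) \<Rightarrow> (nat \<Rightarrow> bool) \<Rightarrow> (nat \<Rightarrow> bool) \<Rightarrow> nat \<Rightarrow> bool" where
  "since_on \<Gamma> A B i \<longleftrightarrow>
     (\<exists>ps. \<Gamma> ps \<and> last ps = i \<and> B (hd ps) \<and> (\<forall>k\<in>set (tl ps). A k))"


subsection \<open>POTL\<close>

datatype hprec = HYield | HTake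

datatype 'a potl =
    Atom 'a
  | Neg "'a potl"
  | Or "'a potl" "'a potl"
  | Next "prec set" "'a potl"
  | Back "prec set" "'a potl"
  | ChainNext "prec set" "'a potl"
  | ChainBack "prec set" "'a potl"
  | Until "prec set" "'a potl" "'a potl"
  | Since "prec set" "'a potl" "'a potl"
  | HNext hprec "'a potl"
  | HBack hprec "'a potl"
  | HUntil hprec "'a potl" "'a potl"
  | HSince hprec "'a potl" "'a potl"

text \<open>The sets of precedence relations decorating the operators must be nonempty.\<close>

primrec wf_potl :: "'a potl \<Rightarrow> bool" where
  "wf_potl (Atom a) \<longleftrightarrow> True"
| "wf_potl (Neg \<phi>) \<longleftrightarrow> wf_potl \<phi>"
| "wf_potl (Or \<phi> \<psi>) \<longleftrightarrow> wf_potl \<phi> \<and> wf_potl \<psi>"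
| "wf_potl (Next \<Pi> \<phi>) \<longleftrightarrow> \<Pi> \<noteq> {} \<and> wf_potl \<phi>"
| "wf_potl (Back \<Pi> \<phi>) \<longleftrightarrow> \<Pi> \<noteq> {} \<and> wf_potl \<phi>"
| "wf_potl (ChainNext \<Pi> \<phi>) \<longleftrightarrow> \<Pi> \<noteq> {} \<and> wf_potl \<phi>"
| "wf_potl (ChainBack \<Pi> \<phi>) \<longleftrightarrow> \<Pi> \<noteq> {} \<and> wf_potl \<phi>"
| "wf_potl (Until \<Pi> \<phi> \<psi>) \<longleftrightarrow> \<Pi> \<noteq> {} \<and> wf_potl \<phi> \<and> wf_potl \<psi>"
| "wf_potl (Since \<Pi> \<phi> \<psi>) \<longleftrightarrow> \<Pi> \<noteq> {} \<and> wf_potl \<phi> \<and> wf_potl \<psi>"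
| "wf_potl (HNext \<mu> \<phi>) \<longleftrightarrow> wf_potl \<phi>"
| "wf_potl (HBack \<mu> \<phi>) \<longleftrightarrow> wf_potl \<phi>"
| "wf_potl (HUntil \<mu> \<phi> \<psi>) \<longleftrightarrow> wf_potl \<phi> \<and> wf_potl \<psi>"
| "wf_potl (HSince \<mu> \<phi> \<psi>) \<longleftrightarrow> wf_potl \<phi> \<and> wf_potl \<psi>"

text \<open>A decorated operator counts as one symbol.\<close>

primrec potl_length :: "'a potl \<Rightarrow> nat" where
  "potl_length (Atom a) = 1"
| "potl_length (Neg \<phi>) = 1 + potl_length \<phi>"
| "potl_length (Or \<phi> \<psi>) = 1 + potl_length \<phi> + potl_length \<psi>"
| "potl_length (Next \<Pi> \<phi>) = 1 + potl_length \<phi>"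
| "potl_length (Back \<Pi> \<phi>) = 1 + potl_length \<phi>"
| "potl_length (ChainNext \<Pi> \<phi>) = 1 + potl_length \<phi>"
| "potl_length (ChainBack \<Pi> \<phi>) = 1 + potl_length \<phi>"
| "potl_length (Until \<Pi> \<phi> \<psi>) = 1 + potl_length \<phi> + potl_length \<psi>"
| "potl_length (Since \<Pi> \<phi> \<psi>) = 1 + potl_length \<phi> + potl_length \<psi>"
| "potl_length (HNext \<mu> \<phi>) = 1 + potl_length \<phi>"
| "potl_length (HBack \<mu> \<phi>) = 1 + potl_length \<phi>"
| "potl_length (HUntil \<mu> \<phi> \<psi>) = 1 + potl_length \<phi> + potl_length \<psi>"
| "potl_length (HSince \<mu> \<phi> \<psi>) = 1 + potl_length \<phi> + potl_length \<psi>"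

fun sat :: "'a opm \<Rightarrow> 'a letter list \<Rightarrow> nat \<Rightarrow> 'a potl \<Rightarrow> bool" where
  "sat M x i (Atom a) \<longleftrightarrow> (\<exists>A. label x i = Some A \<and> a \<in> A)"
| "sat M x i (Neg \<phi>) \<longleftrightarrow> \<not> sat M x i \<phi>"
| "sat M x i (Or \<phi> \<psi>) \<longleftrightarrow> sat M x i \<phi> \<or> sat M x i \<psi>"
| "sat M x i (Next \<Pi> \<phi>) \<longleftrightarrow>
     i + 1 \<in> positions x \<and> (\<exists>\<pi>\<in>\<Pi>. prel M x \<pi> i (i + 1)) \<and> sat M x (i + 1) \<phi>"
| "sat M x i (Back \<Pi> \<phi>) \<longleftrightarrow>
     i \<ge> 1 \<and> (\<exists>\<pi>\<in>\<Pi>. prel M x \<pi> (i - 1) i) \<and> sat M x (i - 1) \<phi>"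
| "sat M x i (ChainNext \<Pi> \<phi>) \<longleftrightarrow>
     (\<exists>j>i. chi M x i j \<and> (\<exists>\<pi>\<in>\<Pi>. prel M x \<pi> i j) \<and> sat M x j \<phi>)"
| "sat M x i (ChainBack \<Pi> \<phi>) \<longleftrightarrow>
     (\<exists>j<i. chi M x j i \<and> (\<exists>\<pi>\<in>\<Pi>. prel M x \<pi> j i) \<and> sat M x j \<phi>)"
| "sat M x i (Until \<Pi> \<phi> \<psi>) \<longleftrightarrow>
     until_on (summary_path M x \<Pi>) (\<lambda>k. sat M x k \<phi>) (\<lambda>k. sat M x k \<psi>) i"
| "sat M x i (Since \<Pi> \<phi> \<psi>) \<longleftrightarrow>
     since_on (summary_path M x \<Pi>) (\<lambda>k. sat M x k \<phi>) (\<lambda>k. sat M x k \<psi>) i"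
| "sat M x i (HNext HYield \<phi>) \<longleftrightarrow>
     (\<exists>h<i. chi M x h i \<and> prel M x Yield h i \<and>
        {k. k > i \<and> chi M x h k \<and> prel M x Yield h k} \<noteq> {} \<and>
        sat M x (Min {k. k > i \<and> chi M x h k \<and> prel M x Yield h k}) \<phi>)"
| "sat M x i (HNext HTake \<phi>) \<longleftrightarrow>
     (\<exists>h>i. chi M x i h \<and> prel M x Take i h \<and>
        {k. k > i \<and> chi M x k h \<and> prel M x Take k h} \<noteq> {} \<and>
        sat M x (Min {k. k > i \<and> chi M x k h \<and> prel M x Take k h}) \<phi>)"
| "sat M x i (HBack HYield \<phi>) \<longleftrightarrow>
     (\<exists>h<i. chi M x h i \<and> prel M x Yield h i \<and>
        {k. k < i \<and> chi M x h k \<and> prel M x Yield h k} \<noteq> {} \<and>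
        sat M x (Max {k. k < i \<and> chi M x h k \<and> prel M x Yield h k}) \<phi>)"
| "sat M x i (HBack HTake \<phi>) \<longleftrightarrow>
     (\<exists>h>i. chi M x i h \<and> prel M x Take i h \<and>
        {k. k < i \<and> chi M x k h \<and> prel M x Take k h} \<noteq> {} \<and>
        sat M x (Max {k. k < i \<and> chi M x k h \<and> prel M x Take k h}) \<phi>)"
| "sat M x i (HUntil HYield \<phi> \<psi>) \<longleftrightarrow>
     until_on (yield_path M x) (\<lambda>k. sat M x k \<phi>) (\<lambda>k. sat M x k \<psi>) i"
| "sat M x i (HUntil HTake \<phi> \<psi>) \<longleftrightarrow>
     until_on (take_path M x) (\<lambda>k. sat M x k \<phi>) (\<lambda>k. sat M x k \<psi>) i"
| "sat M x i (HSince HYield \<phi> \<psi>) \<longleftrightarrow>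
     since_on (yield_path M x) (\<lambda>k. sat M x k \<phi>) (\<lambda>k. sat M x k \<psi>) i"
| "sat M x i (HSince HTake \<phi> \<psi>) \<longleftrightarrow>
     since_on (take_path M x) (\<lambda>k. sat M x k \<phi>) (\<lambda>k. sat M x k \<psi>) i"

definition potl_language :: "'a opm \<Rightarrow> 'a potl \<Rightarrow> 'a letter list set" where
  "potl_language M \<phi> = {x. compatible M x \<and> sat M x 1 \<phi>}"


subsection \<open>Operator precedence automata\<close>

record ('q, 'a) opa =
  states :: "'q set"
  initial :: "'q set"
  final :: "'q set"
  push :: "('q \<times> 'a letter \<times> 'q) set"
  shift :: "('q \<times> 'a letter \<times> 'q) set"
  pop :: "('q \<times> 'q \<times> 'q) set"

definition is_opa :: "('q, 'a) opa \<Rightarrow> bool" where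
  "is_opa \<A> \<longleftrightarrow> finite (states \<A>) \<and> initial \<A> \<subseteq> states \<A> \<and> final \<A> \<subseteq> states \<A> \<and>
     push \<A> \<subseteq> states \<A> \<times> UNIV \<times> states \<A> \<and>
     shift \<A> \<subseteq> states \<A> \<times> UNIV \<times> states \<A> \<and>
     pop \<A> \<subseteq> states \<A> \<times> states \<A> \<times> states \<A>"

text \<open>
  A configuration consists of the remaining input without its final \<open>#\<close>, the current state
  and the stack, topmost pair first and without the bottom symbol. Push and shift moves read
  letters only, since their transition relations contain no \<open>#\<close>.
\<close>

type_synonym ('q, 'a) config = "'a letter list \<times> 'q \<times> ('a letter \<times> 'q) list"

definition next_symb :: "'a letter list \<Rightarrow> 'a symb" where
  "next_symb x = (case x of [] \<Rightarrow> None | b # _ \<Rightarrow> Some b)"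

definition top_symb :: "('a letter \<times> 'q) list \<Rightarrow> 'a symb" where
  "top_symb \<gamma> = (case \<gamma> of [] \<Rightarrow> None | (a, _) # _ \<Rightarrow> Some a)"

inductive move :: "'a opm \<Rightarrow> ('q, 'a) opa \<Rightarrow> ('q, 'a) config \<Rightarrow> ('q, 'a) config \<Rightarrow> bool"
  for M :: "'a opm" and \<A> :: "('q, 'a) opa" where
  push_move: "\<lbrakk>M (top_symb \<gamma>) (Some b) = Some Yield; (p, b, q) \<in> push \<A>\<rbrakk>
    \<Longrightarrow> move M \<A> (b # x, p, \<gamma>) (x, q, (b, p) # \<gamma>)"
| shift_move: "\<lbrakk>M (Some a) (Some b) = Some Equal; (q, b, r) \<in> shift \<A>\<rbrakk>
    \<Longrightarrow> move M \<A> (b # x, q, (a, p) # \<gamma>) (x, r, (b, p) # \<gamma>)"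
| pop_move: "\<lbrakk>M (Some a) (next_symb x) = Some Take; (q, p, r) \<in> pop \<A>\<rbrakk>
    \<Longrightarrow> move M \<A> (x, q, (a, p) # \<gamma>) (x, r, \<gamma>)"

definition opa_language :: "'a opm \<Rightarrow> ('q, 'a) opa \<Rightarrow> 'a letter list set" where
  "opa_language M \<A> =
     {x. \<exists>q\<^sub>I\<in>initial \<A>. \<exists>q\<^sub>F\<in>final \<A>. (move M \<A>)\<^sup>*\<^sup>* (x, q\<^sub>I, []) ([], q\<^sub>F, [])}"

end

theory Submission
  imports Defs
begin

text \<open>
  On a compatible word all runs of an automaton pass through the same configurations, and a
  configuration is determined by the position \<open>i\<close> of the stack top and the next position \<open>p\<close>; the
  pairs \<open>(i, p)\<close> that occur are those with \<open>p = i + 1\<close> or \<open>\<chi>(i, p)\<close>. An accepting run is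
  therefore a labelling of these edges by states. Every POTL operator is a diamond, or a fixpoint
  of diamonds, along a relation that can be read off the edges, and a pop move relates exactly
  the three edges needed to check a diamond: the popped one, the one where it was pushed, and
  the one it uncovers. For until and since this uses that summary paths may be replaced by arbitrary
  paths of edges, since edges do not cross. So a state only has to guess the truth values of linearly
  many formulas at \<open>i\<close> and \<open>p\<close>, plus one accumulator bit per formula.
\<close>

subsection \<open>Runs on positions\<close>

text \<open>Compatibility is tested by the moves themselves: an undefined precedence is the only
  thing that can block the skeleton before its final configuration \<open>(Suc n, [])\<close>, and
  the pairs compared on the way are adjacent positions and contexts of chains. Reaching that
  configuration is therefore equivalent to compatibility. Soundness of the guesses comes from
  uniqueness. True values pass every check (\<open>dia_ok_canon\<close>), and the checks determine
  the values of a diamond from those of its argument (\<open>dia_unique\<close>); so guessed values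
  that pass must be the true ones. The exponent is 12 per symbol of the formula, from three sets of
  formulas in a state and at most four closure elements per symbol. The two labels in a state cost a
  factor that depends on the alphabet only.\<close>

fun top_pos :: "(nat \<times> nat) list \<Rightarrow> nat" where
  "top_pos [] = 0"
| "top_pos ((j, s) # js) = j"

fun wf_stack :: "(nat \<times> nat) list \<Rightarrow> bool" where
  "wf_stack [] = True"
| "wf_stack ((j, s) # js) = (top_pos js < s \<and> s \<le> j \<and> wf_stack js)"

lemma wf_stack_le_top_pos:
  assumes "wf_stack js" "(j, s) \<in> set js"
  shows "j \<le> top_pos js" "s \<le> top_pos js"
proof -
  have "j \<le> top_pos js \<and> s \<le> top_pos js"
    using assms by (induction js rule: wf_stack.induct) auto
  then show "j \<le> top_pos js" "s \<le> top_pos js" by auto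
qed

lemma top_pos_in: "js \<noteq> [] \<Longrightarrow> top_pos js \<in> fst ` set js"
  by (cases js rule: top_pos.cases) auto

locale op_word =
  fixes M :: "'a opm" and x :: "'a letter list"
  assumes None_left: "M None b = Some Yield" and None_right: "M (Some a) None = Some Take"
begin

abbreviation "n \<equiv> length x"
abbreviation "pr \<equiv> prel M x"
abbreviation "lab \<equiv> label x"

lemma lab_0 [simp]: "lab 0 = None"
  by (simp add: label_def delimited_def)

lemma lab_end [simp]: "lab (Suc n) = None"
  by (simp add: label_def delimited_def nth_append)

lemma lab_Suc: "i < n \<Longrightarrow> lab (Suc i) = Some (x ! i)"
  by (simp add: label_def delimited_def nth_append)

lemma lab_letter: "1 \<le> i \<Longrightarrow> i \<le> n \<Longrightarrow> lab i = Some (x ! (i - 1))"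
  using lab_Suc[of "i - 1"] by simp

lemma prel_unique: "pr \<pi> i j \<Longrightarrow> pr \<pi>' i j \<Longrightarrow> \<pi> = \<pi>'"
  by (simp add: prel_def)

lemma prel_0 [simp]: "pr \<pi> 0 j \<longleftrightarrow> \<pi> = Yield"
  by (auto simp: prel_def None_left)

lemma prel_end: "1 \<le> i \<Longrightarrow> i \<le> n \<Longrightarrow> pr \<pi> i (Suc n) \<longleftrightarrow> \<pi> = Take"
  by (auto simp: prel_def None_right lab_letter)

text \<open>
  The precedence relations alone determine which moves an automaton makes on \<open>x\<close>, so its runs all
  share one skeleton. In a configuration \<open>(p, js)\<close>, \<open>p\<close> is the next position to be read, and a stack
  entry \<open>(j, s)\<close> stands for a pair that was pushed at position \<open>s\<close> and whose letter is now that of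
  position \<open>j\<close>; the empty stack has top position \<open>0\<close>.
\<close>

inductive skel :: "nat \<times> (nat \<times> nat) list \<Rightarrow> nat \<times> (nat \<times> nat) list \<Rightarrow> bool" where
  skel_push: "p \<le> n \<Longrightarrow> pr Yield (top_pos js) p \<Longrightarrow> skel (p, js) (Suc p, (p, p) # js)"
| skel_shift: "p \<le> n \<Longrightarrow> pr Equal j p \<Longrightarrow> skel (p, (j, s) # js) (Suc p, (p, s) # js)"
| skel_pop: "pr Take j p \<Longrightarrow> skel (p, (j, s) # js) (p, js)"

text \<open>Reachability from the initial configuration in curried form, so that rule induction
  speaks of position and stack separately; \<open>reach_iff\<close> ties it to
  \<open>skel\<close>.\<close>

inductive reach :: "nat \<Rightarrow> (nat \<times> nat) list \<Rightarrow> bool" where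
  reach_init: "reach 1 []"
| reach_push: "reach p js \<Longrightarrow> p \<le> n \<Longrightarrow> pr Yield (top_pos js) p \<Longrightarrow> reach (Suc p) ((p, p) # js)"
| reach_shift: "reach p ((j, s) # js) \<Longrightarrow> p \<le> n \<Longrightarrow> pr Equal j p \<Longrightarrow> reach (Suc p) ((p, s) # js)"
| reach_pop: "reach p ((j, s) # js) \<Longrightarrow> pr Take j p \<Longrightarrow> reach p js"

lemma reach_skel: "reach p js \<Longrightarrow> skel (p, js) (p', js') \<Longrightarrow> reach p' js'"
  by (auto elim!: skel.cases intro: reach.intros)

lemma reach_later:
  assumes "skel\<^sup>*\<^sup>* (p, js) (p', js')" "reach p js" shows "reach p' js'"
  using assms by (induction rule: rtranclp_induct2) (auto intro: reach_skel)

lemma reach_iff: "reach p js \<longleftrightarrow> skel\<^sup>*\<^sup>* (1, []) (p, js)"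
proof
  show "reach p js \<Longrightarrow> skel\<^sup>*\<^sup>* (1, []) (p, js)"
    by (induction rule: reach.induct) (auto intro: skel.intros rtranclp.rtrancl_into_rtrancl)
qed (auto intro: reach_later reach_init simp del: One_nat_def)

text \<open>The three rules ask for different values of the same matrix entry.\<close>

lemma skel_det: "skel c d \<Longrightarrow> skel c d' \<Longrightarrow> d = d'"
  by (auto elim!: skel.cases dest: prel_unique)

text \<open>By determinism, of two runs from one configuration one is a prefix of the other.\<close>

lemma linear:
  assumes "skel\<^sup>*\<^sup>* c d" "skel\<^sup>*\<^sup>* c d'" shows "skel\<^sup>*\<^sup>* d d' \<or> skel\<^sup>*\<^sup>* d' d"
  using assms
proof (induction rule: rtranclp_induct)
  case (step d e)
  from step.IH[OF step.prems] show ?case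
  proof
    assume "skel\<^sup>*\<^sup>* d d'"
    then show ?thesis
    proof (cases rule: converse_rtranclpE)
      case base
      then show ?thesis using step.hyps by blast
    next
      case (step e')
      then show ?thesis using skel_det[OF \<open>skel d e\<close> step(1)] by simp
    qed
  next
    assume "skel\<^sup>*\<^sup>* d' d"
    then show ?thesis using step.hyps(2) by (meson rtranclp.rtrancl_into_rtrancl)
  qed
qed simp

lemma reach_linear:
  "reach p js \<Longrightarrow> reach p' js' \<Longrightarrow> skel\<^sup>*\<^sup>* (p, js) (p', js') \<or> skel\<^sup>*\<^sup>* (p', js') (p, js)"
  using linear unfolding reach_iff by blast

section \<open>Stack discipline and the order of configurations\<close>

lemma reach_wf:
  "reach p js \<Longrightarrow> wf_stack js \<and> top_pos js < p \<and> 1 \<le> p \<and> p \<le> Suc n"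
proof (induction rule: reach.induct)
  case (reach_shift p j s js)
  then show ?case by auto
qed auto

text \<open>Only the current input position enters the stack, and the input never moves back. So a
  position below \<open>p\<close> that has left the stack stays out, which is how later
  configurations are excluded.\<close>

lemma skel_mono:
  assumes "skel\<^sup>*\<^sup>* (p, js) (p', js')"
  shows "p \<le> p' \<and> fst ` set js' \<subseteq> fst ` set js \<union> {p..} \<and> snd ` set js' \<subseteq> snd ` set js \<union> {p..}"
  using assms
proof (induction rule: rtranclp_induct2)
  case (step p' js' p'' js'')
  from step.hyps(2) show ?case using step.IH by (cases rule: skel.cases) (auto simp: image_iff)
qed auto

text \<open>Push and shift advance the input; a pop keeps it and uncovers a smaller top, by the
  strict order in \<open>wf_stack\<close>. Runs are therefore acyclic and of bounded length.\<close>

lemma skel_less: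
  assumes "reach p js" "skel (p, js) (p', js')"
  shows "p < p' \<or> p = p' \<and> top_pos js' < top_pos js"
  using assms(2) reach_wf[OF assms(1)] by (cases rule: skel.cases) auto

lemma later_less:
  assumes "skel\<^sup>*\<^sup>* (p, js) (p', js')" "reach p js"
  shows "(p', js') = (p, js) \<or> p < p' \<or> p = p' \<and> top_pos js' < top_pos js"
  using assms
proof (induction rule: rtranclp_induct2)
  case (step p' js' p'' js'')
  then have "reach p' js'" using reach_later by blast
  from skel_less[OF this step.hyps(2)] step.IH[OF step.prems] show ?case by auto
qed auto

text \<open>Reachable configurations lie on one run, so comparing their numbers decides which comes
  first. The first step \<open>d\<close> is exposed because the lemmas below distinguish cases on
  it.\<close>

lemma reach_order:
  assumes "reach p js" "reach p' js'" "p < p' \<or> p = p' \<and> top_pos js' < top_pos js"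
  obtains d where "skel (p, js) d" "skel\<^sup>*\<^sup>* d (p', js')"
proof -
  have "\<not> skel\<^sup>*\<^sup>* (p', js') (p, js)"
    using later_less[of p' js' p js] assms by auto
  then have "skel\<^sup>*\<^sup>* (p, js) (p', js')" using reach_linear[OF assms(1,2)] by blast
  moreover have "(p, js) \<noteq> (p', js')" using assms(3) by auto
  ultimately show thesis using that by (auto elim: converse_rtranclpE)
qed

text \<open>
  The configurations of the skeleton correspond one-to-one to the edges: those with a fixed \<open>i\<close> are the
  row of \<open>i\<close>, those with a fixed \<open>p\<close> the column of \<open>p\<close>. In \<open>pop_event j p i s\<close>, the edge \<open>(i, p)\<close> is
  the row successor of \<open>(i, s)\<close>, the edge where the popped pair was pushed, and the column
  successor of \<open>(j, p)\<close>.
\<close>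

definition edge :: "nat \<Rightarrow> nat \<Rightarrow> bool" where
  "edge i p \<longleftrightarrow> (\<exists>js. reach p js \<and> top_pos js = i)"

definition pop_event :: "nat \<Rightarrow> nat \<Rightarrow> nat \<Rightarrow> nat \<Rightarrow> bool" where
  "pop_event j p i s \<longleftrightarrow> (\<exists>js. reach p ((j, s) # js) \<and> pr Take j p \<and> top_pos js = i)"

lemma edge_less: "edge i p \<Longrightarrow> i < p \<and> p \<le> Suc n"
  unfolding edge_def using reach_wf by auto

text \<open>Unless \<open>i\<close> takes \<open>p\<close>, the next move reads \<open>p\<close>, so
  this configuration is the last of its column, in which tops only decrease.\<close>

lemma col_end:
  assumes "edge i p" "\<not> pr Take i p" "edge k p" shows "i \<le> k"
proof (rule ccontr)
  assume "\<not> i \<le> k"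
  obtain js js' where js: "reach p js" "top_pos js = i" "reach p js'" "top_pos js' = k"
    using assms unfolding edge_def by auto
  obtain d where d: "skel (p, js) d" "skel\<^sup>*\<^sup>* d (p, js')"
    using reach_order[OF js(1,3)] \<open>\<not> i \<le> k\<close> js by auto
  from d(1) show False
    using d(2) assms(2) js(2) by (cases rule: skel.cases) (auto dest!: skel_mono)
qed

text \<open>If \<open>i\<close> does not yield to \<open>p\<close>, the next move is a shift or a
  pop. It removes \<open>i\<close> from the stack, and \<open>skel_mono\<close> forbids its
  return.\<close>

lemma row_end:
  assumes "edge i p" "\<not> pr Yield i p" "edge i k" shows "k \<le> p"
proof (rule ccontr)
  assume "\<not> k \<le> p"
  obtain js js' where js: "reach p js" "top_pos js = i" "reach k js'" "top_pos js' = i"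
    using assms unfolding edge_def by auto
  obtain d where d: "skel (p, js) d" "skel\<^sup>*\<^sup>* d (k, js')"
    using reach_order[OF js(1,3)] \<open>\<not> k \<le> p\<close> js by auto
  \<comment> \<open>Position 0 stands for the empty stack and is no stack entry; it is excluded
    because \<open>#\<close> yields to everything.\<close>
  have "i \<noteq> 0" using assms(2) by (metis prel_0)
  then have i: "i \<in> fst ` set js'" using js top_pos_in[of js'] by (cases js') auto
  have "i < p" using edge_less assms by auto
  from d(1) show False
  proof (cases rule: skel.cases)
    case (skel_shift j s l)
    have "i \<in> fst ` set ((p, s) # l)" 
      using skel_mono[of "Suc p" "(p,s)#l" k js'] skel_shift d(2) i \<open>i < p\<close> by auto
    then have "i \<in> fst ` set l" using \<open>i < p\<close> by auto
    moreover have "wf_stack ((i,s)#l)" using skel_shift js(2) reach_wf[OF js(1)] by auto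
    ultimately show False using wf_stack_le_top_pos(1)[of l] by fastforce
  next
    case (skel_pop j s l)
    have "i \<in> fst ` set l" 
      using skel_mono[of p l k js'] skel_pop d(2) i \<open>i < p\<close> by auto
    moreover have "wf_stack ((i,s)#l)" using skel_pop js(2) reach_wf[OF js(1)] by auto
    ultimately show False using wf_stack_le_top_pos(1)[of l] by fastforce
  qed (use assms(2) js(2) in auto)
qed

text \<open>What lies below an entry is untouched while the entry is there, so \<open>vs\<close> is
  still the stack over which it was pushed. A shift changes \<open>j\<close> but keeps
  \<open>s\<close>.\<close>

lemma reach_stack:
  "reach p js \<Longrightarrow> js = us @ (j, s) # vs \<Longrightarrow> reach s vs \<and> s \<le> n \<and> pr Yield (top_pos vs) s"
proof (induction arbitrary: us j rule: reach.induct)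
  case (reach_push p js)
  then show ?case by (cases us) auto
next
  case (reach_shift p j' s' js)
  show ?case
  proof (cases us)
    case Nil
    then show ?thesis using reach_shift.IH[of "[]"] reach_shift.prems by auto
  next
    case (Cons u us')
    then show ?thesis using reach_shift.IH[of "(j', s') # us'"] reach_shift.prems by auto
  qed
next
  case (reach_pop p j' s' js)
  then show ?case using reach_pop.IH[of "(j', s') # us"] by auto
qed auto

section \<open>Pop events and the edges next to them\<close>

lemma pop_event_edges:
  assumes "pop_event j p i s"
  shows "edge j p" "pr Take j p" "edge i s" "pr Yield i s" "s \<le> n" "edge i p"
    "i < s" "s \<le> j" "j < p"
proof -
  obtain js where js: "reach p ((j, s) # js)" "pr Take j p" "top_pos js = i"
    using assms unfolding pop_event_def by auto
  have "reach s js \<and> s \<le> n \<and> pr Yield (top_pos js) s" using reach_stack[OF js(1), of "[]"] by auto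
  then show "edge i s" "pr Yield i s" "s \<le> n" using js unfolding edge_def by auto
  show "edge j p" using js unfolding edge_def by (meson top_pos.simps)
  show "pr Take j p" by fact
  show "edge i p" using js reach_pop[of p j s js] unfolding edge_def by auto
  show "i < s" "s \<le> j" "j < p" using reach_wf[OF js(1)] js(3) by auto
qed

text \<open>From the push at \<open>s\<close> to the pop at \<open>p\<close> the pair covers
  \<open>i\<close>. An edge \<open>(i, k)\<close> in between would have \<open>s\<close> on its
  stack, but push positions there are at most \<open>i < s\<close>.\<close>

lemma pop_event_row_gap:
  assumes "pop_event j p i s" "edge i k" "s < k" shows "p \<le> k"
proof (rule ccontr)
  assume "\<not> p \<le> k"
  obtain js js' where js: "reach p ((j, s) # js)" "top_pos js = i" "reach k js'" "top_pos js' = i"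
    using assms unfolding pop_event_def edge_def by auto
  obtain d where "skel (k, js') d" "skel\<^sup>*\<^sup>* d (p, (j, s) # js)"
    using reach_order[OF js(3,1)] \<open>\<not> p \<le> k\<close> by auto
  then have "skel\<^sup>*\<^sup>* (k, js') (p, (j, s) # js)" by (rule converse_rtranclp_into_rtranclp)
  from skel_mono[OF this] have "s \<in> snd ` set js'" using \<open>s < k\<close> by auto
  then have "s \<le> i" using wf_stack_le_top_pos(2)[of js'] reach_wf[OF js(3)] js(4) by auto
  then show False using pop_event_edges(7)[OF assms(1)] by simp
qed

text \<open>The pop leads from top \<open>j\<close> straight to top \<open>i\<close>, and the tops
  in column \<open>p\<close> decrease.\<close>

lemma pop_event_col_gap:
  assumes "pop_event j p i s" "edge k p" "k < j" shows "k \<le> i"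
proof -
  obtain js js' where js: "reach p ((j, s) # js)" "pr Take j p" "top_pos js = i" "reach p js'" "top_pos js' = k"
    using assms unfolding pop_event_def edge_def by auto
  obtain d where d: "skel (p, (j, s) # js) d" "skel\<^sup>*\<^sup>* d (p, js')"
    using reach_order[OF js(1,4)] assms js by auto
  have "d = (p, js)" using skel_det[OF d(1) skel_pop[OF js(2)]] .
  then have "skel\<^sup>*\<^sup>* (p, js) (p, js')" using d by simp
  from later_less[OF this reach_pop[OF js(1,2)]] show ?thesis using js by auto
qed

text \<open>After a push or a shift the top is the position just read, and the initial edge is
  \<open>(0, 1)\<close>; only a pop produces a non-adjacent pair.\<close>

lemma nonfresh_pop_event:
  assumes "edge i p" "p \<noteq> Suc i" obtains j s where "pop_event j p i s"
proof -
  obtain js where js: "reach p js" "top_pos js = i" using assms unfolding edge_def by auto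
  from js(1) show thesis
    by (cases rule: reach.cases) (use js assms that in \<open>auto simp: pop_event_def\<close>)
qed

lemma take_pop_event:
  assumes "edge j p" "pr Take j p" obtains i s where "pop_event j p i s"
proof -
  obtain js where js: "reach p js" "top_pos js = j" using assms unfolding edge_def by auto
  with assms show thesis
    by (cases js rule: top_pos.cases) (use that in \<open>auto simp: pop_event_def\<close>)
qed

lemma edge_init: "edge 0 1"
  using reach_init unfolding edge_def by force

lemma prec_total: "pr \<pi> i p \<Longrightarrow> pr Yield i p \<or> pr Equal i p \<or> pr Take i p"
  by (cases \<pi>) auto

text \<open>A defined precedence enables a move. At \<open>Suc n\<close> nothing can be pushed or
  shifted, but there every letter takes \<open>#\<close>, so a nonempty stack is popped.\<close>

lemma edge_unstuck:
  assumes "reach p js" "pr \<pi> (top_pos js) p" "(p, js) \<noteq> (Suc n, [])"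
  shows "\<exists>d. skel (p, js) d"
proof (cases js rule: top_pos.cases)
  case 1
  then have "p \<le> n" using assms reach_wf[OF assms(1)] by auto
  then show ?thesis using 1 skel_push[of p js] by auto
next
  case (2 j s l)
  have "p \<le> n \<or> pr Take j p"
    using reach_wf[OF assms(1)] 2 prel_end[of j] by (cases "p = Suc n") auto
  moreover have "pr Yield j p \<or> pr Equal j p \<or> pr Take j p" using prec_total assms(2) 2 by simp
  ultimately show ?thesis using skel_push[of p js] skel_shift[of p j s l] skel_pop[of j p s l] 2
    prel_unique by fastforce
qed

end

text \<open>\<open>compatible_good\<close> and \<open>compatible\<close> show that this assumption
  is compatibility of \<open>x\<close> with \<open>M\<close>.\<close>

locale good_word = op_word +
  assumes good: "reach (Suc n) []"
begin

lemma not_skel_final: "\<not> skel (Suc n, []) d"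
  by (auto elim: skel.cases)

lemma reach_good:
  assumes "reach p js" shows "skel\<^sup>*\<^sup>* (p, js) (Suc n, [])"
  using reach_linear[OF assms good] not_skel_final by (auto elim: converse_rtranclpE)

lemma edge_final: "edge 0 (Suc n)"
  using good unfolding edge_def by force

lemma edge_prec:
  assumes "edge i p" obtains \<pi> where "pr \<pi> i p"
proof -
  obtain js where js: "reach p js" "top_pos js = i" using assms unfolding edge_def by auto
  show thesis
  proof (cases "(p, js) = (Suc n, [])")
    case True
    then show thesis using that js by auto
  next
    case False
    then obtain d where "skel (p, js) d" using reach_good[OF js(1)] by (auto elim: converse_rtranclpE)
    then show thesis using that js by (auto elim!: skel.cases)
  qed
qed

text \<open>A pair that is never popped would survive into every later stack, but the final stack is
  empty.\<close>

lemma push_pop_event: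
  assumes "edge i s" "pr Yield i s" "s \<le> n" obtains j p where "pop_event j p i s"
proof -
  obtain js where js: "reach s js" "top_pos js = i" using assms unfolding edge_def by auto
  have r: "reach (Suc s) ((s, s) # js)" using reach_push js assms by auto
  show thesis
  proof (rule ccontr)
    assume "\<not> thesis"
    then have no: "\<not> (reach p ((j, s) # js) \<and> pr Take j p)" for j p
      using that js(2) unfolding pop_event_def by auto
    have "reach p ks \<and> (\<exists>us j. ks = us @ (j, s) # js)"
      if "skel\<^sup>*\<^sup>* (Suc s, (s, s) # js) (p, ks)" for p ks
      using that
    proof (induction rule: rtranclp_induct2)
      case (step p ks p' ks')
      then obtain us j where k: "ks = us @ (j, s) # js" "reach p ks" by auto
      from step.hyps(2) have "\<exists>us j. ks' = us @ (j, s) # js"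
      proof (cases rule: skel.cases)
        case (skel_pop j' s')
        then show ?thesis using k no[of p j] by (cases us) auto
      qed (use k in \<open>cases us; auto\<close>)+
      then show ?case using reach_skel[OF k(2) step.hyps(2)] by simp
    qed (use r in auto)
    then show False using reach_good[OF r] by auto
  qed
qed

text \<open>Position 0 is the top initially; every other one is read by a push or a shift, after
  which it is the top.\<close>

lemma edge_fresh:
  assumes "i \<le> n" shows "edge i (Suc i)"
proof -
  have "reach q js \<Longrightarrow> i < q \<Longrightarrow> edge i (Suc i)" for q js
  proof (induction rule: reach.induct)
    case reach_init
    then show ?case using edge_init by auto
  next
    case (reach_push p js)
    then show ?case using reach.reach_push[of p js] unfolding edge_def
      by (metis less_SucE top_pos.simps(2))
  next
    case (reach_shift p j s js)
    then show ?case using reach.reach_shift[of p j s js] unfolding edge_def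
      by (metis less_SucE top_pos.simps(2))
  qed
  then show ?thesis using good assms by auto
qed

text \<open>At the edge of column \<open>p\<close> with the least top, a Take would pop and give an
  even smaller top.\<close>

lemma col_end_exists:
  assumes "1 \<le> p" "p \<le> Suc n" obtains i where "edge i p" "\<not> pr Take i p"
proof -
  have "edge (p - 1) p" using edge_fresh[of "p - 1"] assms by auto
  then have e: "edge (LEAST i. edge i p) p" by (rule LeastI)
  have "\<not> pr Take (LEAST i. edge i p) p"
  proof
    assume "pr Take (LEAST i. edge i p) p"
    with e obtain k s where t: "pop_event (LEAST i. edge i p) p k s" by (rule take_pop_event)
    then have "edge k p" "k < (LEAST i. edge i p)" using pop_event_edges[OF t] by auto
    then show False using not_less_Least by blast
  qed
  with e that show thesis by blast
qed

text \<open>At the last edge of the row, a Yield would push a pair whose pop gives a later edge. The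
  second disjunct is the final configuration, where \<open>#\<close> yields to \<open>#\<close> by
  convention but nothing is left to push.\<close>

lemma row_end_exists:
  assumes "i \<le> n" obtains p where "edge i p" "\<not> pr Yield i p \<or> i = 0 \<and> p = Suc n"
proof -
  let ?P = "{p. edge i p}"
  have fin: "finite ?P" using edge_less by (auto intro!: finite_subset[of _ "{..Suc n}"])
  have ne: "?P \<noteq> {}" using edge_fresh assms by auto
  have e: "edge i (Max ?P)" using Max_in[OF fin ne] by simp
  have "\<not> pr Yield i (Max ?P) \<or> i = 0 \<and> Max ?P = Suc n"
  proof (rule ccontr)
    assume a: "\<not> ?thesis"
    have "Max ?P \<le> n"
    proof (rule ccontr)
      assume "\<not> Max ?P \<le> n"
      then have m: "Max ?P = Suc n" using edge_less[OF e] by simp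
      show False using a prel_end[of i Yield] assms unfolding m by (cases "i = 0") auto
    qed
    then obtain j p where t: "pop_event j p i (Max ?P)" using push_pop_event e a by blast
    then have "edge i p" "Max ?P < p" using pop_event_edges[OF t] by auto
    then show False using Max_ge[OF fin, of p] by simp
  qed
  with e that show thesis by blast
qed

end

subsection \<open>Chains\<close>

abbreviation weave :: "'a symb list \<Rightarrow> 'a letter list list \<Rightarrow> 'a symb list" where
  "weave cs ss \<equiv> concat (map2 (\<lambda>c s. c # map Some s) (butlast cs) ss) @ [last cs]"

lemma weave_replicate_Nil: "cs \<noteq> [] \<Longrightarrow> weave cs (replicate (length cs - 1) []) = cs"
proof (induction cs rule: induct_list012)
  case (3 a b cs)
  then show ?case by simp
qed auto

text \<open>The part of a simple chain after its Yield. The recursion follows the shifts and the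
  closing pop of the skeleton.\<close>

fun equal_take :: "'a opm \<Rightarrow> 'a symb list \<Rightarrow> bool" where
  "equal_take M (c # d # e # cs) \<longleftrightarrow> M c d = Some Equal \<and> equal_take M (d # e # cs)"
| "equal_take M [c, d] \<longleftrightarrow> M c d = Some Take"
| "equal_take M _ \<longleftrightarrow> False"

lemma equal_take_nth:
  "equal_take M cs \<longleftrightarrow> length cs \<ge> 2 \<and>
     (\<forall>k<length cs - 2. M (cs ! k) (cs ! Suc k) = Some Equal) \<and>
     M (cs ! (length cs - 2)) (cs ! (length cs - 1)) = Some Take"
proof (induction M cs rule: equal_take.induct)
  case (1 M c d e cs)
  show ?case unfolding equal_take.simps 1 by (auto simp: less_Suc_eq_0_disj nth_Cons')
qed auto

lemma upt_append: "a \<le> b \<Longrightarrow> b \<le> c \<Longrightarrow> [a..<b] @ [b..<c] = [a..<c]"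
  using upt_add_eq_append[of a b "c - b"] by simp

lemma ball_Suc_iff: "(\<forall>k\<in>{Suc 0..<Suc m}. P k) \<longleftrightarrow> (\<forall>k<m. P (Suc k))"
proof -
  have "{Suc 0..<Suc m} = Suc ` {..<m}" by (simp add: image_Suc_lessThan atLeastLessThanSuc_atLeastAtMost)
  then show ?thesis by auto
qed

lemma simple_chain_Cons:
  "simple_chain M (c # d # r) \<longleftrightarrow> M c d = Some Yield \<and> equal_take M (d # r) \<and> None \<notin> set (butlast (d # r))"
proof (cases r rule: rev_cases)
  case Nil
  then show ?thesis unfolding simple_chain_def by auto
next
  case (snoc r' e)
  let ?m = "length r'"
  have "simple_chain M (c # d # r) \<longleftrightarrow> 
    (\<forall>k\<in>{Suc 0..<Suc (Suc ?m)}. (c # d # r) ! k \<noteq> None) \<and> M c d = Some Yield \<and>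
    (\<forall>k\<in>{Suc 0..<Suc ?m}. M ((c # d # r) ! k) ((c # d # r) ! Suc k) = Some Equal) \<and>
    M ((d # r) ! ?m) e = Some Take"
    unfolding simple_chain_def using snoc
    by (auto simp: nth_append atLeastLessThanSuc_atLeastAtMost)
  also have "\<dots> \<longleftrightarrow> (\<forall>k<Suc ?m. (d # r) ! k \<noteq> None) \<and> M c d = Some Yield \<and>
    (\<forall>k<?m. M ((d # r) ! k) ((d # r) ! Suc k) = Some Equal) \<and>
    M ((d # r) ! ?m) e = Some Take"
    unfolding ball_Suc_iff by simp
  also have "(\<forall>k<Suc ?m. (d # r) ! k \<noteq> None) \<longleftrightarrow> None \<notin> set (butlast (d # r))"
  proof -
    have "butlast (d # r) = d # r'" "\<And>k. k < Suc ?m \<Longrightarrow> (d # r) ! k = (d # r') ! k"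
      using snoc by (auto simp: nth_append nth_Cons')
    then show ?thesis by (metis in_set_conv_nth length_Cons)
  qed
  finally show ?thesis unfolding equal_take_nth using snoc by (auto simp: nth_append)
qed

lemma simple_chain_iff:
  "simple_chain M cs \<longleftrightarrow> (\<exists>c d r. cs = c # d # r \<and> M c d = Some Yield \<and> equal_take M (d # r) \<and>
     None \<notin> set (butlast (d # r)))"
proof (cases "\<exists>c d r. cs = c # d # r")
  case True
  then obtain c d r where "cs = c # d # r" by blast
  then show ?thesis using simple_chain_Cons by (simp del: butlast.simps)
next
  case False
  then have "length cs < 2" by (cases cs; cases "tl cs") auto
  then show ?thesis using False unfolding simple_chain_def by auto
qed

text \<open>A simple chain is a composed one with all gaps empty, so one case covers both
  rules.\<close>

lemma chain_composed_induct [consumes 1, case_names composed]: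
  assumes "chain M ys"
    and "\<And>cs ss. simple_chain M cs \<Longrightarrow> length cs = length ss + 1 \<Longrightarrow>
      \<forall>k<length ss. ss ! k = [] \<or> P (cs ! k # map Some (ss ! k) @ [cs ! (k + 1)]) \<Longrightarrow> P (weave cs ss)"
  shows "P ys"
  using assms(1)
proof (induction rule: chain.induct)
  case (simple cs)
  then have "cs \<noteq> []" unfolding simple_chain_iff by auto
  then show ?case
    using assms(2)[OF simple, of "replicate (length cs - 1) []"] weave_replicate_Nil by force
next
  case (composed cs ss)
  then show ?case using assms(2)[of cs ss] by blast
qed

section \<open>From chains to runs\<close>

context op_word begin

lemma segment_lab: "b \<le> Suc n \<Longrightarrow> map Some (map (\<lambda>k. x ! (k - 1)) [Suc a..<b]) = map lab [Suc a..<b]"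
  by (auto simp: lab_letter)

lemma append_eq_map_upt:
  assumes "us @ vs = map f [a..<q]" "vs \<noteq> []"
  shows "us = map f [a..<a + length us]" "vs = map f [a + length us..<q]" "a + length us < q"
proof -
  have "length (us @ vs) = q - a" using assms(1) by (metis length_map length_upt)
  then show l: "a + length us < q" using assms(2) by (cases vs) auto
  show "us = map f [a..<a + length us]" "vs = map f [a + length us..<q]"
    using assms(1) l by (auto simp: append_eq_conv_conj take_map drop_map)
qed

text \<open>One link \<open>c s d\<close> of a composed chain. If \<open>s\<close> is nonempty, the
  inner chain leads from the fresh configuration at \<open>a\<close> to the letter \<open>d\<close>
  with the stack restored; otherwise \<open>d\<close> is already next.\<close>

lemma link_step:
  assumes "c # map Some s @ [d] @ r = map lab [a..<Suc p]" "p \<le> Suc n"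
    "s = [] \<or> (\<forall>i p js. c # map Some s @ [d] = map lab [i..<Suc p] \<longrightarrow>
        p \<le> Suc n \<longrightarrow> reach (Suc i) js \<longrightarrow> top_pos js = i \<longrightarrow> reach p js)"
    "reach (Suc a) js" "top_pos js = a"
  shows "\<exists>b. a < b \<and> b \<le> p \<and> c = lab a \<and> d = lab b \<and> d # r = map lab [b..<Suc p] \<and> reach b js"
proof -
  let ?b = "a + length (c # map Some s)"
  have e: "(c # map Some s) @ ([d] @ r) = map lab [a..<Suc p]" using assms(1) by simp
  have *: "c # map Some s = map lab [a..<?b]" "[d] @ r = map lab [?b..<Suc p]" "?b < Suc p"
    using append_eq_map_upt[OF e] by blast+
  have d: "d = lab ?b" "c = lab a" using *(2,3) *(1) by (auto simp: upt_conv_Cons simp del: upt_Suc)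
  have "c # map Some s @ [d] = map lab [a..<Suc ?b]" using *(1) d by (simp add: upt_conv_Cons)
  moreover have "?b \<le> Suc n" using *(3) assms(2) by linarith
  moreover have "\<forall>i p js. c # map Some s @ [d] = map lab [i..<Suc p] \<longrightarrow>
        p \<le> Suc n \<longrightarrow> reach (Suc i) js \<longrightarrow> top_pos js = i \<longrightarrow> reach p js" if "s \<noteq> []"
    using that assms(3) by (simp only: simp_thms)
  ultimately have "reach ?b js" if "s \<noteq> []" using that assms(4,5)
    by (metis (no_types, lifting))
  then have "reach ?b js" using assms(4) by (cases "s = []") auto
  then show ?thesis using * d by (intro exI[of _ ?b]) auto
qed

text \<open>The entry on top moves along the chain by shifts until the closing Take pops it.\<close>

lemma walk_equal_take:
  assumes "equal_take M cs" "length cs = length ss + 1"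
    "\<forall>k<length ss. ss ! k = [] \<or> (\<forall>i p js. cs ! k # map Some (ss ! k) @ [cs ! (k + 1)] = map lab [i..<Suc p] \<longrightarrow>
        p \<le> Suc n \<longrightarrow> reach (Suc i) js \<longrightarrow> top_pos js = i \<longrightarrow> reach p js)"
    "weave cs ss = map lab [a..<Suc p]" "p \<le> Suc n" "reach (Suc a) ((a, s) # js)"
  shows "reach p js"
  using assms
proof (induction cs arbitrary: ss a rule: induct_list012)
  case (3 c d cs)
  obtain s1 ss' where ss: "ss = s1 # ss'" using 3(4) by (cases ss) auto
  obtain r where r: "weave (d # cs) ss' = [d] @ r"
    using 3(4) ss by (cases cs; cases ss') auto
  have eq: "c # map Some s1 @ [d] @ r = map lab [a..<Suc p]" 
    using 3(6) r ss by (auto simp del: upt_Suc)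
  have "s1 = [] \<or> (\<forall>i p js. c # map Some s1 @ [d] = map lab [i..<Suc p] \<longrightarrow>
        p \<le> Suc n \<longrightarrow> reach (Suc i) js \<longrightarrow> top_pos js = i \<longrightarrow> reach p js)"
    using 3(5)[rule_format, of 0] unfolding ss by (simp del: upt_Suc)
  from link_step[OF eq 3(7) this 3(8)] obtain b where
    b: "a < b" "b \<le> p" "c = lab a" "d = lab b" "d # r = map lab [b..<Suc p]" "reach b ((a, s) # js)"
    by (auto simp del: upt_Suc)
  show ?case
  proof (cases cs)
    case Nil
    then have "ss' = []" using 3(4) ss by simp
    then have "r = []" using r Nil by simp
    then have "length [b..<Suc p] = 1" using b(5) by (metis length_map One_nat_def length_Cons list.size(3))
    then have "b = p" using b(2) by simp
    moreover have "pr Take a b" using 3(3) b Nil by (simp add: prel_def)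
    ultimately show ?thesis using reach_pop[OF b(6)] by simp
  next
    case (Cons e es)
    have "weave (d # cs) ss' = map lab [b..<Suc p]" using r b(5) by simp
    moreover have "ss' \<noteq> []" using 3(4) ss Cons by auto
    then have "r \<noteq> []" using r Cons by (cases ss') auto
    then have "length (d # r) > 1" by simp
    then have "b < p" unfolding b(5) by (auto split: if_splits)
    then have "b \<le> n" using 3(7) by simp
    moreover have "pr Equal a b" using 3(3) b Cons by (simp add: prel_def)
    ultimately have "reach (Suc b) ((b, s) # js)" using reach_shift[OF b(6)] by simp
    then show ?thesis
      using 3(2)[of ss' b] 3(3,4,7) 3(5)[rule_format, of "Suc _"] r b(5) Cons ss
      by (auto simp del: upt_Suc)
  qed
qed auto

text \<open>The Yield pushes, the Equals shift, the Take pops, and inner chains do the same higher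
  up; so reading the body of a chain leaves the stack as it was.\<close>

lemma chain_reach:
  assumes "chain M ys" "ys = map lab [i..<Suc p]" "p \<le> Suc n" "reach (Suc i) js" "top_pos js = i"
  shows "reach p js"
  using assms
proof (induction arbitrary: i p js rule: chain_composed_induct)
  case (composed cs ss)
  obtain c d r where cs: "cs = c # d # r" "M c d = Some Yield" "equal_take M (d # r)"
    using composed(1) unfolding simple_chain_iff by auto
  obtain s1 ss' where ss: "ss = s1 # ss'" using composed(2) cs by (cases ss) auto
  obtain u where u: "weave (d # r) ss' = [d] @ u"
    using composed(2) ss cs by (cases r; cases ss') auto
  have "ss' \<noteq> []" "r \<noteq> []" using cs composed(2) ss by (cases r; auto)+
  then have "u \<noteq> []" using u by (cases ss'; cases r) auto
  have eq: "c # map Some s1 @ [d] @ u = map lab [i..<Suc p]"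
    using composed(4) u ss cs by (auto simp del: upt_Suc)
  have "s1 = [] \<or> (\<forall>i p js. c # map Some s1 @ [d] = map lab [i..<Suc p] \<longrightarrow>
        p \<le> Suc n \<longrightarrow> reach (Suc i) js \<longrightarrow> top_pos js = i \<longrightarrow> reach p js)"
    using composed(3)[rule_format, of 0] unfolding ss cs by (simp del: upt_Suc)
  from link_step[OF eq composed(5) this composed(6,7)] obtain b where
    b: "i < b" "b \<le> p" "c = lab i" "d = lab b" "d # u = map lab [b..<Suc p]" "reach b js" by (auto simp del: upt_Suc)
  have "length (d # u) > 1" using \<open>u \<noteq> []\<close> by simp
  then have "b < p" unfolding b(5) by (auto split: if_splits)
  then have "b \<le> n" using composed(5) by simp
  moreover have "pr Yield (top_pos js) b" using cs(2) b composed(7) by (simp add: prel_def)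
  ultimately have rb: "reach (Suc b) ((b, b) # js)" using reach_push[OF b(6)] by simp
  show ?case
  proof (rule walk_equal_take[OF cs(3) _ _ _ composed(5) rb])
    show "length (d # r) = length ss' + 1" using composed(2) cs ss by simp
    show "weave (d # r) ss' = map lab [b..<Suc p]" using u b(5) by simp
    show "\<forall>k<length ss'. ss' ! k = [] \<or> (\<forall>i p js. (d # r) ! k # map Some (ss' ! k) @ [(d # r) ! (k + 1)] = map lab [i..<Suc p] \<longrightarrow>
        p \<le> Suc n \<longrightarrow> reach (Suc i) js \<longrightarrow> top_pos js = i \<longrightarrow> reach p js)"
      using composed(3)[rule_format, of "Suc _"] unfolding ss cs by (auto simp del: upt_Suc)
  qed
qed

section \<open>From runs to chains\<close>

definition link :: "nat \<Rightarrow> nat \<Rightarrow> bool" where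
  "link a b \<longleftrightarrow> a < b \<and> b \<le> Suc n \<and> (b = Suc a \<or> chain M (map lab [a..<Suc b]))"

text \<open>Letters have positions from 1 and list indices from 0, hence the offset.\<close>

definition gap :: "nat \<Rightarrow> nat \<Rightarrow> 'a letter list" where
  "gap a b = map (\<lambda>k. x ! (k - 1)) [Suc a..<b]"

lemma weave_positions:
  assumes "successively link qs" "qs \<noteq> []"
  shows "hd qs \<le> last qs \<and> weave (map lab qs) (map2 gap qs (tl qs)) = map lab [hd qs..<Suc (last qs)]"
  using assms
proof (induction qs rule: induct_list012)
  case (3 a b qs)
  have l: "a < b" "b \<le> Suc n" using 3(3) by (auto simp: link_def)
  have IH: "b \<le> last (b # qs)" "weave (map lab (b # qs)) (map2 gap (b # qs) qs) = map lab [b..<Suc (last (b # qs))]"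
    using 3(2,3) by auto
  have "weave (map lab (a # b # qs)) (map2 gap (a # b # qs) (b # qs)) =
    lab a # map Some (gap a b) @ weave (map lab (b # qs)) (map2 gap (b # qs) qs)"
    by simp
  also have "\<dots> = lab a # map lab [Suc a..<b] @ map lab [b..<Suc (last (b # qs))]"
    using IH segment_lab[OF l(2)] by (simp only: gap_def)
  also have "\<dots> = map lab ([a] @ [Suc a..<b] @ [b..<Suc (last (b # qs))])" by simp
  also have "[a] @ [Suc a..<b] @ [b..<Suc (last (b # qs))] = [a..<Suc (last (b # qs))]"
    using l IH(1) upt_append[of a b "Suc (last (b # qs))"] by (simp add: upt_conv_Cons del: upt_Suc)
  finally show ?case using l IH(1) by simp
qed auto

lemma equal_take_positions:
  assumes "successively (\<lambda>a b. link a b \<and> pr Equal a b) ps" "ps \<noteq> []" "pr Take (last ps) p"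
  shows "equal_take M (map lab (ps @ [p]))"
  using assms
proof (induction ps rule: induct_list012)
  case (3 a b ps)
  then show ?case by (cases ps) (auto simp: prel_def)
qed (auto simp: prel_def)

text \<open>\<open>i # ps @ [p]\<close> spells a simple chain, and each of its links is adjacent,
  which gives an empty gap, or itself a chain; this is what \<open>chain.composed\<close> asks
  for.\<close>

lemma chain_positions:
  assumes ps: "successively (\<lambda>a b. link a b \<and> pr Equal a b) ps" "ps \<noteq> []"
    and "link i (hd ps)" "pr Yield i (hd ps)" "link (last ps) p" "pr Take (last ps) p"
  shows "chain M (map lab [i..<Suc p])"
proof -
  let ?qs = "i # ps @ [p]"
  have s: "successively link ps" using ps(1) by (rule successively_mono) simp
  have q: "successively link ?qs"
    using s ps(2) assms by (auto simp: successively_append_iff successively_Cons)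
  let ?ss = "map2 gap ?qs (tl ?qs)"
  have nn: "lab k \<noteq> None" if "k \<in> set ps" for k
  proof -
    have "successively (<) ?qs" using q by (rule successively_mono) (simp add: link_def)
    then have "sorted_wrt (<) ?qs" by (simp add: successively_conv_sorted_wrt)
    then have "i < k" "k < p" using that by (auto simp: sorted_wrt_append)
    then show ?thesis using lab_letter[of k] assms(5) by (auto simp: link_def)
  qed
  have "None \<notin> set (map lab ps)"
  proof
    assume "None \<in> set (map lab ps)"
    then obtain k where "k \<in> set ps" "None = lab k" unfolding set_map by (rule imageE) 
    then show False using nn[of k] by simp
  qed
  then have nb: "None \<notin> set (butlast (map lab (ps @ [p])))"
    using map_append[of lab ps "[p]"] by (simp only: list.map butlast_snoc not_False_eq_True)
  have sc: "simple_chain M (map lab ?qs)"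
  proof -
    obtain s r where r: "ps = s # r" using ps(2) by (cases ps) auto
    show ?thesis
      using equal_take_positions[OF ps assms(6)] assms(4) nb
      unfolding r by (simp add: simple_chain_Cons prel_def del: butlast.simps)
  qed
  have "chain M (weave (map lab ?qs) ?ss)"
  proof (rule chain.composed[OF sc], simp, intro allI impI disjCI)
    fix k assume k: "k < length ?ss"
      and n: "\<not> chain M (map lab ?qs ! k # map Some (?ss ! k) @ [map lab ?qs ! (k + 1)])"
    have k': "Suc k < length ?qs" using k by simp
    define a b where ab: "a = ?qs ! k" "b = ?qs ! Suc k"
    have l: "link a b" using q k' unfolding ab successively_conv_nth by blast
    have gap: "?ss ! k = gap a b" using k' unfolding ab by (simp add: nth_append)
    have "map lab ?qs ! k = lab a" "map lab ?qs ! (k + 1) = lab b"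
      using k' unfolding ab by (simp_all only: Suc_eq_plus1[symmetric] nth_map Suc_lessD)
    with gap have "map lab ?qs ! k # map Some (?ss ! k) @ [map lab ?qs ! (k + 1)] = lab a # map lab [Suc a..<b] @ [lab b]"
      using segment_lab[of b a] l by (simp only: gap_def link_def)
    also have "\<dots> = map lab [a..<Suc b]" using l by (simp add: upt_conv_Cons link_def)
    finally have "b = Suc a" using n l by (auto simp: link_def)
    then show "?ss ! k = []" using gap by (simp add: gap_def)
  qed
  then show ?thesis using weave_positions[OF q] by simp
qed

text \<open>The history of a stack entry \<open>(j, s)\<close> over the top \<open>i\<close>: pushed
  at \<open>s\<close>, then shifted along \<open>ps\<close> to \<open>j\<close>. It is a chain body
  still waiting for its Take.\<close>

definition opened :: "nat \<Rightarrow> nat \<Rightarrow> nat \<Rightarrow> bool" where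
  "opened i s j \<longleftrightarrow> (\<exists>ps. successively (\<lambda>a b. link a b \<and> pr Equal a b) ps \<and> ps \<noteq> [] \<and>
     hd ps = s \<and> last ps = j \<and> link i s \<and> pr Yield i s)"

text \<open>The histories of all entries are carried along so that a pop, which supplies the missing
  Take, completes a chain from the uncovered top to \<open>p\<close>.\<close>

lemma reach_link:
  "reach p js \<Longrightarrow> link (top_pos js) p \<and> (\<forall>us j s vs. js = us @ (j, s) # vs \<longrightarrow> opened (top_pos vs) s j)"
proof (induction rule: reach.induct)
  case reach_init
  then show ?case by (auto simp: link_def)
next
  case (reach_push p js)
  have "opened (top_pos js) p p"
    unfolding opened_def using reach_push by (intro exI[of _ "[p]"]) auto
  then show ?case using reach_push by (auto simp: link_def Cons_eq_append_conv)
next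
  case (reach_shift p j s js)
  then have "opened (top_pos js) s j" by blast
  then obtain ps where ps: "successively (\<lambda>a b. link a b \<and> pr Equal a b) ps" "ps \<noteq> []"
    "hd ps = s" "last ps = j" "link (top_pos js) s" "pr Yield (top_pos js) s"
    unfolding opened_def by auto
  have "opened (top_pos js) s p"
    unfolding opened_def using ps reach_shift
    by (intro exI[of _ "ps @ [p]"]) (auto simp: successively_append_iff)
  moreover have "opened (top_pos vs) s' j'" if "js = us @ (j', s') # vs" for us j' s' vs
    using reach_shift.IH that by (metis append_Cons)
  ultimately show ?case using reach_shift by (auto simp: link_def Cons_eq_append_conv)
next
  case (reach_pop p j s js)
  then have "opened (top_pos js) s j" by blast
  then obtain ps where ps: "successively (\<lambda>a b. link a b \<and> pr Equal a b) ps" "ps \<noteq> []"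
    "hd ps = s" "last ps = j" "link (top_pos js) s" "pr Yield (top_pos js) s"
    unfolding opened_def by auto
  have "chain M (map lab [top_pos js..<Suc p])"
    using chain_positions[OF ps(1,2)] ps reach_pop by auto
  moreover have "top_pos js < p" "p \<le> Suc n"
    using reach_wf[OF reach.reach_pop[OF reach_pop(1,2)]] by auto
  moreover have "opened (top_pos vs) s' j'" if "js = us @ (j', s') # vs" for us j' s' vs
    using reach_pop.IH that by (metis append_Cons)
  ultimately show ?case by (simp add: link_def)
qed

section \<open>Edges, the chain relation and compatibility\<close>

lemma chi_iff: "chi M x i j \<longleftrightarrow> Suc i < j \<and> j \<le> Suc n \<and> chain M (map lab [i..<Suc j])"
  by (auto simp: chi_def positions_def)

lemma edge_chi: "edge i p \<Longrightarrow> p = Suc i \<or> chi M x i p"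
  unfolding edge_def chi_iff using reach_link link_def by (metis Suc_lessI)

text \<open>Top and next position are adjacent or the context of a chain, so compatibility defines
  their precedence and only the final configuration is stuck.\<close>

lemma compatible_good:
  assumes "compatible M x" shows "reach (Suc n) []"
proof -
  have defd: "\<exists>\<pi>. pr \<pi> (top_pos js) p" if r: "reach p js" for p js
  proof -
    have "edge (top_pos js) p" using r unfolding edge_def by auto
    then consider "p = Suc (top_pos js)" | "chi M x (top_pos js) p" using edge_chi by auto
    then show ?thesis
    proof cases
      case 1
      \<comment> \<open>Compatibility speaks of adjacent letters; pairs involving \<open>#\<close>
        have a precedence by convention.\<close>
      show ?thesis
      proof (cases "top_pos js = 0 \<or> p = Suc n")
        case True
        then have "top_pos js = 0 \<or> 1 \<le> top_pos js \<and> top_pos js \<le> n \<and> p = Suc n" using 1 by linarith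
        then show ?thesis using prel_0 prel_end[of "top_pos js" Take] by auto
      next
        case False
        then obtain k where k: "top_pos js = Suc k" by (cases "top_pos js") auto
        then have "k + 1 < n" using False 1 reach_wf[OF r] by simp
        then show ?thesis using assms k 1 unfolding compatible_def prel_def
          by (auto simp: lab_Suc)
      qed
    next
      case 2
      let ?y = "map lab [top_pos js..<Suc p]"
      have *: "Suc (top_pos js) < p" "p \<le> Suc n" "chain M ?y" using 2 unfolding chi_iff by auto
      have "delimited x = map lab [0..<Suc (Suc n)]"
        by (rule nth_equalityI) (auto simp: label_def delimited_def simp del: upt_Suc)
      also have "[0..<Suc (Suc n)] = [0..<top_pos js] @ [top_pos js..<Suc p] @ [Suc p..<Suc (Suc n)]"
        using * upt_append[of "top_pos js" "Suc p" "Suc (Suc n)"] upt_append[of 0 "top_pos js" "Suc (Suc n)"]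
        by (simp del: upt_Suc)
      finally have "sublist ?y (delimited x)" by (auto simp: sublist_def simp del: upt_Suc)
      then have "M (hd ?y) (last ?y) \<noteq> None" using assms * unfolding compatible_def by blast
      moreover have "hd ?y = lab (top_pos js)" "last ?y = lab p" using * by (auto simp: upt_conv_Cons)
      ultimately show ?thesis unfolding prel_def by auto
    qed
  qed
  \<comment> \<open>Each move shortens the remaining input, or keeps it and lowers the top.\<close>
  have "reach p js \<Longrightarrow> reach (Suc n) []" for p js
  proof (induction "(Suc n - p, top_pos js)" arbitrary: p js rule: wf_induct[OF wf_lex_prod[OF wf_less_than wf_less_than]])
    case 1
    show ?case
    proof (cases "(p, js) = (Suc n, [])")
      case True
      then show ?thesis using 1 by simp
    next
      case False
      then obtain p' js' where s: "skel (p, js) (p', js')" using edge_unstuck[OF 1(2)] defd[OF 1(2)] by force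
      have "reach p' js'" using reach_skel[OF 1(2) s] .
      moreover have "((Suc n - p', top_pos js'), (Suc n - p, top_pos js)) \<in> less_than <*lex*> less_than"
        using skel_less[OF 1(2) s] reach_wf[OF calculation] by auto
      ultimately show ?thesis using 1(1) by blast
    qed
  qed
  then show ?thesis using reach_init by blast
qed

end

context good_word begin

text \<open>For a chain from \<open>i\<close> to \<open>p\<close>, \<open>chain_reach\<close> starts
  at the fresh edge of \<open>i\<close> and returns to the same stack with \<open>p\<close>
  next.\<close>

lemma edge_iff: "edge i p \<longleftrightarrow> i < p \<and> p \<le> Suc n \<and> (p = Suc i \<or> chi M x i p)"
proof
  assume "i < p \<and> p \<le> Suc n \<and> (p = Suc i \<or> chi M x i p)"
  then have *: "i < p" "p \<le> Suc n" "p = Suc i \<or> chi M x i p" by auto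
  have e: "edge i (Suc i)" using edge_fresh * by auto
  then obtain js where "reach (Suc i) js" "top_pos js = i" unfolding edge_def by auto
  then show "edge i p" using * e chain_reach[OF _ refl *(2)] unfolding chi_iff edge_def by blast
qed (use edge_less edge_chi in auto)

lemma chi_edge: "chi M x i p \<longleftrightarrow> edge i p \<and> p \<noteq> Suc i"
  unfolding edge_iff chi_iff by auto

text \<open>Adjacent letters and contexts of chains are edges, and a configuration on the way to the
  final one needs a precedence for its next move.\<close>

lemma compatible: "compatible M x"
  unfolding compatible_def
proof (intro conjI allI impI)
  fix k assume "k + 1 < n"
  then have "edge (Suc k) (Suc (Suc k))" using edge_fresh by auto
  then show "M (Some (x ! k)) (Some (x ! (k + 1))) \<noteq> None"
    using \<open>k + 1 < n\<close> by (auto elim!: edge_prec simp: prel_def lab_Suc)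
next
  fix y assume "sublist y (delimited x)" "chain M y"
  then obtain us vs where d: "delimited x = us @ y @ vs" unfolding sublist_def by auto
  \<comment> \<open>With three symbols the two ends are non-adjacent, as \<open>chi\<close>
    demands.\<close>
  have ly: "length y \<ge> 3" 
    using \<open>chain M y\<close> 
  proof (induction rule: chain_composed_induct)
    case (composed cs ss)
    then obtain c d e r where "cs = c # d # e # r" unfolding simple_chain_iff
      by (metis equal_take.simps(3,4) list.exhaust)
    then show ?case using composed(2) by (cases ss; cases "tl ss") auto
  qed
  define i p where ip: "i = length us" "p = length us + length y - 1"
  have len: "length (delimited x) = n + 2" by (simp add: delimited_def)
  have p: "p \<le> Suc n" "Suc i < p" using d ly len ip by auto
  have y: "y = map lab [i..<Suc p]"
    by (rule nth_equalityI) (use ip ly in \<open>auto simp: label_def d nth_append simp del: upt_Suc\<close>)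
  have "chi M x i p" using p y \<open>chain M y\<close> unfolding chi_iff by auto
  then have "edge i p" using chi_edge by auto
  moreover have "hd y = lab i" "last y = lab p" using y p by (auto simp: upt_conv_Cons)
  ultimately show "M (hd y) (last y) \<noteq> None" by (auto elim!: edge_prec simp: prel_def)
qed

end

subsection \<open>Acceptance as a labelling of edges\<close>

lemma relpowp_det:
  fixes R :: "'b \<Rightarrow> 'b \<Rightarrow> bool"
  assumes "\<And>a b c. R a b \<Longrightarrow> R a c \<Longrightarrow> b = c"
  shows "(R ^^ k) a b \<Longrightarrow> (R ^^ k) a c \<Longrightarrow> b = c"
proof (induction k arbitrary: b c)
  case (Suc k)
  then show ?case using assms by (metis relpowp_Suc_E)
qed auto

context op_word begin

text \<open>A pair stores the state in which it was pushed, which is the state at the edge from the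
  top below it to \<open>s\<close>.\<close>

fun real_stack :: "(nat \<Rightarrow> nat \<Rightarrow> 'q) \<Rightarrow> (nat \<times> nat) list \<Rightarrow> ('a letter \<times> 'q) list" where
  "real_stack L [] = []"
| "real_stack L ((j, s) # js) = (x ! (j - 1), L (top_pos js) s) # real_stack L js"

fun real_config :: "(nat \<Rightarrow> nat \<Rightarrow> 'q) \<Rightarrow> nat \<times> (nat \<times> nat) list \<Rightarrow> ('q, 'a) config" where
  "real_config L (p, js) = (drop (p - 1) x, L (top_pos js) p, real_stack L js)"

text \<open>Both reading moves lead to the fresh edge of \<open>p\<close>. Stacks have disappeared:
  a pop only mentions the three edges of its event.\<close>

definition run_labelling :: "('q, 'a) opa \<Rightarrow> (nat \<Rightarrow> nat \<Rightarrow> 'q) \<Rightarrow> bool" where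
  "run_labelling \<A> L \<longleftrightarrow> L 0 1 \<in> initial \<A> \<and> L 0 (Suc n) \<in> final \<A> \<and>
     (\<forall>i p. edge i p \<longrightarrow> p \<le> n \<longrightarrow> pr Yield i p \<longrightarrow> (L i p, x ! (p - 1), L p (Suc p)) \<in> push \<A>) \<and>
     (\<forall>i p. edge i p \<longrightarrow> p \<le> n \<longrightarrow> pr Equal i p \<longrightarrow> (L i p, x ! (p - 1), L p (Suc p)) \<in> shift \<A>) \<and>
     (\<forall>j p i s. pop_event j p i s \<longrightarrow> (L j p, L i s, L i p) \<in> pop \<A>)"

lemma top_symb_real:
  assumes "reach p js" shows "top_symb (real_stack L js) = lab (top_pos js)"
  using reach_wf[OF assms]
  by (cases js rule: top_pos.cases) (auto simp: top_symb_def lab_letter)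

lemma next_symb_drop:
  assumes "1 \<le> p" "p \<le> Suc n" shows "next_symb (drop (p - 1) x) = lab p"
proof (cases "p = Suc n")
  case False
  then have "drop (p - 1) x = x ! (p - 1) # drop p x"
    using assms Cons_nth_drop_Suc[of "p - 1" x] by simp
  then show ?thesis using False assms by (simp add: next_symb_def lab_letter)
qed (simp add: next_symb_def)

lemma drop_letter: "1 \<le> p \<Longrightarrow> p \<le> n \<Longrightarrow> drop (p - 1) x = x ! (p - 1) # drop p x"
  using Cons_nth_drop_Suc[of "p - 1" x] by simp

lemma move_real:
  assumes L: "run_labelling \<A> L" and r: "reach p js" and s: "skel (p, js) c'"
  shows "move M \<A> (real_config L (p, js)) (real_config L c')"
  using s
proof (cases rule: skel.cases)
  case skel_push
  have e: "edge (top_pos js) p" using r unfolding edge_def by auto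
  have b: "1 \<le> p" using reach_wf[OF r] by simp
  have "move M \<A> (x ! (p - 1) # drop p x, L (top_pos js) p, real_stack L js)
    (drop p x, L p (Suc p), (x ! (p - 1), L (top_pos js) p) # real_stack L js)"
  proof (rule move.push_move)
    show "M (top_symb (real_stack L js)) (Some (x ! (p - 1))) = Some Yield"
      using skel_push b top_symb_real[OF r, of L] by (simp add: prel_def lab_letter)
    show "(L (top_pos js) p, x ! (p - 1), L p (Suc p)) \<in> push \<A>"
      using L e skel_push unfolding run_labelling_def by auto
  qed
  then show ?thesis using skel_push b drop_letter[of p] by simp
next
  case (skel_shift j s ks)
  have e: "edge j p" using r skel_shift unfolding edge_def by (metis top_pos.simps(2))
  have b: "1 \<le> p" "1 \<le> j" "j \<le> n" using reach_wf[OF r] skel_shift by auto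
  have "move M \<A> (x ! (p - 1) # drop p x, L j p, (x ! (j - 1), L (top_pos ks) s) # real_stack L ks)
    (drop p x, L p (Suc p), (x ! (p - 1), L (top_pos ks) s) # real_stack L ks)"
  proof (rule move.shift_move)
    show "M (Some (x ! (j - 1))) (Some (x ! (p - 1))) = Some Equal"
      using skel_shift b by (simp add: prel_def lab_letter)
    show "(L j p, x ! (p - 1), L p (Suc p)) \<in> shift \<A>"
      using L e skel_shift unfolding run_labelling_def by auto
  qed
  then show ?thesis using skel_shift b drop_letter[of p] by simp
next
  case (skel_pop j s ks)
  have e: "pop_event j p (top_pos ks) s" using r skel_pop unfolding pop_event_def by auto
  have b: "1 \<le> p" "p \<le> Suc n" "1 \<le> j" "j \<le> n" using reach_wf[OF r] skel_pop by auto
  have "move M \<A> (drop (p - 1) x, L j p, (x ! (j - 1), L (top_pos ks) s) # real_stack L ks)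
    (drop (p - 1) x, L (top_pos ks) p, real_stack L ks)"
  proof (rule move.pop_move)
    show "M (Some (x ! (j - 1))) (next_symb (drop (p - 1) x)) = Some Take"
      using skel_pop b next_symb_drop[of p] by (simp add: prel_def lab_letter)
    show "(L j p, L (top_pos ks) s, L (top_pos ks) p) \<in> pop \<A>"
      using L e unfolding run_labelling_def by blast
  qed
  then show ?thesis using skel_pop by simp
qed

lemma run_labelling_accepts:
  assumes "run_labelling \<A> L" "reach (Suc n) []"
  shows "x \<in> opa_language M \<A>"
proof -
  have "reach p js \<Longrightarrow> (move M \<A>)\<^sup>*\<^sup>* (real_config L (1, [])) (real_config L (p, js))" for p js
    unfolding reach_iff
  proof (induction rule: rtranclp_induct2)
    case (step p js p' js')
    then show ?case using move_real[OF assms(1), of p js "(p', js')"] unfolding reach_iff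
      by (meson rtranclp.rtrancl_into_rtrancl)
  qed simp
  from this[OF assms(2)] show ?thesis
    using assms(1) unfolding opa_language_def run_labelling_def by auto
qed

section \<open>From an accepting run to a labelling\<close>

definition upd_label :: "(nat \<Rightarrow> nat \<Rightarrow> 'q) \<Rightarrow> nat \<Rightarrow> nat \<Rightarrow> 'q \<Rightarrow> nat \<Rightarrow> nat \<Rightarrow> 'q" where
  "upd_label L i p q = (\<lambda>a b. if a = i \<and> b = p then q else L a b)"

lemma real_stack_upd:
  "wf_stack js \<Longrightarrow> top_pos js < p \<Longrightarrow> real_stack (upd_label L i p q) js = real_stack L js"
  by (induction js rule: wf_stack.induct) (auto simp: upd_label_def)

text \<open>The current edge of an earlier configuration and the edges stored in its stack all
  differ from the one that is overwritten.\<close>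

lemma real_config_upd:
  assumes "reach p js" "p < p' \<or> p = p' \<and> i < top_pos js"
  shows "real_config (upd_label L i p' q) (p, js) = real_config L (p, js)"
  using assms reach_wf[OF assms(1)] real_stack_upd[of js p' L i q] by (auto simp: upd_label_def)

text \<open>The precedences fix the kind of move, so only the resulting state is free; it becomes
  the label of the edge just reached.\<close>

lemma move_shadow:
  assumes r: "reach p js" and m: "move M \<A> (real_config L (p, js)) c"
  shows "\<exists>p' js' q. skel (p, js) (p', js') \<and> c = real_config (upd_label L (top_pos js') p' q) (p', js')"
proof -
  have w: "1 \<le> p" "p \<le> Suc n" "wf_stack js" "top_pos js < p" using reach_wf[OF r] by auto
  from m show ?thesis
  proof (cases rule: move.cases)
    case (push_move \<gamma> b q0 q y)
    then have d: "drop (p - 1) x = b # y" "\<gamma> = real_stack L js" "q0 = L (top_pos js) p" by auto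
    then have "p - 1 < n" by (metis drop_all leI list.distinct(1))
    then have pn: "p \<le> n" by simp
    have b: "b = x ! (p - 1)" "y = drop p x" using d(1) drop_letter[OF w(1) pn] by auto
    have y: "pr Yield (top_pos js) p"
      using push_move(3) d b top_symb_real[OF r, of L] w pn by (simp add: prel_def lab_letter)
    have "c = real_config (upd_label L p (Suc p) q) (Suc p, (p, p) # js)"
      using push_move d b w real_stack_upd[of js "Suc p" L p q] by (simp add: upd_label_def)
    then show ?thesis using skel.skel_push[OF pn y] by (metis top_pos.simps(2))
  next
    case (shift_move a b q0 q y q1 \<gamma>)
    then have d: "drop (p - 1) x = b # y" "(a, q1) # \<gamma> = real_stack L js" "q0 = L (top_pos js) p" by auto
    then obtain j s ks where js: "js = (j, s) # ks" by (cases js rule: top_pos.cases) auto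
    then have j: "1 \<le> j" "j \<le> n" using w by auto
    have "p - 1 < n" using d by (metis drop_all leI list.distinct(1))
    then have pn: "p \<le> n" by simp
    have b: "b = x ! (p - 1)" "y = drop p x" using d(1) drop_letter[OF w(1) pn] by auto
    have y: "pr Equal j p"
      using shift_move(3) d b js j w pn by (simp add: prel_def lab_letter)
    have "c = real_config (upd_label L p (Suc p) q) (Suc p, (p, s) # ks)"
      using shift_move d b w js real_stack_upd[of ks "Suc p" L p q] by (simp add: upd_label_def)
    then show ?thesis using skel.skel_shift[OF pn y, of s ks] js by (metis top_pos.simps(2))
  next
    case (pop_move a y q0 q1 q \<gamma>)
    then have d: "drop (p - 1) x = y" "(a, q1) # \<gamma> = real_stack L js" "q0 = L (top_pos js) p" by auto
    then obtain j s ks where js: "js = (j, s) # ks" by (cases js rule: top_pos.cases) auto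
    then have j: "1 \<le> j" "j \<le> n" using w by auto
    have y: "pr Take j p"
      using pop_move(3) d js j w next_symb_drop[OF w(1,2)] by (simp add: prel_def lab_letter)
    have "c = real_config (upd_label L (top_pos ks) p q) (p, ks)"
      using pop_move d w js real_stack_upd[of ks p L "top_pos ks" q] by (simp add: upd_label_def)
    then show ?thesis using skel.skel_pop[OF y, of s ks] js by blast
  qed
qed

lemma skel_power_reach: "(skel ^^ k) (1, []) (p, js) \<Longrightarrow> reach p js"
  unfolding reach_iff by (meson relpowp_imp_rtranclp)

text \<open>The labelling grows with the run by one edge per step. The last conjunct keeps all
  previous moves valid for the current labelling.\<close>

lemma run_shadow:
  assumes "(move M \<A> ^^ k) (x, q, []) c"
  shows "\<exists>L p js. (skel ^^ k) (1, []) (p, js) \<and> c = real_config L (p, js) \<and> L 0 1 = q \<and>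
    (\<forall>m<k. \<forall>d d'. (skel ^^ m) (1, []) d \<longrightarrow> skel d d' \<longrightarrow> move M \<A> (real_config L d) (real_config L d'))"
  using assms
proof (induction k arbitrary: c)
  case 0
  then show ?case by (intro exI[of _ "\<lambda>_ _. q"] exI[of _ 1] exI[of _ "[]"]) auto
next
  case (Suc k)
  then obtain c0 where c0: "(move M \<A> ^^ k) (x, q, []) c0" "move M \<A> c0 c" by auto
  from Suc.IH[OF c0(1)] obtain L p js where L: "(skel ^^ k) (1, []) (p, js)" "c0 = real_config L (p, js)" "L 0 1 = q"
    "\<And>m d d'. m < k \<Longrightarrow> (skel ^^ m) (1, []) d \<Longrightarrow> skel d d' \<Longrightarrow> move M \<A> (real_config L d) (real_config L d')"
    by blast
  have r: "reach p js" using skel_power_reach L(1) .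
  from move_shadow[OF r] c0(2) L(2) obtain p' js' q' where
    s: "skel (p, js) (p', js')" "c = real_config (upd_label L (top_pos js') p' q') (p', js')" by blast
  let ?L = "upd_label L (top_pos js') p' q'"
  have less: "p < p' \<or> p = p' \<and> top_pos js' < top_pos js" using skel_less[OF r s(1)] .
  \<comment> \<open>By determinism an earlier configuration leads to \<open>(p, js)\<close>, so its
    edge precedes the new one.\<close>
  have same: "real_config ?L d = real_config L d" if d: "(skel ^^ m) (1, []) d" and "m \<le> k" for m d
  proof -
    obtain p0 js0 where d0: "d = (p0, js0)" by force
    have "(skel ^^ (m + (k - m))) (1, []) (p, js)" using L(1) \<open>m \<le> k\<close> by simp
    then obtain e where e: "(skel ^^ m) (1, []) e" "(skel ^^ (k - m)) e (p, js)"
      by (auto simp: relpowp_add)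
    then have "e = d" using relpowp_det[of skel] skel_det d by blast
    then have l: "skel\<^sup>*\<^sup>* d (p, js)" using e relpowp_imp_rtranclp by metis
    have r0: "reach p0 js0" using skel_power_reach d d0 by blast
    have "p0 < p' \<or> p0 = p' \<and> top_pos js' < top_pos js0"
      using later_less[OF l[unfolded d0] r0] less by auto
    then show ?thesis unfolding d0 by (rule real_config_upd[OF r0])
  qed
  have "move M \<A> (real_config ?L d) (real_config ?L d')"
    if "m < Suc k" "(skel ^^ m) (1, []) d" "skel d d'" for m d d'
  proof (cases "m = k")
    case True
    then have d: "d = (p, js)" using relpowp_det[of skel] skel_det that(2) L(1) by blast
    then have "d' = (p', js')" using skel_det that(3) s(1) by blast
    then show ?thesis using same[OF that(2)] True s c0 L(2) d by simp
  next
    case False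
    then have "m < k" using that by simp
    moreover have "(skel ^^ Suc m) (1, []) d'" using that by auto
    ultimately show ?thesis using same[OF that(2)] same[of "Suc m" d'] L(4) that by simp
  qed
  moreover have "?L 0 1 = q" using less reach_wf[OF r] L(3) by (auto simp: upd_label_def)
  moreover have "(skel ^^ Suc k) (1, []) (p', js')" using L(1) s(1) by auto
  ultimately show ?case using s(2) by blast
qed

lemma accepts_run_labelling:
  assumes "x \<in> opa_language M \<A>"
  shows "reach (Suc n) [] \<and> (\<exists>L. run_labelling \<A> L)"
proof -
  obtain qi qf where q: "qi \<in> initial \<A>" "qf \<in> final \<A>" "(move M \<A>)\<^sup>*\<^sup>* (x, qi, []) ([], qf, [])"
    using assms unfolding opa_language_def by auto
  then obtain k where "(move M \<A> ^^ k) (x, qi, []) ([], qf, [])" using rtranclp_imp_relpowp by metis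
  from run_shadow[OF this] obtain L p js where
    L: "(skel ^^ k) (1, []) (p, js)" "([], qf, []) = real_config L (p, js)" "L 0 1 = qi"
    "\<And>m d d'. m < k \<Longrightarrow> (skel ^^ m) (1, []) d \<Longrightarrow> skel d d' \<Longrightarrow> move M \<A> (real_config L d) (real_config L d')"
    by blast
  have r: "reach p js" using skel_power_reach L(1) .
  have js: "js = []" using L(2) by (cases js rule: top_pos.cases) auto
  have p: "p = Suc n" using L(2) reach_wf[OF r] by auto
  have g: "reach (Suc n) []" using r p js by simp
  interpret good_word M x by unfold_locales (rule g)
  have mv: "move M \<A> (real_config L (p', js')) (real_config L d')" if "reach p' js'" "skel (p', js') d'" for p' js' d'
  proof -
    obtain m where m: "(skel ^^ m) (1, []) (p', js')"
      using \<open>reach p' js'\<close> rtranclp_imp_relpowp unfolding reach_iff by metis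
    \<comment> \<open>After \<open>k\<close> steps the final configuration is reached, which has no
      successor; so every configuration with a move occurs earlier.\<close>
    have "m < k"
    proof (rule ccontr)
      assume "\<not> m < k"
      then have "(skel ^^ (k + (m - k))) (1, []) (p', js')" using m by simp
      then obtain e where e: "(skel ^^ k) (1, []) e" "(skel ^^ (m - k)) e (p', js')" by (auto simp: relpowp_add)
      then have "e = (Suc n, [])" using relpowp_det[of skel] skel_det L(1) p js by blast
      then have "skel\<^sup>*\<^sup>* (Suc n, []) (p', js')" using e relpowp_imp_rtranclp by metis
      then have "(p', js') = (Suc n, [])" using not_skel_final by (metis converse_rtranclpE)
      then show False using that not_skel_final by auto
    qed
    then show ?thesis using L(4) m that by blast
  qed
  have "run_labelling \<A> L"
    unfolding run_labelling_def
  proof (intro conjI allI impI)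
    show "L 0 1 \<in> initial \<A>" using L(3) q by simp
    show "L 0 (Suc n) \<in> final \<A>" using L(2) js p q by auto
  next
    fix i p assume a: "edge i p" "p \<le> n" "pr Yield i p"
    then obtain js where js: "reach p js" "top_pos js = i" unfolding edge_def by auto
    have w: "1 \<le> p" using reach_wf[OF js(1)] by auto
    have "move M \<A> (x ! (p - 1) # drop p x, L i p, real_stack L js)
       (drop p x, L p (Suc p), (x ! (p - 1), L i p) # real_stack L js)"
      using mv[OF js(1) skel_push] a js w drop_letter[of p] by simp
    then show "(L i p, x ! (p - 1), L p (Suc p)) \<in> push \<A>"
      by (cases rule: move.cases) auto
  next
    fix i p assume a: "edge i p" "p \<le> n" "pr Equal i p"
    then obtain js where js: "reach p js" "top_pos js = i" unfolding edge_def by auto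
    have "js \<noteq> []" using a js by auto
    then obtain s ks where k: "js = (i, s) # ks" using js by (cases js rule: top_pos.cases) auto
    have w: "1 \<le> p" using reach_wf[OF js(1)] by auto
    have "move M \<A> (x ! (p - 1) # drop p x, L i p, (x ! (i - 1), L (top_pos ks) s) # real_stack L ks)
       (drop p x, L p (Suc p), (x ! (p - 1), L (top_pos ks) s) # real_stack L ks)"
      using mv[OF js(1), of "(Suc p, (p, s) # ks)"] skel_shift[of p i s ks] a k w drop_letter[of p] by simp
    then show "(L i p, x ! (p - 1), L p (Suc p)) \<in> shift \<A>"
      by (cases rule: move.cases) auto
  next
    fix j p i s assume "pop_event j p i s"
    then obtain ks where k: "reach p ((j, s) # ks)" "pr Take j p" "top_pos ks = i" unfolding pop_event_def by auto
    have "move M \<A> (drop (p - 1) x, L j p, (x ! (j - 1), L i s) # real_stack L ks)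
       (drop (p - 1) x, L i p, real_stack L ks)"
      using mv[OF k(1) skel_pop[OF k(2)]] k by simp
    then show "(L j p, L i s, L i p) \<in> pop \<A>"
    proof (cases rule: move.cases)
      \<comment> \<open>A push would lengthen the stack, whereas here it gets shorter.\<close>
      case (push_move b)
      then show ?thesis by (auto dest: arg_cong[of _ _ length])
    qed auto
  qed
  then show ?thesis using g by blast
qed

theorem opa_language_iff:
  "x \<in> opa_language M \<A> \<longleftrightarrow> reach (Suc n) [] \<and> (\<exists>L. run_labelling \<A> L)"
  using accepts_run_labelling run_labelling_accepts by blast

end

subsection \<open>A core logic\<close>

text \<open>
  \<open>Fut C\<close> and \<open>Past C\<close> follow an edge forwards and backwards; the Boolean in \<open>C\<close> says whether it
  joins adjacent positions. \<open>YN\<close> and \<open>YB\<close> (\<open>TN\<close> and \<open>TB\<close>) lead to the next and the previous position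
  on a yield-precedence (take-precedence) hierarchical path. \<open>Fix r c A B\<close> is the solution of
  \<open>v = c \<and> (B \<or> A \<and> Dia r v)\<close>, unique because each relation only moves in one direction.
\<close>

datatype rel = Fut "(bool \<times> prec) set" | Past "(bool \<times> prec) set" | YN | YB | TN | TB

datatype 'a core =
    CTrue
  | CAtom 'a
  | CNeg "'a core"
  | COr "'a core" "'a core"
  | Dia rel "'a core"
  | Fix rel "'a core" "'a core" "'a core"

inductive holds_fix :: "(nat \<Rightarrow> nat \<Rightarrow> bool) \<Rightarrow> (nat \<Rightarrow> bool) \<Rightarrow> (nat \<Rightarrow> bool) \<Rightarrow> (nat \<Rightarrow> bool) \<Rightarrow> nat \<Rightarrow> bool"
  for R c A B where
  base: "c i \<Longrightarrow> B i \<Longrightarrow> holds_fix R c A B i"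
| step: "c i \<Longrightarrow> A i \<Longrightarrow> R i k \<Longrightarrow> holds_fix R c A B k \<Longrightarrow> holds_fix R c A B i"

lemma holds_fix_unfold:
  "holds_fix R c A B i \<longleftrightarrow> c i \<and> (B i \<or> A i \<and> (\<exists>k. R i k \<and> holds_fix R c A B k))"
  by (auto elim: holds_fix.cases intro: holds_fix.intros)

text \<open>The path form, to be matched with \<open>until_on\<close>;
  \<open>holds_fix_path_rev\<close> is its mirror image for \<open>since_on\<close>.\<close>

lemma holds_fix_path:
  "holds_fix R c A B i \<longleftrightarrow> (\<exists>ps. ps \<noteq> [] \<and> hd ps = i \<and> successively R ps \<and> (\<forall>k\<in>set ps. c k) \<and>
     (\<forall>k\<in>set (butlast ps). A k) \<and> B (last ps))"
proof
  assume "holds_fix R c A B i"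
  then show "\<exists>ps. ps \<noteq> [] \<and> hd ps = i \<and> successively R ps \<and> (\<forall>k\<in>set ps. c k) \<and>
     (\<forall>k\<in>set (butlast ps). A k) \<and> B (last ps)"
  proof (induction rule: holds_fix.induct)
    case (base i)
    then show ?case by (intro exI[of _ "[i]"]) auto
  next
    case (step i k)
    then obtain ps where "ps \<noteq> []" "hd ps = k" "successively R ps" "\<forall>k\<in>set ps. c k"
     "\<forall>k\<in>set (butlast ps). A k" "B (last ps)" by auto
    then show ?case using step by (intro exI[of _ "i # ps"]) (auto simp: successively_Cons)
  qed
next
  have "ps \<noteq> [] \<Longrightarrow> successively R ps \<Longrightarrow> (\<forall>k\<in>set ps. c k) \<Longrightarrow>
     (\<forall>k\<in>set (butlast ps). A k) \<Longrightarrow> B (last ps) \<Longrightarrow> holds_fix R c A B (hd ps)" for ps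
    by (induction ps rule: induct_list012) (auto intro: holds_fix.intros)
  then show "\<exists>ps. ps \<noteq> [] \<and> hd ps = i \<and> successively R ps \<and> (\<forall>k\<in>set ps. c k) \<and>
     (\<forall>k\<in>set (butlast ps). A k) \<and> B (last ps) \<Longrightarrow> holds_fix R c A B i" by blast
qed

lemma holds_fix_path_rev:
  "holds_fix (\<lambda>a b. R b a) c A B i \<longleftrightarrow> (\<exists>ps. ps \<noteq> [] \<and> last ps = i \<and> successively R ps \<and>
     (\<forall>k\<in>set ps. c k) \<and> (\<forall>k\<in>set (tl ps). A k) \<and> B (hd ps))"
proof -
  have ex_rev: "(\<exists>ps. P ps) \<longleftrightarrow> (\<exists>ps. P (rev ps))" for P :: "nat list \<Rightarrow> bool"
    by (metis rev_rev_ident)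
  have "holds_fix (\<lambda>a b. R b a) c A B i \<longleftrightarrow> (\<exists>ps. rev ps \<noteq> [] \<and> hd (rev ps) = i \<and>
     successively (\<lambda>a b. R b a) (rev ps) \<and> (\<forall>k\<in>set (rev ps). c k) \<and>
     (\<forall>k\<in>set (butlast (rev ps)). A k) \<and> B (last (rev ps)))"
    unfolding holds_fix_path by (rule ex_rev)
  also have "\<dots> \<longleftrightarrow> (\<exists>ps. ps \<noteq> [] \<and> last ps = i \<and> successively R ps \<and>
     (\<forall>k\<in>set ps. c k) \<and> (\<forall>k\<in>set (tl ps). A k) \<and> B (hd ps))"
    by (simp add: butlast_rev hd_rev last_rev)
  finally show ?thesis .
qed

text \<open>In the hierarchical until and since the guard asks for a context at each position,
  because even a path of a single position needs its \<open>h\<close>. Summary operators follow both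
  kinds of edges, hence \<open>UNIV\<close>.\<close>

primrec core_of :: "'a potl \<Rightarrow> 'a core" where
  "core_of (Atom a) = CAtom a"
| "core_of (Neg \<phi>) = CNeg (core_of \<phi>)"
| "core_of (Or \<phi> \<psi>) = COr (core_of \<phi>) (core_of \<psi>)"
| "core_of (Next \<Pi> \<phi>) = Dia (Fut ({True} \<times> \<Pi>)) (core_of \<phi>)"
| "core_of (Back \<Pi> \<phi>) = Dia (Past ({True} \<times> \<Pi>)) (core_of \<phi>)"
| "core_of (ChainNext \<Pi> \<phi>) = Dia (Fut ({False} \<times> \<Pi>)) (core_of \<phi>)"
| "core_of (ChainBack \<Pi> \<phi>) = Dia (Past ({False} \<times> \<Pi>)) (core_of \<phi>)"
| "core_of (Until \<Pi> \<phi> \<psi>) = Fix (Fut (UNIV \<times> \<Pi>)) CTrue (core_of \<phi>) (core_of \<psi>)"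
| "core_of (Since \<Pi> \<phi> \<psi>) = Fix (Past (UNIV \<times> \<Pi>)) CTrue (core_of \<phi>) (core_of \<psi>)"
| "core_of (HNext \<mu> \<phi>) = Dia (case \<mu> of HYield \<Rightarrow> YN | HTake \<Rightarrow> TN) (core_of \<phi>)"
| "core_of (HBack \<mu> \<phi>) = Dia (case \<mu> of HYield \<Rightarrow> YB | HTake \<Rightarrow> TB) (core_of \<phi>)"
| "core_of (HUntil \<mu> \<phi> \<psi>) = (case \<mu> of
      HYield \<Rightarrow> Fix YN (Dia (Past {(False, Yield)}) CTrue) (core_of \<phi>) (core_of \<psi>)
    | HTake \<Rightarrow> Fix TN (Dia (Fut {(False, Take)}) CTrue) (core_of \<phi>) (core_of \<psi>))"
| "core_of (HSince \<mu> \<phi> \<psi>) = (case \<mu> of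
      HYield \<Rightarrow> Fix YB (Dia (Past {(False, Yield)}) CTrue) (core_of \<phi>) (core_of \<psi>)
    | HTake \<Rightarrow> Fix TB (Dia (Fut {(False, Take)}) CTrue) (core_of \<phi>) (core_of \<psi>))"

context op_word begin

definition cond :: "(bool \<times> prec) set \<Rightarrow> nat \<Rightarrow> nat \<Rightarrow> bool" where
  "cond C i k \<longleftrightarrow> (\<exists>\<pi>. pr \<pi> i k \<and> (k = Suc i, \<pi>) \<in> C)"

text \<open>In \<open>pop_event j k h i\<close> the edge \<open>(h, k)\<close> follows
  \<open>(h, i)\<close> in its row, and \<open>(h, i)\<close> has Yield since a pair was pushed
  there. In \<open>pop_event k h i s\<close> the edge \<open>(i, h)\<close> follows
  \<open>(k, h)\<close> in its column, and \<open>(k, h)\<close> has Take since it is popped. The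
  inequalities exclude adjacent pairs, which are not chains.\<close>

primrec Rel :: "rel \<Rightarrow> nat \<Rightarrow> nat \<Rightarrow> bool" where
  "Rel (Fut C) = (\<lambda>i k. edge i k \<and> cond C i k)"
| "Rel (Past C) = (\<lambda>i k. edge k i \<and> cond C k i)"
| "Rel YN = (\<lambda>i k. \<exists>h j. pop_event j k h i \<and> i \<noteq> Suc h \<and> pr Yield h k)"
| "Rel YB = (\<lambda>k i. \<exists>h j. pop_event j k h i \<and> i \<noteq> Suc h \<and> pr Yield h k)"
| "Rel TN = (\<lambda>i k. \<exists>h s. pop_event k h i s \<and> h \<noteq> Suc k \<and> pr Take i h)"
| "Rel TB = (\<lambda>k i. \<exists>h s. pop_event k h i s \<and> h \<noteq> Suc k \<and> pr Take i h)"

primrec csat :: "'a core \<Rightarrow> nat \<Rightarrow> bool" where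
  "csat CTrue = (\<lambda>i. True)"
| "csat (CAtom a) = (\<lambda>i. \<exists>A. lab i = Some A \<and> a \<in> A)"
| "csat (CNeg f) = (\<lambda>i. \<not> csat f i)"
| "csat (COr f g) = (\<lambda>i. csat f i \<or> csat g i)"
| "csat (Dia r f) = (\<lambda>i. \<exists>k. Rel r i k \<and> csat f k)"
| "csat (Fix r c A B) = holds_fix (Rel r) (csat c) (csat A) (csat B)"

section \<open>Successors in rows and columns\<close>

lemma row_not_last: "edge h i \<Longrightarrow> edge h k \<Longrightarrow> i < k \<Longrightarrow> pr Yield h i"
  using row_end by fastforce

lemma col_not_last: "edge k h \<Longrightarrow> edge i h \<Longrightarrow> i < k \<Longrightarrow> pr Take k h"
  using col_end by fastforce

text \<open>An edge with Yield ends its column, and a column has only one end.\<close>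

lemma yield_unique: "edge h i \<Longrightarrow> pr Yield h i \<Longrightarrow> edge h' i \<Longrightarrow> pr Yield h' i \<Longrightarrow> h = h'"
  using col_end[of h i h'] col_end[of h' i h] prel_unique by fastforce

lemma take_unique: "edge i h \<Longrightarrow> pr Take i h \<Longrightarrow> edge i h' \<Longrightarrow> pr Take i h' \<Longrightarrow> h = h'"
  using row_end[of i h h'] row_end[of i h' h] prel_unique by fastforce

text \<open>A non-fresh edge arises by a pop, and \<open>pop_event_row_gap\<close> makes its push
  edge the row predecessor. \<open>col_succ\<close> is the same for columns.\<close>

lemma row_succ:
  "(\<exists>j. pop_event j k h i) \<longleftrightarrow> edge h i \<and> edge h k \<and> i < k \<and> (\<forall>m. edge h m \<longrightarrow> i < m \<longrightarrow> k \<le> m)"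
proof
  assume r: "edge h i \<and> edge h k \<and> i < k \<and> (\<forall>m. edge h m \<longrightarrow> i < m \<longrightarrow> k \<le> m)"
  then have "k \<noteq> Suc h" using edge_less[of h i] by auto
  then obtain j s where t: "pop_event j k h s" using r nonfresh_pop_event by blast
  have "edge h s" "s < k" using pop_event_edges[OF t] by auto
  then have "\<not> i < s" "\<not> s < i" using r pop_event_row_gap[OF t, of i] by auto
  then have "s = i" by simp
  then show "\<exists>j. pop_event j k h i" using t by blast
next
  assume "\<exists>j. pop_event j k h i"
  then obtain j where t: "pop_event j k h i" ..
  show "edge h i \<and> edge h k \<and> i < k \<and> (\<forall>m. edge h m \<longrightarrow> i < m \<longrightarrow> k \<le> m)"
    using pop_event_edges[OF t] pop_event_row_gap[OF t] by auto
qed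

lemma col_succ:
  "(\<exists>s. pop_event k h i s) \<longleftrightarrow> edge k h \<and> edge i h \<and> i < k \<and> (\<forall>m. edge m h \<longrightarrow> m < k \<longrightarrow> m \<le> i)"
proof
  assume r: "edge k h \<and> edge i h \<and> i < k \<and> (\<forall>m. edge m h \<longrightarrow> m < k \<longrightarrow> m \<le> i)"
  then have "h \<noteq> Suc i" using edge_less[of k h] by auto
  then obtain j s where t: "pop_event j h i s" using r nonfresh_pop_event by blast
  have "edge j h" "i < j" using pop_event_edges[OF t] by auto
  then have "\<not> k < j" "\<not> j < k" using r pop_event_col_gap[OF t, of k] by auto
  then have "j = k" by simp
  then show "\<exists>s. pop_event k h i s" using t by blast
next
  assume "\<exists>s. pop_event k h i s"
  then obtain s where t: "pop_event k h i s" ..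
  show "edge k h \<and> edge i h \<and> i < k \<and> (\<forall>m. edge m h \<longrightarrow> m < k \<longrightarrow> m \<le> i)"
    using pop_event_edges[OF t] pop_event_col_gap[OF t] by auto
qed

text \<open>When \<open>(i, m)\<close> is reached, all stack positions are at most \<open>i\<close>.
  As \<open>k\<close> lies strictly between \<open>i\<close> and \<open>m\<close>, it is off the
  stack and cannot be a top later.\<close>

lemma edge_noncross:
  assumes "edge i m" "edge k l" "i < k" "k < m" shows "l \<le> m"
proof (rule ccontr)
  assume "\<not> l \<le> m"
  obtain js js' where js: "reach m js" "top_pos js = i" "reach l js'" "top_pos js' = k"
    using assms unfolding edge_def by auto
  obtain d where "skel (m, js) d" "skel\<^sup>*\<^sup>* d (l, js')"
    using reach_order[OF js(1,3)] \<open>\<not> l \<le> m\<close> by auto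
  then have s: "skel\<^sup>*\<^sup>* (m, js) (l, js')" by (rule converse_rtranclp_into_rtranclp)
  have "js' \<noteq> []" using js(4) assms(3) by auto
  then have "k \<in> fst ` set js'" using top_pos_in js(4) by blast
  then have "k \<in> fst ` set js" using skel_mono[OF s] assms(4) by auto
  then show False using wf_stack_le_top_pos(1)[of js k] reach_wf[OF js(1)] js(2) assms(3) by auto
qed

lemma pop_event_bounds: "pop_event j p i s \<Longrightarrow> i < s \<and> s \<le> j \<and> j < p \<and> p \<le> Suc n"
  using pop_event_edges[of j p i s] edge_less by blast

lemma Rel_less:
  "Rel r i k \<Longrightarrow> (case r of Fut _ \<Rightarrow> i < k | YN \<Rightarrow> i < k | TN \<Rightarrow> i < k | _ \<Rightarrow> k < i) \<and> i \<le> Suc n \<and> k \<le> Suc n"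
  by (cases r) (auto dest!: edge_less pop_event_bounds)

end

section \<open>Hierarchical operators and paths\<close>

context good_word begin

abbreviation "X \<equiv> chi M x"

lemma chi_less: "X i k \<Longrightarrow> Suc i < k \<and> k \<le> Suc n"
  by (simp add: chi_iff)

lemma Rel_YN:
  "Rel YN i k \<longleftrightarrow> (\<exists>h. X h i \<and> X h k \<and> i < k \<and> pr Yield h k \<and> (\<forall>m. X h m \<longrightarrow> i < m \<longrightarrow> k \<le> m))"
proof -
  have "Rel YN i k \<longleftrightarrow> (\<exists>h. (\<exists>j. pop_event j k h i) \<and> i \<noteq> Suc h \<and> pr Yield h k)" by auto
  also have "\<dots> \<longleftrightarrow> (\<exists>h. X h i \<and> X h k \<and> i < k \<and> pr Yield h k \<and> (\<forall>m. X h m \<longrightarrow> i < m \<longrightarrow> k \<le> m))"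
    unfolding row_succ chi_edge
  proof (intro iff_exI)
    fix h
    have "edge h i \<Longrightarrow> i < m \<Longrightarrow> m \<noteq> Suc h" for m using edge_less[of h i] by auto
    then show "(edge h i \<and> edge h k \<and> i < k \<and> (\<forall>m. edge h m \<longrightarrow> i < m \<longrightarrow> k \<le> m)) \<and> i \<noteq> Suc h \<and> pr Yield h k \<longleftrightarrow>
      (edge h i \<and> i \<noteq> Suc h) \<and> (edge h k \<and> k \<noteq> Suc h) \<and> i < k \<and> pr Yield h k \<and>
      (\<forall>m. edge h m \<and> m \<noteq> Suc h \<longrightarrow> i < m \<longrightarrow> k \<le> m)" by blast
  qed
  finally show ?thesis .
qed

lemma Rel_TN:
  "Rel TN i k \<longleftrightarrow> (\<exists>h. X k h \<and> X i h \<and> i < k \<and> pr Take i h \<and> (\<forall>m. X m h \<longrightarrow> m < k \<longrightarrow> m \<le> i))"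
proof -
  have "Rel TN i k \<longleftrightarrow> (\<exists>h. (\<exists>s. pop_event k h i s) \<and> h \<noteq> Suc k \<and> pr Take i h)" by auto
  also have "\<dots> \<longleftrightarrow> (\<exists>h. X k h \<and> X i h \<and> i < k \<and> pr Take i h \<and> (\<forall>m. X m h \<longrightarrow> m < k \<longrightarrow> m \<le> i))"
    unfolding col_succ chi_edge
  proof (intro iff_exI)
    fix h
    have "edge k h \<Longrightarrow> m < k \<Longrightarrow> h \<noteq> Suc m" for m using edge_less[of k h] by auto
    then show "(edge k h \<and> edge i h \<and> i < k \<and> (\<forall>m. edge m h \<longrightarrow> m < k \<longrightarrow> m \<le> i)) \<and> h \<noteq> Suc k \<and> pr Take i h \<longleftrightarrow>
      (edge k h \<and> h \<noteq> Suc k) \<and> (edge i h \<and> h \<noteq> Suc i) \<and> i < k \<and> pr Take i h \<and>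
      (\<forall>m. edge m h \<and> h \<noteq> Suc m \<longrightarrow> m < k \<longrightarrow> m \<le> i)" by blast
  qed
  finally show ?thesis .
qed

lemma Rel_rev: "Rel YB = (\<lambda>a b. Rel YN b a)" "Rel TB = (\<lambda>a b. Rel TN b a)" "Rel (Past C) = (\<lambda>a b. Rel (Fut C) b a)"
  by auto

lemma chi_yield_unique: "X h i \<Longrightarrow> pr Yield h i \<Longrightarrow> X h' i \<Longrightarrow> pr Yield h' i \<Longrightarrow> h = h'"
  using yield_unique chi_edge by blast

lemma chi_take_unique: "X i h \<Longrightarrow> pr Take i h \<Longrightarrow> X i h' \<Longrightarrow> pr Take i h' \<Longrightarrow> h = h'"
  using take_unique chi_edge by blast

lemma chi_row: "X h i \<Longrightarrow> X h k \<Longrightarrow> i < k \<Longrightarrow> pr Yield h i"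
  using row_not_last chi_edge by blast

lemma chi_col: "X k h \<Longrightarrow> X i h \<Longrightarrow> i < k \<Longrightarrow> pr Take k h"
  using col_not_last chi_edge by blast

text \<open>A chain from \<open>h\<close> that is followed by another one has Yield. Hence the
  minimum over the chains with Yield is the plain row successor. The three lemmas below argue alike,
  with columns for Take.\<close>

lemma HNext_Yield_iff:
  "(\<exists>h<i. X h i \<and> pr Yield h i \<and> {k. k > i \<and> X h k \<and> pr Yield h k} \<noteq> {} \<and>
      W (Min {k. k > i \<and> X h k \<and> pr Yield h k})) \<longleftrightarrow> (\<exists>k. Rel YN i k \<and> W k)"
proof -
  have fin: "finite {k. k > i \<and> X h k \<and> pr Yield h k}" for h
    by (rule finite_subset[of _ "{..Suc n}"]) (auto dest: chi_less)
  show ?thesis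
  proof
    assume "\<exists>h<i. X h i \<and> pr Yield h i \<and> {k. k > i \<and> X h k \<and> pr Yield h k} \<noteq> {} \<and>
      W (Min {k. k > i \<and> X h k \<and> pr Yield h k})"
    then obtain h where h: "X h i" "pr Yield h i" "{k. k > i \<and> X h k \<and> pr Yield h k} \<noteq> {}"
      "W (Min {k. k > i \<and> X h k \<and> pr Yield h k})" (is "W ?k") by auto
    have k: "i < ?k" "X h ?k" "pr Yield h ?k" using Min_in[OF fin h(3)] by auto
    have "?k \<le> m" if "X h m" "i < m" for m
    proof (rule ccontr)
      assume "\<not> ?k \<le> m"
      then have "pr Yield h m" using chi_row[OF that(1) k(2)] by simp
      then show False using Min_le[OF fin, of m] that \<open>\<not> ?k \<le> m\<close> by auto
    qed
    then show "\<exists>k. Rel YN i k \<and> W k" unfolding Rel_YN using h k by blast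
  next
    assume "\<exists>k. Rel YN i k \<and> W k"
    then obtain h k where k: "X h i" "X h k" "i < k" "pr Yield h k" "\<And>m. X h m \<Longrightarrow> i < m \<Longrightarrow> k \<le> m" "W k"
      unfolding Rel_YN by auto
    then have "Min {k. k > i \<and> X h k \<and> pr Yield h k} = k" by (intro Min_eqI[OF fin]) auto
    then show "\<exists>h<i. X h i \<and> pr Yield h i \<and> {k. k > i \<and> X h k \<and> pr Yield h k} \<noteq> {} \<and>
      W (Min {k. k > i \<and> X h k \<and> pr Yield h k})"
      using k chi_row[OF k(1,2,3)] chi_less[OF k(1)] by (intro exI[of _ h]) auto
  qed
qed

lemma HBack_Yield_iff:
  "(\<exists>h<i. X h i \<and> pr Yield h i \<and> {k. k < i \<and> X h k \<and> pr Yield h k} \<noteq> {} \<and>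
      W (Max {k. k < i \<and> X h k \<and> pr Yield h k})) \<longleftrightarrow> (\<exists>k. Rel YB i k \<and> W k)"
proof -
  have fin: "finite {k. k < i \<and> X h k \<and> pr Yield h k}" for h
    by (rule finite_subset[of _ "{..Suc n}"]) (auto dest: chi_less)
  show ?thesis
  proof
    assume "\<exists>h<i. X h i \<and> pr Yield h i \<and> {k. k < i \<and> X h k \<and> pr Yield h k} \<noteq> {} \<and>
      W (Max {k. k < i \<and> X h k \<and> pr Yield h k})"
    then obtain h where h: "X h i" "pr Yield h i" "{k. k < i \<and> X h k \<and> pr Yield h k} \<noteq> {}"
      "W (Max {k. k < i \<and> X h k \<and> pr Yield h k})" (is "W ?k") by auto
    have k: "?k < i" "X h ?k" "pr Yield h ?k" using Max_in[OF fin h(3)] by auto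
    have "i \<le> m" if "X h m" "?k < m" for m
    proof (rule ccontr)
      assume "\<not> i \<le> m"
      then have "pr Yield h m" using chi_row[OF that(1) h(1)] by simp
      then have "m \<in> {k. k < i \<and> X h k \<and> pr Yield h k}" using that \<open>\<not> i \<le> m\<close> by simp
      then show False using Max_ge[OF fin] that(2) leD by blast
    qed
    then show "\<exists>k. Rel YB i k \<and> W k" unfolding Rel_rev Rel_YN using h k by blast
  next
    assume "\<exists>k. Rel YB i k \<and> W k"
    then obtain h k where k: "X h k" "X h i" "k < i" "pr Yield h i" "\<And>m. X h m \<Longrightarrow> k < m \<Longrightarrow> i \<le> m" "W k"
      unfolding Rel_rev Rel_YN by auto
    have "Max {k. k < i \<and> X h k \<and> pr Yield h k} = k"
    proof (rule Max_eqI[OF fin])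
      show "k \<in> {k. k < i \<and> X h k \<and> pr Yield h k}" using k chi_row[OF k(1-3)] by simp
      show "m \<le> k" if "m \<in> {k. k < i \<and> X h k \<and> pr Yield h k}" for m
        using that k(5)[of m] by fastforce
    qed
    then show "\<exists>h<i. X h i \<and> pr Yield h i \<and> {k. k < i \<and> X h k \<and> pr Yield h k} \<noteq> {} \<and>
      W (Max {k. k < i \<and> X h k \<and> pr Yield h k})"
      using k chi_row[OF k(1,2,3)] chi_less[OF k(2)] by (intro exI[of _ h]) auto
  qed
qed

lemma HNext_Take_iff:
  "(\<exists>h>i. X i h \<and> pr Take i h \<and> {k. k > i \<and> X k h \<and> pr Take k h} \<noteq> {} \<and>
      W (Min {k. k > i \<and> X k h \<and> pr Take k h})) \<longleftrightarrow> (\<exists>k. Rel TN i k \<and> W k)"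
proof -
  have fin: "finite {k. k > i \<and> X k h \<and> pr Take k h}" for h
    by (rule finite_subset[of _ "{..Suc n}"]) (auto dest: chi_less)
  show ?thesis
  proof
    assume "\<exists>h>i. X i h \<and> pr Take i h \<and> {k. k > i \<and> X k h \<and> pr Take k h} \<noteq> {} \<and>
      W (Min {k. k > i \<and> X k h \<and> pr Take k h})"
    then obtain h where h: "X i h" "pr Take i h" "{k. k > i \<and> X k h \<and> pr Take k h} \<noteq> {}"
      "W (Min {k. k > i \<and> X k h \<and> pr Take k h})" (is "W ?k") by auto
    have k: "i < ?k" "X ?k h" "pr Take ?k h" using Min_in[OF fin h(3)] by auto
    have "m \<le> i" if "X m h" "m < ?k" for m
    proof (rule ccontr)
      assume "\<not> m \<le> i"
      then have "pr Take m h" using chi_col[OF that(1) h(1)] by simp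
      then have "m \<in> {k. k > i \<and> X k h \<and> pr Take k h}" using that \<open>\<not> m \<le> i\<close> by simp
      then show False using Min_le[OF fin] that(2) leD by blast
    qed
    then show "\<exists>k. Rel TN i k \<and> W k" unfolding Rel_TN using h k by blast
  next
    assume "\<exists>k. Rel TN i k \<and> W k"
    then obtain h k where k: "X k h" "X i h" "i < k" "pr Take i h" "\<And>m. X m h \<Longrightarrow> m < k \<Longrightarrow> m \<le> i" "W k"
      unfolding Rel_TN by auto
    have "Min {k. k > i \<and> X k h \<and> pr Take k h} = k"
    proof (rule Min_eqI[OF fin])
      show "k \<in> {k. k > i \<and> X k h \<and> pr Take k h}" using k chi_col[OF k(1-3)] by simp
      show "k \<le> m" if "m \<in> {k. k > i \<and> X k h \<and> pr Take k h}" for m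
        using that k(5)[of m] by fastforce
    qed
    then show "\<exists>h>i. X i h \<and> pr Take i h \<and> {k. k > i \<and> X k h \<and> pr Take k h} \<noteq> {} \<and>
      W (Min {k. k > i \<and> X k h \<and> pr Take k h})"
      using k chi_col[OF k(1,2,3)] chi_less[OF k(2)] by (intro exI[of _ h]) auto
  qed
qed

lemma HBack_Take_iff:
  "(\<exists>h>i. X i h \<and> pr Take i h \<and> {k. k < i \<and> X k h \<and> pr Take k h} \<noteq> {} \<and>
      W (Max {k. k < i \<and> X k h \<and> pr Take k h})) \<longleftrightarrow> (\<exists>k. Rel TB i k \<and> W k)"
proof -
  have fin: "finite {k. k < i \<and> X k h \<and> pr Take k h}" for h
    by (rule finite_subset[of _ "{..Suc n}"]) (auto dest: chi_less)
  show ?thesis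
  proof
    assume "\<exists>h>i. X i h \<and> pr Take i h \<and> {k. k < i \<and> X k h \<and> pr Take k h} \<noteq> {} \<and>
      W (Max {k. k < i \<and> X k h \<and> pr Take k h})"
    then obtain h where h: "X i h" "pr Take i h" "{k. k < i \<and> X k h \<and> pr Take k h} \<noteq> {}"
      "W (Max {k. k < i \<and> X k h \<and> pr Take k h})" (is "W ?k") by auto
    have k: "?k < i" "X ?k h" "pr Take ?k h" using Max_in[OF fin h(3)] by auto
    have "m \<le> ?k" if "X m h" "m < i" for m
    proof (rule ccontr)
      assume "\<not> m \<le> ?k"
      then have "pr Take m h" using chi_col[OF that(1) k(2)] by simp
      then show False using Max_ge[OF fin, of m] that \<open>\<not> m \<le> ?k\<close> by auto
    qed
    then show "\<exists>k. Rel TB i k \<and> W k" unfolding Rel_rev Rel_TN using h k by blast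
  next
    assume "\<exists>k. Rel TB i k \<and> W k"
    then obtain h k where k: "X i h" "X k h" "k < i" "pr Take k h" "\<And>m. X m h \<Longrightarrow> m < i \<Longrightarrow> m \<le> k" "W k"
      unfolding Rel_rev Rel_TN by auto
    then have "Max {k. k < i \<and> X k h \<and> pr Take k h} = k" by (intro Max_eqI[OF fin]) auto
    then show "\<exists>h>i. X i h \<and> pr Take i h \<and> {k. k < i \<and> X k h \<and> pr Take k h} \<noteq> {} \<and>
      W (Max {k. k < i \<and> X k h \<and> pr Take k h})"
      using k chi_col[OF k(1,2,3)] chi_less[OF k(1)] by (intro exI[of _ h]) auto
  qed
qed

lemma ctx_Yield: "csat (Dia (Past {(False, Yield)}) CTrue) k \<longleftrightarrow> (\<exists>h. X h k \<and> pr Yield h k)"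
  by (auto simp: cond_def chi_edge)

lemma ctx_Take: "csat (Dia (Fut {(False, Take)}) CTrue) k \<longleftrightarrow> (\<exists>h. X k h \<and> pr Take k h)"
  by (auto simp: cond_def chi_edge)

lemma successively_nth_tl:
  "successively R ps \<longleftrightarrow> (\<forall>q. q + 1 < length ps \<longrightarrow> R (ps ! q) (ps ! (q + 1)))"
  by (simp add: successively_conv_nth)

text \<open>Each step names its own \<open>h\<close>, but these agree because a position has at most
  one chain context with Yield. So the common \<open>h\<close> of a path becomes a condition on each
  position.\<close>

lemma yield_path_iff:
  "yield_path M x ps \<longleftrightarrow> ps \<noteq> [] \<and> successively (Rel YN) ps \<and> (\<forall>k\<in>set ps. \<exists>h. X h k \<and> pr Yield h k)"
proof
  assume y: "yield_path M x ps"
  then obtain h where h: "ps \<noteq> []" "sorted_wrt (<) ps" "\<forall>i\<in>set ps. X h i \<and> pr Yield h i"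
    "\<And>q k. q + 1 < length ps \<Longrightarrow> ps ! q < k \<Longrightarrow> k < ps ! (q + 1) \<Longrightarrow> \<not> X h k"
    unfolding yield_path_def is_path_def by metis
  have "Rel YN (ps ! q) (ps ! (q + 1))" if q: "q + 1 < length ps" for q
    unfolding Rel_YN
  proof (intro exI[of _ h] conjI allI impI)
    show "ps ! q < ps ! (q + 1)" using h(2) q by (simp add: sorted_wrt_nth_less)
    show "ps ! (q + 1) \<le> m" if "X h m" "ps ! q < m" for m using h(4)[OF q that(2)] that by fastforce
  qed (use h q in auto)
  then show "ps \<noteq> [] \<and> successively (Rel YN) ps \<and> (\<forall>k\<in>set ps. \<exists>h. X h k \<and> pr Yield h k)"
    using h by (auto simp: successively_nth_tl)
next
  assume a: "ps \<noteq> [] \<and> successively (Rel YN) ps \<and> (\<forall>k\<in>set ps. \<exists>h. X h k \<and> pr Yield h k)"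
  then obtain h where h: "X h (hd ps)" "pr Yield h (hd ps)" by (meson list.set_sel(1))
  have all: "ps \<noteq> [] \<Longrightarrow> successively (Rel YN) ps \<Longrightarrow> X h (hd ps) \<Longrightarrow> pr Yield h (hd ps) \<Longrightarrow>
     \<forall>k\<in>set ps. X h k \<and> pr Yield h k"
  proof (induction ps rule: induct_list012)
    case (3 a b ps)
    have "Rel YN a b" using 3(4) by (simp only: successively.simps)
    then obtain h' where h': "X h' a" "X h' b" "a < b" "pr Yield h' b" unfolding Rel_YN by auto
    have "h' = h" using chi_yield_unique[OF h'(1) chi_row[OF h'(1-3)], of h] 3(5,6) by simp
    then have "\<forall>k\<in>set (b # ps). X h k \<and> pr Yield h k" using 3(2) 3(4) h' by (simp del: Rel.simps)
    then show ?case using 3(5,6) by simp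
  qed auto
  have all': "\<forall>k\<in>set ps. X h k \<and> pr Yield h k" using all a h by blast
  have "successively (Rel YN) ps" using a by blast
  then have "successively (<) ps" by (rule successively_mono) (auto simp only: Rel_YN)
  then have s: "sorted_wrt (<) ps" by (simp add: successively_conv_sorted_wrt)
  have "is_path x ps" using a s all' chi_less unfolding is_path_def positions_def by fastforce
  moreover have "\<not> X h k" if q: "q + 1 < length ps" "ps ! q < k" "k < ps ! (q + 1)" for q k
  proof
    assume k: "X h k"
    have "Rel YN (ps ! q) (ps ! (q + 1))" using a q by (simp add: successively_nth_tl)
    then obtain h' where h': "X h' (ps ! q)" "X h' (ps ! (q + 1))" "\<And>m. X h' m \<Longrightarrow> ps ! q < m \<Longrightarrow> ps ! (q + 1) \<le> m"
      unfolding Rel_YN by auto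
    have "h' = h" 
      using chi_yield_unique[OF h'(1)] chi_row[OF h'(1,2)] q all' by (auto simp: nth_mem)
    then show False using h'(3)[of k] k q by auto
  qed
  moreover have "h < hd ps" using chi_less[OF h(1)] by simp
  ultimately show "yield_path M x ps" unfolding yield_path_def using all' by blast
qed

lemma take_path_iff:
  "take_path M x ps \<longleftrightarrow> ps \<noteq> [] \<and> successively (Rel TN) ps \<and> (\<forall>k\<in>set ps. \<exists>h. X k h \<and> pr Take k h)"
proof
  assume y: "take_path M x ps"
  then obtain h where h: "ps \<noteq> []" "sorted_wrt (<) ps" "\<forall>i\<in>set ps. X i h \<and> pr Take i h"
    "\<And>q k. q + 1 < length ps \<Longrightarrow> ps ! q < k \<Longrightarrow> k < ps ! (q + 1) \<Longrightarrow> \<not> X k h"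
    unfolding take_path_def is_path_def by metis
  have "Rel TN (ps ! q) (ps ! (q + 1))" if q: "q + 1 < length ps" for q
    unfolding Rel_TN
  proof (intro exI[of _ h] conjI allI impI)
    show "ps ! q < ps ! (q + 1)" using h(2) q by (simp add: sorted_wrt_nth_less)
    show "m \<le> ps ! q" if "X m h" "m < ps ! (q + 1)" for m using h(4)[OF q _ that(2)] that by fastforce
  qed (use h q in auto)
  then show "ps \<noteq> [] \<and> successively (Rel TN) ps \<and> (\<forall>k\<in>set ps. \<exists>h. X k h \<and> pr Take k h)"
    using h by (auto simp: successively_nth_tl)
next
  assume a: "ps \<noteq> [] \<and> successively (Rel TN) ps \<and> (\<forall>k\<in>set ps. \<exists>h. X k h \<and> pr Take k h)"
  then obtain h where h: "X (hd ps) h" "pr Take (hd ps) h" by (meson list.set_sel(1))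
  have all: "ps \<noteq> [] \<Longrightarrow> successively (Rel TN) ps \<Longrightarrow> X (hd ps) h \<Longrightarrow> pr Take (hd ps) h \<Longrightarrow>
     \<forall>k\<in>set ps. X k h \<and> pr Take k h"
  proof (induction ps rule: induct_list012)
    case (3 a b ps)
    have "Rel TN a b" using 3(4) by (simp only: successively.simps)
    then obtain h' where h': "X b h'" "X a h'" "a < b" "pr Take a h'" unfolding Rel_TN by auto
    have "h' = h" using chi_take_unique[OF h'(2,4), of h] 3(5,6) by simp
    then have "\<forall>k\<in>set (b # ps). X k h \<and> pr Take k h" using 3(2) 3(4) h' chi_col[OF h'(1-3)] by (simp del: Rel.simps)
    then show ?case using 3(5,6) by simp
  qed auto
  have all': "\<forall>k\<in>set ps. X k h \<and> pr Take k h" using all a h by blast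
  have "successively (Rel TN) ps" using a by blast
  then have "successively (<) ps" by (rule successively_mono) (auto simp only: Rel_TN)
  then have s: "sorted_wrt (<) ps" by (simp add: successively_conv_sorted_wrt)
  have "is_path x ps" using a s all' chi_less unfolding is_path_def positions_def by fastforce
  moreover have "\<not> X k h" if q: "q + 1 < length ps" "ps ! q < k" "k < ps ! (q + 1)" for q k
  proof
    assume k: "X k h"
    have "Rel TN (ps ! q) (ps ! (q + 1))" using a q by (simp add: successively_nth_tl)
    then obtain h' where h': "X (ps ! q) h'" "pr Take (ps ! q) h'" "\<And>m. X m h' \<Longrightarrow> m < ps ! (q + 1) \<Longrightarrow> m \<le> ps ! q"
      unfolding Rel_TN by auto
    have "h' = h" 
      using chi_take_unique[OF h'(1,2)] q all' by (auto simp: nth_mem)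
    then show False using h'(3)[of k] k q by auto
  qed
  moreover have "last ps < h" using all' a chi_less by (meson last_in_set Suc_lessD)
  ultimately show "take_path M x ps" unfolding take_path_def using all' by blast
qed

section \<open>Summary paths\<close>

definition sum_step :: "prec set \<Rightarrow> nat \<Rightarrow> nat \<Rightarrow> nat \<Rightarrow> bool" where
  "sum_step \<Pi> j i t \<longleftrightarrow> (let K = {h. h \<le> j \<and> X i h \<and> (\<exists>\<pi>\<in>\<Pi>. pr \<pi> i h)}
        in if K \<noteq> {} then t = Max K else t = i + 1 \<and> (\<exists>\<pi>\<in>\<Pi>. pr \<pi> i (i + 1)))"

text \<open>The steps depend on the end of the path, so a summary path does not follow a fixed
  relation on positions. The lemmas up to \<open>Since_iff\<close> remove this dependence.\<close>

lemma summary_path_iff: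
  "summary_path M x \<Pi> ps \<longleftrightarrow> ps \<noteq> [] \<and> successively (<) ps \<and> set ps \<subseteq> {..Suc n} \<and>
     successively (sum_step \<Pi> (last ps)) ps"
  unfolding summary_path_def is_path_def successively_nth_tl[of "sum_step \<Pi> (last ps)"] sum_step_def
  by (simp add: positions_def successively_conv_sorted_wrt atLeast0AtMost)

lemma Rel_Fut_UNIV: "Rel (Fut (UNIV \<times> \<Pi>)) i k \<longleftrightarrow> edge i k \<and> (\<exists>\<pi>\<in>\<Pi>. pr \<pi> i k)"
  by (auto simp: cond_def)

lemma finite_sum_set: "finite {h. h \<le> j \<and> X i h \<and> (\<exists>\<pi>\<in>\<Pi>. pr \<pi> i h)}"
  by (rule finite_subset[of _ "{..j}"]) auto

lemma sum_step_Rel: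
  assumes "sum_step \<Pi> j i t" "i \<le> n" shows "Rel (Fut (UNIV \<times> \<Pi>)) i t"
proof -
  let ?K = "{h. h \<le> j \<and> X i h \<and> (\<exists>\<pi>\<in>\<Pi>. pr \<pi> i h)}"
  show ?thesis
  proof (cases "?K = {}")
    case True
    then show ?thesis using assms edge_fresh unfolding Rel_Fut_UNIV sum_step_def Let_def by simp
  next
    case False
    then have "t = Max ?K" using assms unfolding sum_step_def Let_def by simp
    then have "t \<in> ?K" using Max_in[OF finite_sum_set False] by simp
    then show ?thesis unfolding Rel_Fut_UNIV by (simp add: chi_edge)
  qed
qed

lemma summary_path_Rel:
  assumes "summary_path M x \<Pi> ps" shows "successively (Rel (Fut (UNIV \<times> \<Pi>))) ps"
  unfolding successively_nth_tl
proof (intro allI impI)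
  fix q assume q: "q + 1 < length ps"
  have p: "successively (<) ps" "set ps \<subseteq> {..Suc n}" "successively (sum_step \<Pi> (last ps)) ps"
    using assms unfolding summary_path_iff by auto
  have "ps ! q < ps ! (q + 1)" "ps ! (q + 1) \<in> set ps" "sum_step \<Pi> (last ps) (ps ! q) (ps ! (q + 1))"
    using p(1,3) q unfolding successively_nth_tl by auto
  then show "Rel (Fut (UNIV \<times> \<Pi>)) (ps ! q) (ps ! (q + 1))" using sum_step_Rel p(2) by fastforce
qed

text \<open>
  Edges do not cross, so a path that enters the span of an edge from \<open>i\<close> and ends beyond it visits
  the far end. Hence the maximal jumps of summary paths only skip positions.
\<close>

lemma path_through:
  assumes "successively (Rel (Fut C)) (k # r)" "edge i m" "i < k" "k \<le> m" "m \<le> last (k # r)"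
  shows "m \<in> set (k # r)"
  using assms
proof (induction r arbitrary: k)
  case (Cons k' r)
  show ?case
  proof (cases "k = m")
    case False
    have "edge k k'" using Cons.prems(1) by simp
    then have "k' \<le> m" "k < k'" using edge_noncross[OF Cons.prems(2)] edge_less Cons.prems False by fastforce+
    then show ?thesis using Cons.IH[of k'] Cons.prems by auto
  qed simp
qed auto

text \<open>The first step is replaced by the prescribed one, whose target is on the path; what it
  skips is dropped, and induction handles the rest. Since \<open>set qs \<subseteq> set ps\<close>,
  whatever holds along the old path holds along the new one.\<close>

lemma summary_path_exists:
  assumes "successively (Rel (Fut (UNIV \<times> \<Pi>))) ps" "ps \<noteq> []" "set ps \<subseteq> {..Suc n}"
  shows "\<exists>qs. summary_path M x \<Pi> qs \<and> hd qs = hd ps \<and> last qs = last ps \<and> set qs \<subseteq> set ps"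
  using assms
proof (induction ps rule: length_induct)
  case (1 ps)
  obtain i r where ps: "ps = i # r" using 1 by (cases ps) auto
  show ?case
  proof (cases r)
    case Nil
    then show ?thesis using ps 1(4) by (intro exI[of _ "[i]"]) (auto simp: summary_path_iff)
  next
    case (Cons k r')
    let ?R = "Rel (Fut (UNIV \<times> \<Pi>))"
    have ik: "?R i k" and kr: "successively ?R (k # r')" using 1(2) ps Cons by auto
    have e: "edge i k" "\<exists>\<pi>\<in>\<Pi>. pr \<pi> i k" "i < k" using ik edge_less unfolding Rel_Fut_UNIV by auto
    have "successively (<) (k # r')" using kr by (rule successively_mono) (auto dest: edge_less)
    then have "sorted_wrt (<) (k # r')" by (simp add: successively_conv_sorted_wrt)
    then have kl: "k \<le> last ps" using ps Cons last_in_set[of r'] by fastforce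
    let ?K = "{h. h \<le> last ps \<and> X i h \<and> (\<exists>\<pi>\<in>\<Pi>. pr \<pi> i h)}"
    have kK: "k \<noteq> Suc i \<Longrightarrow> k \<in> ?K" using e kl by (auto simp: chi_edge)
    have "\<exists>us t vs. k # r' = us @ t # vs \<and> i < t \<and> sum_step \<Pi> (last ps) i t"
    proof (cases "?K = {}")
      case True
      then have "k = Suc i" using kK by blast
      then have "sum_step \<Pi> (last ps) i k" using True e unfolding sum_step_def Let_def by simp
      then show ?thesis using e(3) by (intro exI[of _ "[]"]) auto
    next
      case False
      let ?m = "Max ?K"
      have m: "?m \<in> ?K" using Max_in[OF finite_sum_set False] .
      then have im: "edge i ?m" "Suc i < ?m" "?m \<le> last ps" using chi_less by (auto simp: chi_edge)
      have "k \<le> ?m"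
      proof (cases "k = Suc i")
        case False
        then show ?thesis using Max_ge[OF finite_sum_set kK] by simp
      qed (use im in simp)
      then have "?m \<in> set (k # r')" using path_through[OF kr im(1) e(3)] im(3) ps Cons by simp
      then obtain us vs where "k # r' = us @ ?m # vs" by (meson split_list)
      moreover have "sum_step \<Pi> (last ps) i ?m" using False unfolding sum_step_def Let_def by simp
      ultimately show ?thesis using Suc_lessD[OF im(2)] by blast
    qed
    then obtain us t vs where t: "k # r' = us @ t # vs" "i < t" "sum_step \<Pi> (last ps) i t" by blast
    have l: "last (t # vs) = last ps" using t(1) ps Cons by (metis last_ConsR last_appendR list.distinct(1))
    have "successively ?R (t # vs)" using kr t(1) by (simp add: successively_append_iff)
    moreover have "length (t # vs) < length ps"
      using arg_cong[OF t(1), of length] ps Cons by simp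
    moreover have sub: "set (t # vs) \<subseteq> set ps"
      using arg_cong[OF t(1), of set] ps Cons by auto
    ultimately obtain qs where qs: "summary_path M x \<Pi> qs" "hd qs = t" "last qs = last ps" "set qs \<subseteq> set (t # vs)"
      using 1(1)[rule_format, of "t # vs"] 1(4) l by auto
    have "summary_path M x \<Pi> (i # qs)"
      using qs t(2,3) 1(4) ps unfolding summary_path_iff by (auto simp: successively_Cons)
    moreover have "qs \<noteq> []" using qs(1) unfolding summary_path_iff by simp
    ultimately show ?thesis using qs sub ps by (intro exI[of _ "i # qs"]) auto
  qed
qed

lemma Until_iff:
  assumes "i \<le> Suc n"
  shows "until_on (summary_path M x \<Pi>) A B i \<longleftrightarrow> holds_fix (Rel (Fut (UNIV \<times> \<Pi>))) (\<lambda>_. True) A B i"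
proof
  assume "until_on (summary_path M x \<Pi>) A B i"
  then show "holds_fix (Rel (Fut (UNIV \<times> \<Pi>))) (\<lambda>_. True) A B i"
    unfolding until_on_def holds_fix_path using summary_path_Rel summary_path_iff by metis
next
  assume "holds_fix (Rel (Fut (UNIV \<times> \<Pi>))) (\<lambda>_. True) A B i"
  then obtain ps where ps: "ps \<noteq> []" "hd ps = i" "successively (Rel (Fut (UNIV \<times> \<Pi>))) ps"
    "\<forall>k\<in>set (butlast ps). A k" "B (last ps)" unfolding holds_fix_path by auto
  have s: "successively (Rel (Fut (UNIV \<times> \<Pi>))) ps \<Longrightarrow> ps \<noteq> [] \<Longrightarrow> hd ps \<le> Suc n \<Longrightarrow> set ps \<subseteq> {..Suc n}" for ps
    by (induction ps rule: induct_list012) (auto dest: edge_less)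
  obtain qs where qs: "summary_path M x \<Pi> qs" "hd qs = hd ps" "last qs = last ps" "set qs \<subseteq> set ps"
    using summary_path_exists[OF ps(3,1)] s[OF ps(3,1)] assms ps(2) by blast
  have q: "qs \<noteq> []" "distinct qs"
    using qs(1) unfolding summary_path_iff by (auto simp: successively_conv_sorted_wrt strict_sorted_iff)
  \<comment> \<open>Positions on \<open>qs\<close> do not repeat, so the common end of
    \<open>qs\<close> and \<open>ps\<close> does not occur in \<open>butlast qs\<close>.\<close>
  have "set (butlast qs) \<subseteq> set (butlast ps)"
  proof
    fix k assume k: "k \<in> set (butlast qs)"
    have "distinct (butlast qs @ [last qs])" using q by simp
    then have "k \<noteq> last ps" using k qs(3) by auto
    moreover have "k \<in> set (butlast ps @ [last ps])" using k qs(4) ps(1) in_set_butlastD by fastforce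
    ultimately show "k \<in> set (butlast ps)" by simp
  qed
  then show "until_on (summary_path M x \<Pi>) A B i"
    unfolding until_on_def using qs ps by (intro exI[of _ qs]) auto
qed

lemma Since_iff:
  assumes "i \<le> Suc n"
  shows "since_on (summary_path M x \<Pi>) A B i \<longleftrightarrow> holds_fix (Rel (Past (UNIV \<times> \<Pi>))) (\<lambda>_. True) A B i"
  unfolding Rel_rev(3)
proof
  assume "since_on (summary_path M x \<Pi>) A B i"
  then show "holds_fix (\<lambda>a b. Rel (Fut (UNIV \<times> \<Pi>)) b a) (\<lambda>_. True) A B i"
    unfolding since_on_def holds_fix_path_rev using summary_path_Rel summary_path_iff by metis
next
  assume "holds_fix (\<lambda>a b. Rel (Fut (UNIV \<times> \<Pi>)) b a) (\<lambda>_. True) A B i"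
  then obtain ps where ps: "ps \<noteq> []" "last ps = i" "successively (Rel (Fut (UNIV \<times> \<Pi>))) ps"
    "\<forall>k\<in>set (tl ps). A k" "B (hd ps)" unfolding holds_fix_path_rev by auto
  have s: "successively (Rel (Fut (UNIV \<times> \<Pi>))) ps \<Longrightarrow> ps \<noteq> [] \<Longrightarrow> last ps \<le> Suc n \<Longrightarrow> set ps \<subseteq> {..Suc n}" for ps
    by (induction ps rule: induct_list012) (auto dest: edge_less)
  obtain qs where qs: "summary_path M x \<Pi> qs" "hd qs = hd ps" "last qs = last ps" "set qs \<subseteq> set ps"
    using summary_path_exists[OF ps(3,1)] s[OF ps(3,1)] assms ps(2) by blast
  have q: "qs \<noteq> []" "distinct qs"
    using qs(1) unfolding summary_path_iff by (auto simp: successively_conv_sorted_wrt strict_sorted_iff)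
  have "set (tl qs) \<subseteq> set (tl ps)"
  proof
    fix k assume k: "k \<in> set (tl qs)"
    have "distinct (hd qs # tl qs)" using q by simp
    then have "k \<noteq> hd ps" using k qs(2) by auto
    moreover have "k \<in> set (hd ps # tl ps)" using k qs(4) ps(1) q(1) list.set_sel(2) by fastforce
    ultimately show "k \<in> set (tl ps)" by simp
  qed
  then show "since_on (summary_path M x \<Pi>) A B i"
    unfolding since_on_def using qs ps by (intro exI[of _ qs]) auto
qed

section \<open>Translation of POTL into the core logic\<close>

lemma until_on_cong:
  assumes "\<And>ps. \<Gamma> ps \<Longrightarrow> is_path x ps" "\<And>k. k \<le> Suc n \<Longrightarrow> A k = A' k" "\<And>k. k \<le> Suc n \<Longrightarrow> B k = B' k"
  shows "until_on \<Gamma> A B i = until_on \<Gamma> A' B' i"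
proof -
  have "\<Gamma> ps \<Longrightarrow> ((\<forall>k\<in>set (butlast ps). A k) \<and> B (last ps)) = ((\<forall>k\<in>set (butlast ps). A' k) \<and> B' (last ps))" for ps
    using assms(1)[of ps] assms(2,3) unfolding is_path_def positions_def
    by (metis add.commute atLeastAtMost_iff in_mono in_set_butlastD last_in_set plus_1_eq_Suc)
  then show ?thesis unfolding until_on_def by blast
qed

lemma since_on_cong:
  assumes "\<And>ps. \<Gamma> ps \<Longrightarrow> is_path x ps" "\<And>k. k \<le> Suc n \<Longrightarrow> A k = A' k" "\<And>k. k \<le> Suc n \<Longrightarrow> B k = B' k"
  shows "since_on \<Gamma> A B i = since_on \<Gamma> A' B' i"
proof -
  have "\<Gamma> ps \<Longrightarrow> (B (hd ps) \<and> (\<forall>k\<in>set (tl ps). A k)) = (B' (hd ps) \<and> (\<forall>k\<in>set (tl ps). A' k))" for ps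
    using assms(1)[of ps] assms(2,3) unfolding is_path_def positions_def
    by (metis add.commute atLeastAtMost_iff in_mono list.set_sel plus_1_eq_Suc)
  then show ?thesis unfolding since_on_def by blast
qed

lemma Dia_cong:
  assumes "\<And>k. k \<le> Suc n \<Longrightarrow> A k = A' k"
  shows "(\<exists>k. Rel r i k \<and> A k) \<longleftrightarrow> (\<exists>k. Rel r i k \<and> A' k)"
  using Rel_less assms by blast

lemma Rel_fresh:
  "Rel (Fut ({True} \<times> \<Pi>)) i k \<longleftrightarrow> k = Suc i \<and> i \<le> n \<and> (\<exists>\<pi>\<in>\<Pi>. pr \<pi> i k)"
  by (auto simp: cond_def edge_fresh dest: edge_less)

text \<open>The bound on \<open>i\<close> matters for paths of a single position:
  \<open>is_path\<close> demands a position of the word, \<open>holds_fix\<close> does not.\<close>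

lemma sat_csat: "i \<le> Suc n \<Longrightarrow> sat M x i \<phi> \<longleftrightarrow> csat (core_of \<phi>) i"
proof (induction \<phi> arbitrary: i)
  case (Next \<Pi> \<phi>)
  have "sat M x i (Next \<Pi> \<phi>) \<longleftrightarrow> (\<exists>k. Rel (Fut ({True} \<times> \<Pi>)) i k \<and> sat M x k \<phi>)"
    unfolding Rel_fresh using Next.prems by (auto simp: positions_def)
  also have "\<dots> \<longleftrightarrow> (\<exists>k. Rel (Fut ({True} \<times> \<Pi>)) i k \<and> csat (core_of \<phi>) k)"
    using Next.IH by (rule Dia_cong)
  finally show ?case by simp
next
  case (Back \<Pi> \<phi>)
  have "sat M x i (Back \<Pi> \<phi>) \<longleftrightarrow> (\<exists>k. Rel (Past ({True} \<times> \<Pi>)) i k \<and> sat M x k \<phi>)"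
    unfolding Rel_rev Rel_fresh using Back.prems by (cases i) auto
  also have "\<dots> \<longleftrightarrow> (\<exists>k. Rel (Past ({True} \<times> \<Pi>)) i k \<and> csat (core_of \<phi>) k)"
    using Back.IH by (rule Dia_cong)
  finally show ?case by simp
next
  case (ChainNext \<Pi> \<phi>)
  have "sat M x i (ChainNext \<Pi> \<phi>) \<longleftrightarrow> (\<exists>k. Rel (Fut ({False} \<times> \<Pi>)) i k \<and> sat M x k \<phi>)"
    by (auto simp: cond_def chi_edge dest: edge_less)
  also have "\<dots> \<longleftrightarrow> (\<exists>k. Rel (Fut ({False} \<times> \<Pi>)) i k \<and> csat (core_of \<phi>) k)"
    using ChainNext.IH by (rule Dia_cong)
  finally show ?case by simp
next
  case (ChainBack \<Pi> \<phi>)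
  have "sat M x i (ChainBack \<Pi> \<phi>) \<longleftrightarrow> (\<exists>k. Rel (Past ({False} \<times> \<Pi>)) i k \<and> sat M x k \<phi>)"
    by (auto simp: cond_def chi_edge dest: edge_less)
  also have "\<dots> \<longleftrightarrow> (\<exists>k. Rel (Past ({False} \<times> \<Pi>)) i k \<and> csat (core_of \<phi>) k)"
    using ChainBack.IH by (rule Dia_cong)
  finally show ?case by simp
next
  case (Until \<Pi> \<phi> \<psi>)
  have "sat M x i (Until \<Pi> \<phi> \<psi>) \<longleftrightarrow> until_on (summary_path M x \<Pi>) (csat (core_of \<phi>)) (csat (core_of \<psi>)) i"
    unfolding sat.simps by (rule until_on_cong) (use Until.IH in \<open>auto simp: summary_path_def\<close>)
  then show ?case using Until_iff[OF Until.prems] by simp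
next
  case (Since \<Pi> \<phi> \<psi>)
  have "sat M x i (Since \<Pi> \<phi> \<psi>) \<longleftrightarrow> since_on (summary_path M x \<Pi>) (csat (core_of \<phi>)) (csat (core_of \<psi>)) i"
    unfolding sat.simps by (rule since_on_cong) (use Since.IH in \<open>auto simp: summary_path_def\<close>)
  then show ?case using Since_iff[OF Since.prems] by simp
next
  case (HNext \<mu> \<phi>)
  show ?case
  proof (cases \<mu>)
    case HYield
    have "sat M x i (HNext \<mu> \<phi>) \<longleftrightarrow> (\<exists>k. Rel YN i k \<and> sat M x k \<phi>)"
      unfolding HYield sat.simps by (rule HNext_Yield_iff)
    also have "\<dots> \<longleftrightarrow> (\<exists>k. Rel YN i k \<and> csat (core_of \<phi>) k)" using HNext.IH by (rule Dia_cong)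
    finally show ?thesis by (simp add: HYield)
  next
    case HTake
    have "sat M x i (HNext \<mu> \<phi>) \<longleftrightarrow> (\<exists>k. Rel TN i k \<and> sat M x k \<phi>)"
      unfolding HTake sat.simps by (rule HNext_Take_iff)
    also have "\<dots> \<longleftrightarrow> (\<exists>k. Rel TN i k \<and> csat (core_of \<phi>) k)" using HNext.IH by (rule Dia_cong)
    finally show ?thesis by (simp add: HTake)
  qed
next
  case (HBack \<mu> \<phi>)
  show ?case
  proof (cases \<mu>)
    case HYield
    have "sat M x i (HBack \<mu> \<phi>) \<longleftrightarrow> (\<exists>k. Rel YB i k \<and> sat M x k \<phi>)"
      unfolding HYield sat.simps by (rule HBack_Yield_iff)
    also have "\<dots> \<longleftrightarrow> (\<exists>k. Rel YB i k \<and> csat (core_of \<phi>) k)" using HBack.IH by (rule Dia_cong)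
    finally show ?thesis by (simp add: HYield)
  next
    case HTake
    have "sat M x i (HBack \<mu> \<phi>) \<longleftrightarrow> (\<exists>k. Rel TB i k \<and> sat M x k \<phi>)"
      unfolding HTake sat.simps by (rule HBack_Take_iff)
    also have "\<dots> \<longleftrightarrow> (\<exists>k. Rel TB i k \<and> csat (core_of \<phi>) k)" using HBack.IH by (rule Dia_cong)
    finally show ?thesis by (simp add: HTake)
  qed
next
  case (HUntil \<mu> \<phi> \<psi>)
  show ?case
  proof (cases \<mu>)
    case HYield
    have "sat M x i (HUntil \<mu> \<phi> \<psi>) \<longleftrightarrow> until_on (yield_path M x) (csat (core_of \<phi>)) (csat (core_of \<psi>)) i"
      unfolding HYield sat.simps by (rule until_on_cong) (use HUntil.IH in \<open>auto simp: yield_path_def\<close>)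
    then show ?thesis
      unfolding HYield core_of.simps hprec.case csat.simps(6) holds_fix_path ctx_Yield until_on_def yield_path_iff
      by blast
  next
    case HTake
    have "sat M x i (HUntil \<mu> \<phi> \<psi>) \<longleftrightarrow> until_on (take_path M x) (csat (core_of \<phi>)) (csat (core_of \<psi>)) i"
      unfolding HTake sat.simps by (rule until_on_cong) (use HUntil.IH in \<open>auto simp: take_path_def\<close>)
    then show ?thesis
      unfolding HTake core_of.simps hprec.case csat.simps(6) holds_fix_path ctx_Take until_on_def take_path_iff
      by blast
  qed
next
  case (HSince \<mu> \<phi> \<psi>)
  show ?case
  proof (cases \<mu>)
    case HYield
    have "sat M x i (HSince \<mu> \<phi> \<psi>) \<longleftrightarrow> since_on (yield_path M x) (csat (core_of \<phi>)) (csat (core_of \<psi>)) i"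
      unfolding HYield sat.simps by (rule since_on_cong) (use HSince.IH in \<open>auto simp: yield_path_def\<close>)
    then show ?thesis
      unfolding HYield core_of.simps hprec.case csat.simps(6) Rel_rev holds_fix_path_rev ctx_Yield since_on_def yield_path_iff
      by blast
  next
    case HTake
    have "sat M x i (HSince \<mu> \<phi> \<psi>) \<longleftrightarrow> since_on (take_path M x) (csat (core_of \<phi>)) (csat (core_of \<psi>)) i"
      unfolding HTake sat.simps by (rule since_on_cong) (use HSince.IH in \<open>auto simp: take_path_def\<close>)
    then show ?thesis
      unfolding HTake core_of.simps hprec.case csat.simps(6) Rel_rev holds_fix_path_rev ctx_Take since_on_def take_path_iff
      by blast
  qed
next
  case (Neg \<phi>)
  show ?case using Neg.IH[OF Neg.prems] by simp
next
  case (Or \<phi> \<psi>)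
  show ?case using Or.IH(1)[OF Or.prems] Or.IH(2)[OF Or.prems] by simp
qed simp

end

subsection \<open>The automaton locally checks diamonds\<close>

text \<open>
  The state at an edge \<open>(i, p)\<close> holds the labels of \<open>i\<close> and \<open>p\<close> (pop moves read no letter, so \<open>i \<pi> p\<close> must
  be known to the state), whether \<open>p = i + 1\<close>, the formulas true at \<open>i\<close> and at \<open>p\<close>, and the diamonds
  already witnessed in the part of the row (for \<open>Fut\<close>) or of the column (for \<open>Past\<close>) seen so far.
\<close>

datatype 'a astate = AState (cur_lab: "'a symb") (nxt_lab: "'a symb") (is_fresh: bool)
  (cur: "'a core set") (nxt: "'a core set") (acc: "'a core set")

definition prec_at :: "'a opm \<Rightarrow> 'a astate \<Rightarrow> prec option" where
  "prec_at M q = M (cur_lab q) (nxt_lab q)"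

definition hit :: "'a opm \<Rightarrow> (bool \<times> prec) set \<Rightarrow> 'a astate \<Rightarrow> bool" where
  "hit M C q \<longleftrightarrow> (\<exists>\<pi>. prec_at M q = Some \<pi> \<and> (is_fresh q, \<pi>) \<in> C)"

text \<open>A fresh edge is the first of its row and of its column, so both kinds of accumulator
  start here.\<close>

fun fresh_ok :: "'a opm \<Rightarrow> 'a astate \<Rightarrow> rel \<Rightarrow> 'a core \<Rightarrow> bool" where
  "fresh_ok M q (Fut C) g \<longleftrightarrow> (Dia (Fut C) g \<in> acc q \<longleftrightarrow> hit M C q \<and> g \<in> nxt q)"
| "fresh_ok M q (Past C) g \<longleftrightarrow> (Dia (Past C) g \<in> acc q \<longleftrightarrow> hit M C q \<and> g \<in> cur q)"
| "fresh_ok M q _ g \<longleftrightarrow> True"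

text \<open>Nothing lies to the left of position 0: neither a target for \<open>Past\<close> nor a
  context for \<open>YN\<close> and \<open>YB\<close>.\<close>

definition first_ok :: "'a astate \<Rightarrow> rel \<Rightarrow> 'a core \<Rightarrow> bool" where
  "first_ok q r g \<longleftrightarrow> (r \<in> range Past \<union> {YN, YB} \<longrightarrow> Dia r g \<notin> cur q)"

text \<open>Nothing lies to the right of the last position: neither a target for \<open>Fut\<close>
  and \<open>YN\<close> nor a context for \<open>TN\<close> and \<open>TB\<close>.\<close>

definition last_ok :: "'a astate \<Rightarrow> rel \<Rightarrow> 'a core \<Rightarrow> bool" where
  "last_ok q r g \<longleftrightarrow> (r \<in> range Fut \<union> {YN, TN, TB} \<longrightarrow> Dia r g \<notin> nxt q)"

text \<open>Checked at the last edge of a column, where the accumulator is complete. No other edge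
  of the column can have Yield, so this edge decides whether the position has a yield
  context.\<close>

fun col_ok :: "'a opm \<Rightarrow> 'a astate \<Rightarrow> rel \<Rightarrow> 'a core \<Rightarrow> bool" where
  "col_ok M q (Past C) g \<longleftrightarrow> (Dia (Past C) g \<in> nxt q \<longleftrightarrow> Dia (Past C) g \<in> acc q)"
| "col_ok M q YN g \<longleftrightarrow> (is_fresh q \<or> prec_at M q \<noteq> Some Yield \<longrightarrow> Dia YN g \<notin> nxt q)"
| "col_ok M q YB g \<longleftrightarrow> (is_fresh q \<or> prec_at M q \<noteq> Some Yield \<longrightarrow> Dia YB g \<notin> nxt q)"
| "col_ok M q _ g \<longleftrightarrow> True"

text \<open>Checked at the last edge of a row, the only one in the row that can have Take.\<close>

fun row_ok :: "'a opm \<Rightarrow> 'a astate \<Rightarrow> rel \<Rightarrow> 'a core \<Rightarrow> bool" where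
  "row_ok M q (Fut C) g \<longleftrightarrow> (Dia (Fut C) g \<in> cur q \<longleftrightarrow> Dia (Fut C) g \<in> acc q)"
| "row_ok M q TN g \<longleftrightarrow> (is_fresh q \<or> prec_at M q \<noteq> Some Take \<longrightarrow> Dia TN g \<notin> cur q)"
| "row_ok M q TB g \<longleftrightarrow> (is_fresh q \<or> prec_at M q \<noteq> Some Take \<longrightarrow> Dia TB g \<notin> cur q)"
| "row_ok M q _ g \<longleftrightarrow> True"

text \<open>\<open>q\<close>, \<open>qs\<close> and \<open>q'\<close> sit at the popped edge
  \<open>(j, p)\<close>, the push edge \<open>(i, s)\<close> and the new edge \<open>(i, p)\<close>.
  Row accumulators continue from \<open>qs\<close>, column accumulators from \<open>q\<close>;
  hierarchical operators compare \<open>s\<close> with \<open>p\<close> or \<open>i\<close> with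
  \<open>j\<close>.\<close>

fun pop_ok :: "'a opm \<Rightarrow> 'a astate \<Rightarrow> 'a astate \<Rightarrow> 'a astate \<Rightarrow> rel \<Rightarrow> 'a core \<Rightarrow> bool" where
  "pop_ok M q qs q' (Fut C) g \<longleftrightarrow>
     (Dia (Fut C) g \<in> acc q' \<longleftrightarrow> Dia (Fut C) g \<in> acc qs \<or> hit M C q' \<and> g \<in> nxt q')"
| "pop_ok M q qs q' (Past C) g \<longleftrightarrow>
     (Dia (Past C) g \<in> acc q' \<longleftrightarrow> Dia (Past C) g \<in> acc q \<or> hit M C q' \<and> g \<in> cur q')"
| "pop_ok M q qs q' YN g \<longleftrightarrow>
     (\<not> is_fresh qs \<longrightarrow> (Dia YN g \<in> nxt qs \<longleftrightarrow> prec_at M q' = Some Yield \<and> g \<in> nxt q'))"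
| "pop_ok M q qs q' YB g \<longleftrightarrow>
     (prec_at M q' = Some Yield \<longrightarrow> (Dia YB g \<in> nxt q' \<longleftrightarrow> \<not> is_fresh qs \<and> g \<in> nxt qs))"
| "pop_ok M q qs q' TN g \<longleftrightarrow>
     (prec_at M q' = Some Take \<longrightarrow> (Dia TN g \<in> cur q' \<longleftrightarrow> \<not> is_fresh q \<and> g \<in> cur q))"
| "pop_ok M q qs q' TB g \<longleftrightarrow>
     (\<not> is_fresh q \<longrightarrow> (Dia TB g \<in> cur q \<longleftrightarrow> prec_at M q' = Some Take \<and> g \<in> cur q'))"

section \<open>Soundness and completeness of the checks for one diamond\<close>

context good_word begin

definition dia_ok :: "(nat \<Rightarrow> nat \<Rightarrow> 'a astate) \<Rightarrow> rel \<Rightarrow> 'a core \<Rightarrow> bool" where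
  "dia_ok L r g \<longleftrightarrow> first_ok (L 0 1) r g \<and> last_ok (L 0 (Suc n)) r g \<and>
     (\<forall>i\<le>n. fresh_ok M (L i (Suc i)) r g) \<and>
     (\<forall>i p. edge i p \<longrightarrow> \<not> pr Take i p \<longrightarrow> col_ok M (L i p) r g) \<and>
     (\<forall>i p. edge i p \<longrightarrow> \<not> pr Yield i p \<or> i = 0 \<and> p = Suc n \<longrightarrow> row_ok M (L i p) r g) \<and>
     (\<forall>j p i s. pop_event j p i s \<longrightarrow> pop_ok M (L j p) (L i s) (L i p) r g)"

text \<open>The guesses about a position agree at all its edges and thus form one truth
  assignment.\<close>

definition consist :: "(nat \<Rightarrow> nat \<Rightarrow> 'a astate) \<Rightarrow> ('a core \<Rightarrow> nat \<Rightarrow> bool) \<Rightarrow> bool" where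
  "consist L v \<longleftrightarrow> (\<forall>i p. edge i p \<longrightarrow> cur_lab (L i p) = lab i \<and> nxt_lab (L i p) = lab p \<and>
     (is_fresh (L i p) \<longleftrightarrow> p = Suc i) \<and> (\<forall>f. f \<in> cur (L i p) \<longleftrightarrow> v f i) \<and> (\<forall>f. f \<in> nxt (L i p) \<longleftrightarrow> v f p))"

text \<open>A run traverses a row towards larger \<open>p\<close> and a column towards smaller
  \<open>i\<close>, hence the two ranges.\<close>

fun acc_sem :: "('a core \<Rightarrow> nat \<Rightarrow> bool) \<Rightarrow> 'a core \<Rightarrow> nat \<Rightarrow> nat \<Rightarrow> bool" where
  "acc_sem u (Dia (Fut C) g) i p \<longleftrightarrow> (\<exists>k\<le>p. edge i k \<and> cond C i k \<and> u g k)"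
| "acc_sem u (Dia (Past C) g) i p \<longleftrightarrow> (\<exists>k\<ge>i. edge k p \<and> cond C k p \<and> u g k)"
| "acc_sem u _ i p \<longleftrightarrow> False"

definition canon :: "'a core set \<Rightarrow> ('a core \<Rightarrow> nat \<Rightarrow> bool) \<Rightarrow> nat \<Rightarrow> nat \<Rightarrow> 'a astate" where
  "canon S u i p = AState (lab i) (lab p) (p = Suc i) {f. u f i} {f. u f p} {f \<in> S. acc_sem u f i p}"

lemma canon_sel [simp]:
  "cur_lab (canon S u i p) = lab i" "nxt_lab (canon S u i p) = lab p" "is_fresh (canon S u i p) \<longleftrightarrow> p = Suc i"
  "f \<in> cur (canon S u i p) \<longleftrightarrow> u f i" "f \<in> nxt (canon S u i p) \<longleftrightarrow> u f p"
  "f \<in> acc (canon S u i p) \<longleftrightarrow> f \<in> S \<and> acc_sem u f i p"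
  "prec_at M (canon S u i p) = Some \<pi> \<longleftrightarrow> pr \<pi> i p"
  "hit M C (canon S u i p) \<longleftrightarrow> cond C i p"
  by (auto simp: canon_def prec_at_def prel_def hit_def cond_def)

lemma consist_canon: "consist (canon S u) u"
  by (simp add: consist_def)

text \<open>By the gap lemmas a pop adds exactly one edge to the visited part of a row and of a
  column, so accumulators are updated correctly. Uniqueness of Yield and Take contexts reduces a
  hierarchical step to the event at hand.\<close>

lemma dia_ok_canon:
  assumes f: "Dia r g \<in> S" and u: "\<And>i. i \<le> Suc n \<Longrightarrow> u (Dia r g) i \<longleftrightarrow> (\<exists>k. Rel r i k \<and> u g k)"
  shows "dia_ok (canon S u) r g"
  unfolding dia_ok_def
proof (intro conjI allI impI)
  show "first_ok (canon S u 0 1) r g"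
    using u[of 0] by (auto simp: first_ok_def dest!: edge_less pop_event_bounds)
  show "last_ok (canon S u 0 (Suc n)) r g"
    using u[of "Suc n"] by (auto simp: last_ok_def dest!: edge_less pop_event_bounds dest: pop_event_edges(5))
next
  fix i assume "i \<le> n"
  then have e: "edge i (Suc i)" using edge_fresh by simp
  have "edge i k \<and> k \<le> Suc i \<longleftrightarrow> k = Suc i" "edge k (Suc i) \<and> i \<le> k \<longleftrightarrow> k = i" for k
    using e edge_less[of i k] edge_less[of k "Suc i"] by auto
  then show "fresh_ok M (canon S u i (Suc i)) r g"
    using f by (cases r) (auto, metis+)
next
  fix i p assume e: "edge i p" "\<not> pr Take i p"
  have p: "p \<le> Suc n" using edge_less[OF e(1)] by simp
  have *: "h = i" if "edge h p" "\<not> pr Take h p" for h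
    using col_end[OF e that(1)] col_end[OF that e(1)] by simp
  have Y: "\<not> pr Take h k" if "pr Yield h k" for h k using prel_unique that by blast
  show "col_ok M (canon S u i p) r g"
  proof (cases r)
    case (Past C)
    then show ?thesis using f u[OF p] col_end[OF e] by auto
  next
    case YN
    have "False" if t: "pop_event j k h p" "p \<noteq> Suc h" and a: "p = Suc i \<or> \<not> pr Yield i p" for j k h
      using *[of h] pop_event_edges[OF t(1)] Y[of h p] t a by auto
    then show ?thesis using YN u[OF p] by auto
  next
    case YB
    have "False" if t: "pop_event j p h k" "pr Yield h p" and a: "p = Suc i \<or> \<not> pr Yield i p" for j k h
      using *[of h] pop_event_edges[OF t(1)] Y[of h p] t a by auto
    then show ?thesis using YB u[OF p] by auto
  qed auto
next
  fix i p assume e: "edge i p" "\<not> pr Yield i p \<or> i = 0 \<and> p = Suc n"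
  have i: "i \<le> Suc n" using edge_less[OF e(1)] by simp
  have last: "k \<le> p" if "edge i k" for k
    using e row_end[OF e(1) _ that] edge_less[OF that] by auto
  have *: "h = p" if "edge i h" "pr Take i h" for h
  proof -
    have "\<not> pr Yield i h" using prel_unique that by blast
    then show ?thesis using row_end[OF that(1) _ e(1)] last[OF that(1)] by simp
  qed
  show "row_ok M (canon S u i p) r g"
  proof (cases r)
    case (Fut C)
    then show ?thesis using f u[OF i] last by auto
  next
    case TN
    have "False" if t: "pop_event k h i s" "pr Take i h" and a: "p = Suc i \<or> \<not> pr Take i p" for k h s
      using *[of h] pop_event_edges[OF t(1)] t a by auto
    then show ?thesis using TN u[OF i] by auto
  next
    case TB
    have "False" if t: "pop_event i h k s" "h \<noteq> Suc i" and a: "p = Suc i \<or> \<not> pr Take i p" for k h s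
      using *[of h] pop_event_edges[OF t(1)] t a by auto
    then show ?thesis using TB u[OF i] by auto
  qed auto
next
  fix j p i s assume t: "pop_event j p i s"
  note e = pop_event_edges[OF t]
  have b: "i \<le> Suc n" "j \<le> Suc n" "s \<le> Suc n" "p \<le> Suc n" using pop_event_bounds[OF t] by auto
  show "pop_ok M (canon S u j p) (canon S u i s) (canon S u i p) r g"
  proof (cases r)
    case (Fut C)
    have "edge i k \<and> k \<le> p \<longleftrightarrow> edge i k \<and> k \<le> s \<or> k = p" for k
      using pop_event_row_gap[OF t, of k] e by (cases "s < k") auto
    then show ?thesis using Fut f by auto
  next
    case (Past C)
    have "edge k p \<and> i \<le> k \<longleftrightarrow> edge k p \<and> j \<le> k \<or> k = i" for k
      using pop_event_col_gap[OF t, of k] e by (cases "k < j") auto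
    then show ?thesis using Past f by auto
  next
    case YN
    have "Rel YN s k \<longleftrightarrow> k = p \<and> pr Yield i p" if "s \<noteq> Suc i" for k
    proof
      assume "Rel YN s k"
      then obtain h j' where t': "pop_event j' k h s" "pr Yield h k" by auto
      have "h = i" using yield_unique e(3,4) pop_event_edges(3,4)[OF t'(1)] by blast
      moreover have "k = p"
        using pop_event_row_gap[OF t, of k] pop_event_row_gap[OF t'(1), of p] pop_event_edges[OF t'(1)] e \<open>h = i\<close> by auto
      ultimately show "k = p \<and> pr Yield i p" using t' by simp
    qed (use t that in auto)
    then show ?thesis using YN u[OF b(3)] by auto
  next
    case YB
    have "Rel YB p k \<longleftrightarrow> k = s \<and> s \<noteq> Suc i" if y: "pr Yield i p" for k
    proof
      assume "Rel YB p k"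
      then obtain h j' where t': "pop_event j' p h k" "k \<noteq> Suc h" "pr Yield h p" by auto
      have "h = i" using yield_unique e(6) y pop_event_edges(6)[OF t'(1)] t'(3) by blast
      moreover have "k = s"
        using pop_event_row_gap[OF t, of k] pop_event_row_gap[OF t'(1), of s] pop_event_edges[OF t'(1)] e \<open>h = i\<close>
        by (cases "k < s"; cases "s < k") auto
      ultimately show "k = s \<and> s \<noteq> Suc i" using t' by simp
    qed (use t that in auto)
    then show ?thesis using YB u[OF b(4)] by auto
  next
    case TN
    have "Rel TN i k \<longleftrightarrow> k = j \<and> p \<noteq> Suc j" if y: "pr Take i p" for k
    proof
      assume "Rel TN i k"
      then obtain h s' where t': "pop_event k h i s'" "h \<noteq> Suc k" "pr Take i h" by auto
      have "h = p" using take_unique e(6) y pop_event_edges(6)[OF t'(1)] t'(3) by blast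
      moreover have "k = j"
        using pop_event_col_gap[OF t, of k] pop_event_col_gap[OF t'(1), of j] pop_event_edges[OF t'(1)] e \<open>h = p\<close>
        by (cases "k < j"; cases "j < k") auto
      ultimately show "k = j \<and> p \<noteq> Suc j" using t' by simp
    qed (use t that in auto)
    then show ?thesis using TN u[OF b(1)] by auto
  next
    case TB
    have "Rel TB j k \<longleftrightarrow> k = i \<and> pr Take i p" if "p \<noteq> Suc j" for k
    proof
      assume "Rel TB j k"
      then obtain h s' where t': "pop_event j h k s'" "pr Take k h" by auto
      have "h = p" using take_unique e(1,2) pop_event_edges(1,2)[OF t'(1)] by blast
      moreover have "k = i"
        using pop_event_col_gap[OF t, of k] pop_event_col_gap[OF t'(1), of i] pop_event_edges[OF t'(1)] e \<open>h = p\<close> by auto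
      ultimately show "k = i \<and> pr Take i p" using t' by simp
    qed (use t that in auto)
    then show ?thesis using TB u[OF b(2)] by auto
  qed
qed

text \<open>The checks fix the accumulators edge by edge, along rows for \<open>Fut\<close> and
  columns for \<open>Past\<close>, and the value at a position is read off at the end of its row or
  column. Hierarchical diamonds are fixed by a single pop event or by the absence of a
  context.\<close>

lemma dia_unique:
  assumes L: "dia_ok L r g" "consist L v" and L': "dia_ok L' r g" "consist L' v'"
    and g: "\<And>k. v g k \<longleftrightarrow> v' g k" and i: "i \<le> Suc n"
  shows "v (Dia r g) i \<longleftrightarrow> v' (Dia r g) i"
proof -
  note c = L(2)[unfolded consist_def, rule_format] and c' = L'(2)[unfolded consist_def, rule_format]
  note d = L(1)[unfolded dia_ok_def] and d' = L'(1)[unfolded dia_ok_def]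
  have prec: "prec_at M (L i p) = Some \<pi> \<longleftrightarrow> pr \<pi> i p" "prec_at M (L' i p) = Some \<pi> \<longleftrightarrow> pr \<pi> i p"
    if "edge i p" for i p \<pi>
    using c[OF that] c'[OF that] by (auto simp: prec_at_def prel_def)
  have hit: "hit M C (L i p) \<longleftrightarrow> cond C i p" "hit M C (L' i p) \<longleftrightarrow> cond C i p" if "edge i p" for i p C
    using c[OF that] c'[OF that] prec[OF that] by (auto simp: hit_def cond_def)
  have fresh: "fresh_ok M (L i (Suc i)) r g" "fresh_ok M (L' i (Suc i)) r g" if "i \<le> n" for i
    using d d' that by auto
  have pop: "pop_ok M (L j p) (L i s) (L i p) r g" "pop_ok M (L' j p) (L' i s) (L' i p) r g"
    if "pop_event j p i s" for j p i s using d d' that by auto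
  have zero: "v (Dia r g) 0 \<longleftrightarrow> v' (Dia r g) 0" if "r \<in> range Past \<union> {YN, YB}"
    using d d' c[OF edge_init] c'[OF edge_init] that by (auto simp: first_ok_def)
  have final: "v (Dia r g) (Suc n) \<longleftrightarrow> v' (Dia r g) (Suc n)" if "r \<in> range Fut \<union> {YN, TN, TB}"
    using d d' c[OF edge_final] c'[OF edge_final] that by (auto simp: last_ok_def)
  have col: "\<exists>h. edge h i \<and> \<not> pr Take h i \<and> col_ok M (L h i) r g \<and> col_ok M (L' h i) r g" if "i \<noteq> 0"
    using col_end_exists[of i] i that d d' by (metis One_nat_def Suc_leI neq0_conv)
  have row: "\<exists>p. edge i p \<and> row_ok M (L i p) r g \<and> row_ok M (L' i p) r g" if "i \<noteq> Suc n"
    using row_end_exists[of i] i that d d' by (metis le_SucE)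
  show ?thesis
  proof (cases r)
    case (Fut C)
    have acc: "edge i p \<Longrightarrow> Dia r g \<in> acc (L i p) \<longleftrightarrow> Dia r g \<in> acc (L' i p)" for i p
    proof (induction p rule: less_induct)
      case (less p)
      note cc = c[OF less.prems] c'[OF less.prems] hit[OF less.prems]
      show ?case
      proof (cases "p = Suc i")
        case True
        then show ?thesis using fresh[of i] edge_less[OF less.prems] cc g unfolding Fut by auto
      next
        case False
        then obtain j s where t: "pop_event j p i s" using nonfresh_pop_event less.prems by blast
        have "Dia r g \<in> acc (L i s) \<longleftrightarrow> Dia r g \<in> acc (L' i s)" using less.IH[of s] pop_event_edges[OF t] by auto
        then show ?thesis using pop[OF t] cc g unfolding Fut by auto
      qed
    qed
    show ?thesis
    proof (cases "i = Suc n")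
      case False
      then obtain p where p: "edge i p" "row_ok M (L i p) r g" "row_ok M (L' i p) r g" using row by blast
      then show ?thesis using acc[OF p(1)] c[OF p(1)] c'[OF p(1)] unfolding Fut by auto
    qed (use final Fut in auto)
  next
    case (Past C)
    have acc: "edge i p \<Longrightarrow> Dia r g \<in> acc (L i p) \<longleftrightarrow> Dia r g \<in> acc (L' i p)" for i p
    \<comment> \<open>A column starts at its fresh edge and descends in \<open>i\<close>, so the
      preceding edge \<open>(j, p)\<close> is shorter.\<close>
    proof (induction "p - i" arbitrary: i rule: less_induct)
      case less
      note cc = c[OF less.prems] c'[OF less.prems] hit[OF less.prems]
      show ?case
      proof (cases "p = Suc i")
        case True
        then show ?thesis using fresh[of i] edge_less[OF less.prems] cc g unfolding Past by auto
      next
        case False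
        then obtain j s where t: "pop_event j p i s" using nonfresh_pop_event less.prems by blast
        have "Dia r g \<in> acc (L j p) \<longleftrightarrow> Dia r g \<in> acc (L' j p)" using less.hyps[of j] pop_event_edges[OF t] by auto
        then show ?thesis using pop[OF t] cc g unfolding Past by auto
      qed
    qed
    show ?thesis
    proof (cases "i = 0")
      case False
      then obtain h where p: "edge h i" "col_ok M (L h i) r g" "col_ok M (L' h i) r g" using col by blast
      then show ?thesis using acc[OF p(1)] c[OF p(1)] c'[OF p(1)] unfolding Past by auto
    qed (use zero Past in auto)
  next
    case YN
    show ?thesis
    proof (cases "i = 0 \<or> i = Suc n")
      case False
      then obtain h where p: "edge h i" "col_ok M (L h i) r g" "col_ok M (L' h i) r g" using col by blast
      note cc = c[OF p(1)] c'[OF p(1)] prec[OF p(1)]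
      show ?thesis
      proof (cases "i = Suc h \<or> \<not> pr Yield h i")
        case True
        then show ?thesis using p(2,3) cc unfolding YN by auto
      next
        case F: False
        have "i \<le> n" using False i by simp
        then obtain j k where t: "pop_event j k h i" using push_pop_event[OF p(1)] F by blast
        have e: "edge h k" using pop_event_edges[OF t] by simp
        show ?thesis using pop[OF t] c[OF e] c'[OF e] prec[OF e] cc g F unfolding YN by auto
      qed
    qed (use zero final YN in auto)
  next
    case YB
    show ?thesis
    proof (cases "i = 0")
      case False
      then obtain h where p: "edge h i" "col_ok M (L h i) r g" "col_ok M (L' h i) r g" using col by blast
      note cc = c[OF p(1)] c'[OF p(1)] prec[OF p(1)]
      show ?thesis
      proof (cases "i = Suc h \<or> \<not> pr Yield h i")
        case True
        then show ?thesis using p(2,3) cc unfolding YB by auto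
      next
        case F: False
        then obtain j s where t: "pop_event j i h s" using nonfresh_pop_event[OF p(1)] by blast
        have e: "edge h s" using pop_event_edges[OF t] by simp
        show ?thesis using pop[OF t] c[OF e] c'[OF e] prec[OF e] cc g F unfolding YB by auto
      qed
    qed (use zero YB in auto)
  next
    case TN
    show ?thesis
    proof (cases "i = Suc n")
      case False
      then obtain p where p: "edge i p" "row_ok M (L i p) r g" "row_ok M (L' i p) r g" using row by blast
      note cc = c[OF p(1)] c'[OF p(1)] prec[OF p(1)]
      show ?thesis
      proof (cases "p = Suc i \<or> \<not> pr Take i p")
        case True
        then show ?thesis using p(2,3) cc unfolding TN by auto
      next
        case F: False
        then obtain j s where t: "pop_event j p i s" using nonfresh_pop_event[OF p(1)] by blast
        have e: "edge j p" using pop_event_edges[OF t] by simp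
        show ?thesis using pop[OF t] c[OF e] c'[OF e] prec[OF e] cc g F unfolding TN by auto
      qed
    qed (use final TN in auto)
  next
    case TB
    show ?thesis
    proof (cases "i = Suc n")
      case False
      then obtain p where p: "edge i p" "row_ok M (L i p) r g" "row_ok M (L' i p) r g" using row by blast
      note cc = c[OF p(1)] c'[OF p(1)] prec[OF p(1)]
      show ?thesis
      proof (cases "p = Suc i \<or> \<not> pr Take i p")
        case True
        then show ?thesis using p(2,3) cc unfolding TB by auto
      next
        case F: False
        then obtain h s where t: "pop_event i p h s" using take_pop_event[OF p(1)] by blast
        have e: "edge h p" using pop_event_edges[OF t] by simp
        show ?thesis using pop[OF t] c[OF e] c'[OF e] prec[OF e] cc g F unfolding TB by auto
      qed
    qed (use final TB in auto)
  qed
qed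

text \<open>The canonical labelling for the true values of this diamond passes the checks, so
  \<open>dia_unique\<close> forces the guessed values to be these.\<close>

lemma dia_sound:
  assumes "dia_ok L r g" "consist L v" "i \<le> Suc n"
  shows "v (Dia r g) i \<longleftrightarrow> (\<exists>k. Rel r i k \<and> v g k)"
proof -
  define u where "u = v(Dia r g := (\<lambda>i. \<exists>k. Rel r i k \<and> v g k))"
  \<comment> \<open>Hence the update at the diamond leaves the values of \<open>g\<close>
    alone.\<close>
  have "g \<noteq> Dia r g" by (rule size_neq_size_imp_neq) simp
  then have ug: "u g = v g" unfolding u_def by simp
  have "dia_ok (canon {Dia r g} u) r g"
    by (rule dia_ok_canon) (simp_all add: ug, simp add: u_def)
  from dia_unique[OF assms(1,2) this consist_canon _ assms(3)] show ?thesis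
    using ug unfolding u_def by simp
qed

text \<open>Each relation moves strictly in one direction within the word, so the unfolding
  determines \<open>w\<close> by induction on the distance \<open>m\<close> to the end towards which
  it moves.\<close>

lemma fix_unique:
  assumes "\<And>i. i \<le> Suc n \<Longrightarrow> w i \<longleftrightarrow> c i \<and> (B i \<or> A i \<and> (\<exists>k. Rel r i k \<and> w k))" "i \<le> Suc n"
  shows "w i \<longleftrightarrow> holds_fix (Rel r) c A B i"
proof -
  define m where "m i = (case r of Fut _ \<Rightarrow> Suc n - i | YN \<Rightarrow> Suc n - i | TN \<Rightarrow> Suc n - i | _ \<Rightarrow> i)" for i
  have m: "Rel r i k \<Longrightarrow> m k < m i \<and> k \<le> Suc n" for i k
    using Rel_less[of r i k] unfolding m_def by (cases r) (auto simp del: Rel.simps)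
  show ?thesis using assms(2)
  proof (induction "m i" arbitrary: i rule: less_induct)
    case less
    have "(\<exists>k. Rel r i k \<and> w k) \<longleftrightarrow> (\<exists>k. Rel r i k \<and> holds_fix (Rel r) c A B k)"
      using less.hyps m by blast
    then show ?case using assms(1)[OF less.prems] holds_fix_unfold[of "Rel r" c A B i] by simp
  qed
qed

end

subsection \<open>Correctness and size\<close>

text \<open>A \<open>Fix\<close> brings along the diamond that its unfolding mentions; the argument
  of that diamond is the \<open>Fix\<close> itself, so nothing further arises.\<close>

primrec closure :: "'a core \<Rightarrow> 'a core set" where
  "closure CTrue = {CTrue}"
| "closure (CAtom a) = {CAtom a}"
| "closure (CNeg f) = insert (CNeg f) (closure f)"
| "closure (COr f g) = insert (COr f g) (closure f \<union> closure g)"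
| "closure (Dia r f) = insert (Dia r f) (closure f)"
| "closure (Fix r c A B) = insert (Fix r c A B) (insert (Dia r (Fix r c A B)) (closure c \<union> closure A \<union> closure B))"

primrec parts :: "'a core \<Rightarrow> 'a core set" where
  "parts CTrue = {}"
| "parts (CAtom a) = {}"
| "parts (CNeg f) = {f}"
| "parts (COr f g) = {f, g}"
| "parts (Dia r f) = {f}"
| "parts (Fix r c A B) = {c, A, B, Dia r (Fix r c A B)}"

lemma self_closure: "f \<in> closure f"
  by (cases f) auto

lemma parts_closure: "g \<in> closure f \<Longrightarrow> parts g \<subseteq> closure f"
  by (induction f) (auto simp: self_closure)

lemma finite_closure: "finite (closure f)"
  by (induction f) auto

primrec csize :: "'a core \<Rightarrow> nat" where
  "csize CTrue = 1"
| "csize (CAtom a) = 1"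
| "csize (CNeg f) = 1 + csize f"
| "csize (COr f g) = 1 + csize f + csize g"
| "csize (Dia r f) = 1 + csize f"
| "csize (Fix r c A B) = 2 + csize c + csize A + csize B"

lemma card_insert_bound: "finite A \<Longrightarrow> card A \<le> m \<Longrightarrow> card (insert a A) \<le> Suc m"
  by (simp add: card_insert_if)

lemma card_Un_bound: "card A \<le> k \<Longrightarrow> card B \<le> m \<Longrightarrow> card (A \<union> B) \<le> k + m"
  using card_Un_le[of A B] by linarith

lemma card_closure: "card (closure f) \<le> csize f"
proof (induction f)
  case (Fix r c A B)
  have "card (closure c \<union> closure A \<union> closure B) \<le> csize c + csize A + csize B"
    using Fix by (intro card_Un_bound)
  then have "card (closure (Fix r c A B)) \<le> Suc (Suc (csize c + csize A + csize B))"
    unfolding closure.simps by (intro card_insert_bound) (auto simp: finite_closure)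
  then show ?case by simp
next
  case (COr f g)
  then show ?case using card_insert_bound[OF _ card_Un_bound[OF COr]] by (simp add: finite_closure)
qed (auto simp: card_insert_bound finite_closure)

text \<open>The worst case is a hierarchical until or since: two for \<open>Fix\<close> and its
  diamond, two for the context test in the guard.\<close>

lemma csize_core_of: "csize (core_of \<phi>) \<le> 4 * potl_length \<phi>"
  by (induction \<phi>) (auto split: hprec.split)

text \<open>Conditions within one position. Diamonds relate positions and are left to the checks at
  edges.\<close>

fun loc_ok :: "'a symb \<Rightarrow> 'a core set \<Rightarrow> 'a core \<Rightarrow> bool" where
  "loc_ok a V CTrue \<longleftrightarrow> CTrue \<in> V"
| "loc_ok a V (CAtom p) \<longleftrightarrow> (CAtom p \<in> V \<longleftrightarrow> (\<exists>A. a = Some A \<and> p \<in> A))"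
| "loc_ok a V (CNeg f) \<longleftrightarrow> (CNeg f \<in> V \<longleftrightarrow> f \<notin> V)"
| "loc_ok a V (COr f g) \<longleftrightarrow> (COr f g \<in> V \<longleftrightarrow> f \<in> V \<or> g \<in> V)"
| "loc_ok a V (Dia r f) \<longleftrightarrow> True"
| "loc_ok a V (Fix r c A B) \<longleftrightarrow>
     (Fix r c A B \<in> V \<longleftrightarrow> c \<in> V \<and> (B \<in> V \<or> A \<in> V \<and> Dia r (Fix r c A B) \<in> V))"

definition valid :: "'a core set \<Rightarrow> 'a astate \<Rightarrow> bool" where
  "valid S q \<longleftrightarrow> cur q \<subseteq> S \<and> nxt q \<subseteq> S \<and> acc q \<subseteq> S \<and>
     (\<forall>f\<in>S. loc_ok (cur_lab q) (cur q) f \<and> loc_ok (nxt_lab q) (nxt q) f)"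

definition all_dia :: "'a core set \<Rightarrow> (rel \<Rightarrow> 'a core \<Rightarrow> bool) \<Rightarrow> bool" where
  "all_dia S P \<longleftrightarrow> (\<forall>r g. Dia r g \<in> S \<longrightarrow> P r g)"

text \<open>Reading a position ends its column, so \<open>col_ok\<close> is due at \<open>q\<close>,
  and opens its fresh edge, so \<open>fresh_ok\<close> is due at \<open>q'\<close>.\<close>

definition read_ok :: "'a opm \<Rightarrow> 'a core set \<Rightarrow> 'a astate \<Rightarrow> 'a letter \<Rightarrow> 'a astate \<Rightarrow> bool" where
  "read_ok M S q b q' \<longleftrightarrow> valid S q \<and> valid S q' \<and> nxt_lab q = Some b \<and> cur_lab q' = Some b \<and> cur q' = nxt q \<and> is_fresh q' \<and>
     all_dia S (fresh_ok M q') \<and> all_dia S (col_ok M q)"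

text \<open>A shift or a pop removes the top and so ends its row, hence \<open>row_ok\<close>; after
  a push the row resumes at the matching pop. The initial edge is \<open>(0, 1)\<close>, so position
  1 is \<open>nxt\<close> there.\<close>

definition potl_opa :: "'a opm \<Rightarrow> 'a core \<Rightarrow> ('a astate, 'a) opa" where
  "potl_opa M f = (let S = closure f in
    \<lparr>states = {q. valid S q},
     initial = {q. valid S q \<and> cur_lab q = None \<and> is_fresh q \<and> f \<in> nxt q \<and> all_dia S (fresh_ok M q) \<and> all_dia S (first_ok q)},
     final = {q. valid S q \<and> cur_lab q = None \<and> nxt_lab q = None \<and> all_dia S (col_ok M q) \<and> all_dia S (row_ok M q) \<and>
       all_dia S (last_ok q)},
     push = {(q, b, q'). read_ok M S q b q'},
     shift = {(q, b, q'). read_ok M S q b q' \<and> all_dia S (row_ok M q)},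
     pop = {(q, qs, q'). valid S q \<and> valid S qs \<and> valid S q' \<and> cur_lab q' = cur_lab qs \<and> cur q' = cur qs \<and>
       nxt_lab q' = nxt_lab q \<and> nxt q' = nxt q \<and> \<not> is_fresh q' \<and> all_dia S (row_ok M q) \<and> all_dia S (pop_ok M q qs q')}\<rparr>)"

section \<open>Runs of the automaton for a formula\<close>

context good_word begin

text \<open>The order of the run: a fresh edge comes after column \<open>i\<close>, any other edge
  after the popped edge and the push edge of its event.\<close>

lemma edge_induct [consumes 1, case_names fresh pop]:
  assumes "edge i p"
    and fresh: "\<And>i. i \<le> n \<Longrightarrow> (\<And>h. edge h i \<Longrightarrow> P h i) \<Longrightarrow> P i (Suc i)"
    and pop: "\<And>j p i s. pop_event j p i s \<Longrightarrow> P j p \<Longrightarrow> P i s \<Longrightarrow> P i p"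
  shows "P i p"
  using assms(1)
proof (induction p arbitrary: i rule: less_induct)
  case (less p)
  note outer = less.IH
  from less.prems show ?case
  proof (induction "p - i" arbitrary: i rule: less_induct)
    case less
    show ?case
    proof (cases "p = Suc i")
      case True
      then show ?thesis using fresh[of i] outer edge_less[OF less.prems] by auto
    next
      case False
      then obtain j s where t: "pop_event j p i s" using nonfresh_pop_event less.prems by blast
      then show ?thesis using pop[OF t] less.hyps[of j] outer[of s i] pop_event_edges[OF t] by auto
    qed
  qed
qed

lemma edge_read:
  assumes "edge i p" "\<not> pr Take i p" shows "p \<le> n \<and> (pr Yield i p \<or> pr Equal i p) \<or> i = 0 \<and> p = Suc n"
proof -
  obtain \<pi> where "pr \<pi> i p" using edge_prec[OF assms(1)] .
  then have "pr Yield i p \<or> pr Equal i p" using assms(2) by (cases \<pi>) auto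
  moreover have "i = 0" if "p = Suc n"
  proof (rule ccontr)
    assume "i \<noteq> 0"
    then show False using prel_end[of i Take] assms edge_less[OF assms(1)] that by auto
  qed
  ultimately show ?thesis using edge_less[OF assms(1)] by auto
qed

text \<open>\<open>V\<close> takes the guess for a position from the fresh edge leading to it;
  position 0 has none, so its guess comes from the initial state.\<close>

context
  fixes f0 :: "'a core" and L :: "nat \<Rightarrow> nat \<Rightarrow> 'a astate" and S V v
  assumes run: "run_labelling (potl_opa M f0) L"
  defines "S \<equiv> closure f0"
    and "V \<equiv> \<lambda>p. if p = 0 then cur (L 0 1) else nxt (L (p - 1) p)"
    and "v \<equiv> \<lambda>f p. f \<in> V p"
begin

lemma run_initial:
  "valid S (L 0 1)" "cur_lab (L 0 1) = None" "is_fresh (L 0 1)" "f0 \<in> nxt (L 0 1)"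
  "all_dia S (fresh_ok M (L 0 1))" "all_dia S (first_ok (L 0 1))"
  using run unfolding run_labelling_def potl_opa_def Let_def S_def by auto

lemma run_final:
  "nxt_lab (L 0 (Suc n)) = None" "all_dia S (col_ok M (L 0 (Suc n)))"
  "all_dia S (row_ok M (L 0 (Suc n)))" "all_dia S (last_ok (L 0 (Suc n)))"
  using run unfolding run_labelling_def potl_opa_def Let_def S_def by auto

lemma run_read:
  assumes "edge i p" "\<not> pr Take i p" "p \<le> n" shows "read_ok M S (L i p) (x ! (p - 1)) (L p (Suc p))"
  using run edge_read[OF assms(1,2)] assms unfolding run_labelling_def potl_opa_def Let_def S_def by auto

lemma run_shift:
  assumes "edge i p" "pr Equal i p" "p \<le> n" shows "all_dia S (row_ok M (L i p))"
  using run assms unfolding run_labelling_def potl_opa_def Let_def S_def by auto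

lemma run_pop:
  assumes "pop_event j p i s"
  shows "valid S (L i p)" "cur_lab (L i p) = cur_lab (L i s)" "cur (L i p) = cur (L i s)" "nxt_lab (L i p) = nxt_lab (L j p)"
    "nxt (L i p) = nxt (L j p)" "\<not> is_fresh (L i p)" "all_dia S (row_ok M (L j p))" "all_dia S (pop_ok M (L j p) (L i s) (L i p))"
proof -
  have "(L j p, L i s, L i p) \<in> pop (potl_opa M f0)" using run assms unfolding run_labelling_def by blast
  then show "valid S (L i p)" "cur_lab (L i p) = cur_lab (L i s)" "cur (L i p) = cur (L i s)" "nxt_lab (L i p) = nxt_lab (L j p)"
    "nxt (L i p) = nxt (L j p)" "\<not> is_fresh (L i p)" "all_dia S (row_ok M (L j p))" "all_dia S (pop_ok M (L j p) (L i s) (L i p))"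
    unfolding potl_opa_def Let_def S_def by simp_all
qed

text \<open>A pop copies row data from the push edge and column data from the popped edge; reading
  turns \<open>nxt\<close> into \<open>cur\<close>. The next label is only compared within its
  column, since it is confirmed later, in \<open>run_lb\<close>.\<close>

lemma run_edge:
  assumes "edge i p"
  shows "valid S (L i p) \<and> cur_lab (L i p) = lab i \<and> nxt_lab (L i p) = nxt_lab (L (p - 1) p) \<and>
    (is_fresh (L i p) \<longleftrightarrow> p = Suc i) \<and> cur (L i p) = V i \<and> nxt (L i p) = V p"
  using assms
proof (induction rule: edge_induct)
  case (fresh i)
  show ?case
  proof (cases "i = 0")
    case True
    then show ?thesis using run_initial unfolding V_def by auto
  next
    case False
    obtain h where h: "edge h i" "\<not> pr Take h i" using col_end_exists[of i] False fresh(1) by auto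
    have "lab i = Some (x ! (i - 1))" using lab_letter[of i] False fresh(1) by auto
    then show ?thesis using run_read[OF h fresh(1)] fresh(2)[OF h(1)] unfolding read_ok_def
      by (simp add: V_def)
  qed
next
  case (pop j p i s)
  then show ?case using run_pop[OF pop(1)] pop_event_edges(7-9)[OF pop(1)] by auto
qed

text \<open>The guessed label is confirmed at the end of the column, by the letter read or by the
  final state, and \<open>run_edge\<close> carries this to the whole column.\<close>

lemma run_lb:
  assumes "edge i p" shows "nxt_lab (L i p) = lab p"
proof -
  have "1 \<le> p" "p \<le> Suc n" using edge_less[OF assms] by auto
  then obtain h where h: "edge h p" "\<not> pr Take h p" using col_end_exists by blast
  have "nxt_lab (L h p) = lab p"
  proof (cases "p \<le> n")
    case True
    then show ?thesis using run_read[OF h True] lab_letter[of p] \<open>1 \<le> p\<close> unfolding read_ok_def by auto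
  next
    case False
    then have "h = 0" "p = Suc n" using edge_read[OF h] by auto
    then show ?thesis using run_final by simp
  qed
  then show ?thesis using run_edge[OF h(1)] run_edge[OF assms] by simp
qed

lemma run_consist: "consist L v"
  unfolding consist_def using run_edge run_lb by (simp add: v_def)

lemma run_dia:
  assumes "Dia r g \<in> S" shows "dia_ok L r g"
  unfolding dia_ok_def
proof (intro conjI allI impI)
  show "first_ok (L 0 1) r g" "last_ok (L 0 (Suc n)) r g"
    using run_initial run_final assms unfolding all_dia_def by blast+
next
  fix i assume i: "i \<le> n"
  show "fresh_ok M (L i (Suc i)) r g"
  proof (cases "i = 0")
    case True
    then show ?thesis using run_initial assms unfolding all_dia_def by auto
  next
    case False
    obtain h where h: "edge h i" "\<not> pr Take h i" using col_end_exists[of i] False i by auto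
    show ?thesis using run_read[OF h i] assms unfolding read_ok_def all_dia_def by blast
  qed
next
  fix i p assume e: "edge i p" "\<not> pr Take i p"
  show "col_ok M (L i p) r g"
  proof (cases "p \<le> n")
    case True
    then show ?thesis using run_read[OF e True] assms unfolding read_ok_def all_dia_def by blast
  next
    case False
    then have "i = 0" "p = Suc n" using edge_read[OF e] by auto
    then show ?thesis using run_final assms unfolding all_dia_def by blast
  qed
next
  fix i p assume e: "edge i p" "\<not> pr Yield i p \<or> i = 0 \<and> p = Suc n"
  \<comment> \<open>A row ends in the final state, at a pop or at a shift, and each of them includes
    \<open>row_ok\<close>.\<close>
  consider "i = 0 \<and> p = Suc n" | "pr Take i p" | "pr Equal i p" "p \<le> n"
    using e edge_read[OF e(1)] by blast
  then show "row_ok M (L i p) r g"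
  proof cases
    case 1
    then show ?thesis using run_final assms unfolding all_dia_def by blast
  next
    case 2
    then obtain h s where t: "pop_event i p h s" using take_pop_event[OF e(1)] by blast
    then show ?thesis using run_pop(7)[OF t] assms unfolding all_dia_def by blast
  next
    case 3
    then show ?thesis using run_shift[OF e(1) 3] assms unfolding all_dia_def by blast
  qed
next
  fix j p i s assume "pop_event j p i s"
  then show "pop_ok M (L j p) (L i s) (L i p) r g" using run_pop(8) assms unfolding all_dia_def by blast
qed

lemma run_local:
  assumes "f \<in> S" "p \<le> Suc n" shows "loc_ok (lab p) (V p) f"
proof (cases p)
  case 0
  then show ?thesis using run_initial assms unfolding valid_def V_def by auto
next
  case (Suc i)
  then have e: "edge i p" using edge_fresh assms by simp
  show ?thesis using run_edge[OF e] run_lb[OF e] assms unfolding valid_def by metis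
qed

text \<open>For a \<open>Fix\<close>, its local condition and the meaning of its diamond together
  form the unfolding equation, which has only one solution by \<open>fix_unique\<close>.\<close>

lemma run_csat:
  assumes "f \<in> S" "p \<le> Suc n" shows "v f p \<longleftrightarrow> csat f p"
proof -
  have dia: "v (Dia r g) i \<longleftrightarrow> (\<exists>k. Rel r i k \<and> v g k)" if "Dia r g \<in> S" "i \<le> Suc n" for r g i
    using dia_sound[OF run_dia run_consist] that by blast
  have sub: "parts f \<subseteq> S" if "f \<in> S" for f using parts_closure that unfolding S_def by blast
  show ?thesis using assms
  proof (induction f arbitrary: p)
    case (Dia r g)
    have "g \<in> S" using sub[OF Dia.prems(1)] by simp
    then have "(\<exists>k. Rel r p k \<and> v g k) \<longleftrightarrow> (\<exists>k. Rel r p k \<and> csat g k)"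
      using Dia.IH by (intro Dia_cong) blast
    then show ?case using dia[OF Dia.prems] by simp
  next
    case (Fix r c A B)
    let ?f = "Fix r c A B"
    have s: "c \<in> S" "A \<in> S" "B \<in> S" "Dia r ?f \<in> S" using sub[OF Fix.prems(1)] by auto
    have *: "v ?f i \<longleftrightarrow> csat c i \<and> (csat B i \<or> csat A i \<and> (\<exists>k. Rel r i k \<and> v ?f k))" if "i \<le> Suc n" for i
      using run_local[OF Fix.prems(1) that] dia[OF s(4) that] Fix.IH(1)[OF s(1) that]
        Fix.IH(2)[OF s(2) that] Fix.IH(3)[OF s(3) that] by (simp add: v_def)
    show ?case unfolding csat.simps by (rule fix_unique[OF * Fix.prems(2)])
  next
    case (CNeg f)
    have "f \<in> S" using sub[OF CNeg.prems(1)] by simp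
    then show ?case using run_local[OF CNeg.prems] CNeg.IH[of p] CNeg.prems by (simp add: v_def)
  next
    case (COr f g)
    have "f \<in> S" "g \<in> S" using sub[OF COr.prems(1)] by auto
    then show ?case using run_local[OF COr.prems] COr.IH(1)[of p] COr.IH(2)[of p] COr.prems by (simp add: v_def)
  next
    case CTrue
    then show ?case using run_local[OF CTrue] by (simp add: v_def)
  next
    case (CAtom a)
    then show ?case using run_local[OF CAtom] by (simp add: v_def)
  qed
qed

lemma run_sound: "csat f0 1"
  using run_csat[of f0 1] run_initial(4) self_closure unfolding S_def v_def V_def by auto

end

lemma run_complete:
  assumes "csat f0 1" shows "\<exists>L. run_labelling (potl_opa M f0) L"
proof -
  define S where "S = closure f0"
  \<comment> \<open>Cutting the truth values down to \<open>S\<close> keeps the states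
    \<open>valid\<close>.\<close>
  define u where "u f i \<longleftrightarrow> f \<in> S \<and> csat f i" for f i
  let ?L = "canon S u"
  have sub: "parts f \<subseteq> S" if "f \<in> S" for f using parts_closure that unfolding S_def by blast
  have ok: "dia_ok ?L r g" if d: "Dia r g \<in> S" for r g
    using d sub[OF d] by (intro dia_ok_canon) (auto simp: u_def simp del: Rel.simps)
  have loc: "loc_ok (lab i) {f. u f i} f" if f: "f \<in> S" for f i
  proof (cases f)
    case (Fix r c A B)
    then show ?thesis
      using f sub[OF f] holds_fix_unfold[of "Rel r" "csat c" "csat A" "csat B" i] by (simp add: u_def)
  qed (use f sub[OF f] in \<open>auto simp: u_def\<close>)
  have valid: "valid S (?L i p)" for i p
    using loc unfolding valid_def by (auto simp: canon_def u_def)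
  have cn: "cur (?L i p) = {f. u f i}" "nxt (?L i p) = {f. u f p}" for i p by (auto simp: canon_def)
  note d = ok[unfolded dia_ok_def]
  have read: "read_ok M S (?L i p) (x ! (p - 1)) (?L p (Suc p))" if "edge i p" "\<not> pr Take i p" "p \<le> n" for i p
    using that d valid lab_letter[of p] edge_less[OF that(1)] unfolding read_ok_def all_dia_def
    by (auto simp: cn)
  have row: "all_dia S (row_ok M (?L i p))" if "edge i p" "\<not> pr Yield i p \<or> i = 0 \<and> p = Suc n" for i p
    using that d unfolding all_dia_def by blast
  have Y: "\<not> pr Take i p" "\<not> pr Equal i p" if "pr Yield i p" for i p using prel_unique that by blast+
  have E: "\<not> pr Take i p" "\<not> pr Yield i p" if "pr Equal i p" for i p using prel_unique that by blast+
  have "run_labelling (potl_opa M f0) ?L"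
    unfolding run_labelling_def
  proof (intro conjI allI impI)
    have "all_dia S (fresh_ok M (?L 0 1))" "all_dia S (first_ok (?L 0 1))"
      using d unfolding all_dia_def by auto
    then show "?L 0 1 \<in> initial (potl_opa M f0)"
      using valid[of 0 1] assms self_closure[of f0] unfolding potl_opa_def Let_def S_def[symmetric]
      by (auto simp: u_def)
    have "all_dia S (col_ok M (?L 0 (Suc n)))" "all_dia S (last_ok (?L 0 (Suc n)))"
      using d edge_final unfolding all_dia_def by auto
    then show "?L 0 (Suc n) \<in> final (potl_opa M f0)"
      using valid[of 0 "Suc n"] row[OF edge_final] unfolding potl_opa_def Let_def S_def[symmetric] by auto
  next
    fix i p assume "edge i p" "p \<le> n" "pr Yield i p"
    then show "(?L i p, x ! (p - 1), ?L p (Suc p)) \<in> push (potl_opa M f0)"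
      using read Y unfolding potl_opa_def Let_def S_def[symmetric] by auto
  next
    fix i p assume "edge i p" "p \<le> n" "pr Equal i p"
    then show "(?L i p, x ! (p - 1), ?L p (Suc p)) \<in> shift (potl_opa M f0)"
      using read E row unfolding potl_opa_def Let_def S_def[symmetric] by auto
  next
    fix j p i s assume t: "pop_event j p i s"
    have "\<not> pr Yield j p" using pop_event_edges(2)[OF t] prel_unique by blast
    then have "all_dia S (row_ok M (?L j p))" using row pop_event_edges(1)[OF t] by blast
    moreover have "all_dia S (pop_ok M (?L j p) (?L i s) (?L i p))" using d t unfolding all_dia_def by blast
    moreover have "\<not> is_fresh (?L i p)" using pop_event_edges(7-9)[OF t] by simp
    ultimately show "(?L j p, ?L i s, ?L i p) \<in> pop (potl_opa M f0)"
      using valid unfolding potl_opa_def Let_def S_def[symmetric] by (auto simp: cn)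
  qed
  then show ?thesis by blast
qed

lemma run_labelling_potl_opa: "(\<exists>L. run_labelling (potl_opa M f) L) \<longleftrightarrow> csat f 1"
  using run_sound run_complete by blast

end

text \<open>If the skeleton does not reach its final configuration, \<open>x\<close> is in neither
  language, by \<open>opa_language_iff\<close> and \<open>compatible_good\<close>.\<close>

lemma opa_language_potl_opa:
  assumes M: "\<And>b. M None b = Some Yield" "\<And>a. M (Some a) None = Some Take"
  shows "opa_language M (potl_opa M (core_of \<phi>)) = potl_language M \<phi>"
proof (rule set_eqI)
  fix x
  interpret op_word M x by unfold_locales (use M in auto)
  show "x \<in> opa_language M (potl_opa M (core_of \<phi>)) \<longleftrightarrow> x \<in> potl_language M \<phi>"
  proof (cases "reach (Suc n) []")
    case True
    interpret good_word M x by unfold_locales (rule True)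
    show ?thesis
      using opa_language_iff[of "potl_opa M (core_of \<phi>)"] run_labelling_potl_opa True compatible sat_csat[of 1 \<phi>]
      unfolding potl_language_def by auto
  next
    case False
    then show ?thesis using opa_language_iff[of "potl_opa M (core_of \<phi>)"] compatible_good unfolding potl_language_def by auto
  qed
qed

section \<open>Renaming states to natural numbers\<close>

definition rename_opa :: "('q \<Rightarrow> 'r) \<Rightarrow> ('q, 'a) opa \<Rightarrow> ('r, 'a) opa" where
  "rename_opa h \<A> = \<lparr>states = h ` states \<A>, initial = h ` initial \<A>, final = h ` final \<A>,
     push = (\<lambda>(p, b, q). (h p, b, h q)) ` push \<A>,
     shift = (\<lambda>(p, b, q). (h p, b, h q)) ` shift \<A>,
     pop = (\<lambda>(p, q, r). (h p, h q, h r)) ` pop \<A>\<rparr>"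

text \<open>Applied to \<open>h\<close> and then to its inverse on the states, this gives both
  inclusions in \<open>opa_language_rename\<close>.\<close>

lemma (in op_word) run_labelling_rename:
  fixes \<A> :: "('q, 'a) opa" and h :: "'q \<Rightarrow> 'r"
  assumes "run_labelling \<A> L" shows "run_labelling (rename_opa h \<A>) (\<lambda>i p. h (L i p))"
proof -
  have "(h a, b, h c) \<in> (\<lambda>(p, b, q). (h p, b, h q)) ` X" if "(a, b, c) \<in> X" for a b c and X :: "('q \<times> 'a letter \<times> 'q) set"
    using that by force
  moreover have "(h a, h b, h c) \<in> (\<lambda>(p, q, r). (h p, h q, h r)) ` X" if "(a, b, c) \<in> X" for a b c X
    using that by force
  ultimately show ?thesis
    using assms unfolding run_labelling_def rename_opa_def by simp
qed

lemma image_id_on: "(\<And>a. a \<in> A \<Longrightarrow> k a = a) \<Longrightarrow> k ` A = A"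
  by force

lemma rename_inverse:
  assumes "is_opa \<A>" "\<And>q. q \<in> states \<A> \<Longrightarrow> g (h q) = q"
  shows "rename_opa g (rename_opa h \<A>) = \<A>"
proof -
  have s: "initial \<A> \<subseteq> states \<A>" "final \<A> \<subseteq> states \<A>" "push \<A> \<subseteq> states \<A> \<times> UNIV \<times> states \<A>"
    "shift \<A> \<subseteq> states \<A> \<times> UNIV \<times> states \<A>" "pop \<A> \<subseteq> states \<A> \<times> states \<A> \<times> states \<A>"
    using assms(1) unfolding is_opa_def by auto
  have "(\<lambda>q. g (h q)) ` states \<A> = states \<A>" "(\<lambda>q. g (h q)) ` initial \<A> = initial \<A>"
    "(\<lambda>q. g (h q)) ` final \<A> = final \<A>"
    "(\<lambda>t. case (case t of (p, b, q) \<Rightarrow> (h p, b, h q)) of (p, b, q) \<Rightarrow> (g p, b, g q)) ` push \<A> = push \<A>"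
    "(\<lambda>t. case (case t of (p, b, q) \<Rightarrow> (h p, b, h q)) of (p, b, q) \<Rightarrow> (g p, b, g q)) ` shift \<A> = shift \<A>"
    "(\<lambda>t. case (case t of (p, q, r) \<Rightarrow> (h p, h q, h r)) of (p, q, r) \<Rightarrow> (g p, g q, g r)) ` pop \<A> = pop \<A>"
    by (rule image_id_on; use s assms(2) in auto)+
  then show ?thesis by (intro opa.equality) (simp_all add: rename_opa_def image_image)
qed

lemma opa_language_rename:
  assumes M: "\<And>b. M None b = Some Yield" "\<And>a. M (Some a) None = Some Take"
    and "is_opa \<A>" "inj_on h (states \<A>)"
  shows "opa_language M (rename_opa h \<A>) = opa_language M \<A>"
proof (rule set_eqI)
  fix x
  interpret op_word M x by unfold_locales (use M in auto)
  let ?g = "inv_into (states \<A>) h"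
  have inv: "rename_opa ?g (rename_opa h \<A>) = \<A>"
    by (rule rename_inverse[OF assms(3)]) (rule inv_into_f_f[OF assms(4)])
  have "run_labelling \<A> (\<lambda>i p. ?g (L i p))" if "run_labelling (rename_opa h \<A>) L" for L
    using run_labelling_rename[OF that, of ?g] unfolding inv .
  then have "(\<exists>L. run_labelling (rename_opa h \<A>) L) \<longleftrightarrow> (\<exists>L. run_labelling \<A> L)"
    using run_labelling_rename by blast
  then show "x \<in> opa_language M (rename_opa h \<A>) \<longleftrightarrow> x \<in> opa_language M \<A>"
    unfolding opa_language_iff by simp
qed

lemma is_opa_rename: "is_opa \<A> \<Longrightarrow> is_opa (rename_opa h \<A>)"
  unfolding is_opa_def rename_opa_def by auto

text \<open>A state consists of two labels, one bit and three subsets of the closure.\<close>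

lemma states_potl_opa:
  fixes f :: "'a::finite core"
  shows "finite (states (potl_opa M f))"
    "card (states (potl_opa M f)) \<le> 2 * card (UNIV :: 'a symb set) * card (UNIV :: 'a symb set) * 2 ^ (3 * card (closure f))"
proof -
  let ?S = "Pow (closure f)"
  let ?D = "(UNIV :: 'a symb set) \<times> (UNIV :: 'a symb set) \<times> (UNIV :: bool set) \<times> ?S \<times> ?S \<times> ?S"
  let ?g = "\<lambda>(a, b, c, C, N, A). AState a b c C N A"
  have sub: "states (potl_opa M f) \<subseteq> ?g ` ?D"
  proof
    fix q assume "q \<in> states (potl_opa M f)"
    then have "valid (closure f) q" by (simp add: potl_opa_def Let_def)
    then have "(cur_lab q, nxt_lab q, is_fresh q, cur q, nxt q, acc q) \<in> ?D" by (auto simp: valid_def)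
    moreover have "q = ?g (cur_lab q, nxt_lab q, is_fresh q, cur q, nxt q, acc q)" by simp
    ultimately show "q \<in> ?g ` ?D" by (rule rev_image_eqI)
  qed
  have fin: "finite ?D" by (simp add: finite_closure)
  show "finite (states (potl_opa M f))" using sub fin finite_surj by blast
  have "card (states (potl_opa M f)) \<le> card ?D" using sub fin by (meson surj_card_le)
  also have "\<dots> = 2 * card (UNIV :: 'a symb set) * card (UNIV :: 'a symb set) * (2 ^ card (closure f)) ^ 3"
    by (simp add: card_cartesian_product card_Pow finite_closure power3_eq_cube)
  finally show "card (states (potl_opa M f)) \<le> 2 * card (UNIV :: 'a symb set) * card (UNIV :: 'a symb set) * 2 ^ (3 * card (closure f))"
    by (simp add: power_mult[symmetric] mult.commute)
qed

lemma is_opa_potl_opa: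
  fixes f :: "'a::finite core"
  shows "is_opa (potl_opa M f)"
  unfolding is_opa_def using states_potl_opa(1)[of M f]
  by (auto simp: potl_opa_def Let_def read_ok_def)

lemma potl_length_pos: "1 \<le> potl_length \<phi>"
  by (cases \<phi>) auto

theorem theorem3:
  fixes SL :: "'a::finite set" and M :: "'a opm"
  assumes "is_opm SL M"
  shows "\<exists>f :: nat \<Rightarrow> nat. (\<lambda>n. real (f n)) \<in> O(\<lambda>n. real n) \<and>
    (\<forall>\<phi> :: 'a potl. wf_potl \<phi> \<longrightarrow>
      (\<exists>\<A> :: (nat, 'a) opa. is_opa \<A> \<and> opa_language M \<A> = potl_language M \<phi> \<and>
         card (states \<A>) \<le> 2 ^ f (potl_length \<phi>)))"
proof -
  have M: "M None b = Some Yield" "M (Some a) None = Some Take" for a b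
    using assms unfolding is_opm_def by auto
  let ?c = "2 * card (UNIV :: 'a symb set) * card (UNIV :: 'a symb set)"
  \<comment> \<open>The 12 is three sets times four closure elements per symbol; the factor
    \<open>?c\<close> moves into the exponent by \<open>?c \<le> 2 ^ ?c\<close>.\<close>
  let ?f = "\<lambda>n. (?c + 12) * n"
  have "\<exists>\<A> :: (nat, 'a) opa. is_opa \<A> \<and> opa_language M \<A> = potl_language M \<phi> \<and>
         card (states \<A>) \<le> 2 ^ ?f (potl_length \<phi>)" for \<phi> :: "'a potl"
  proof -
    let ?A = "potl_opa M (core_of \<phi>)"
    obtain h :: "'a astate \<Rightarrow> nat" where h: "inj_on h (states ?A)"
      using finite_imp_inj_to_nat_seg[OF states_potl_opa(1)] by metis
    have "card (states (rename_opa h ?A)) = card (states ?A)"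
      unfolding rename_opa_def using card_image[OF h] by simp
    also have "\<dots> \<le> ?c * 2 ^ (3 * card (closure (core_of \<phi>)))" by (rule states_potl_opa(2))
    also have "\<dots> \<le> 2 ^ ?c * 2 ^ (3 * card (closure (core_of \<phi>)))"
      by (intro mult_right_mono) (simp_all add: less_imp_le less_exp)
    also have "\<dots> = 2 ^ (?c + 3 * card (closure (core_of \<phi>)))" by (simp add: power_add)
    also have "\<dots> \<le> 2 ^ ?f (potl_length \<phi>)"
    proof (rule power_increasing)
      have "card (closure (core_of \<phi>)) \<le> 4 * potl_length \<phi>" using card_closure csize_core_of le_trans by blast
      moreover have "?c \<le> ?c * potl_length \<phi>" using potl_length_pos[of \<phi>] by simp
      ultimately show "?c + 3 * card (closure (core_of \<phi>)) \<le> ?f (potl_length \<phi>)"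
        unfolding add_mult_distrib by linarith
    qed simp
    finally have "card (states (rename_opa h ?A)) \<le> 2 ^ ?f (potl_length \<phi>)" .
    moreover have "opa_language M (rename_opa h ?A) = potl_language M \<phi>"
      using opa_language_rename[of M, OF M is_opa_potl_opa h] opa_language_potl_opa[of M, OF M] by simp
    ultimately show ?thesis using is_opa_rename[OF is_opa_potl_opa] by blast
  qed
  moreover have "(\<lambda>n. real (?f n)) \<in> O(\<lambda>n. real n)"
    by (intro bigoI[of _ "real (?c + 12)"]) (simp add: algebra_simps)
  ultimately show ?thesis by (intro exI[of _ ?f]) blast
qed

end
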